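(* Let $(W,S)$ be an affine Coxeter system (a Coxeter system with $S$ finite each of whose irreducible components is of affine type). Then $L_{\mathrm{Shi}}(W,S)=L(W,S)$.
   Context: Let $(W,S)$ be a Coxeter system with Coxeter matrix $(m_{st})$ and length function $\ell$. Let $V$ be the real vector space with basis $\Delta=\{\alpha_s:s\in S\}$ and symmetric bilinear form $B(\alpha_s,\alpha_t)=-\cos(\pi/m_{st})$ if $m_{st}<\infty$ and $-1$ if $m_{st}=\infty$. $W$ acts on $V$ by $s(x)=x-2B(\alpha_s,x)\alpha_s$. The root system is $\Phi=W(\Delta)$, with positive roots $\Phi^+=\Phi\cap\operatorname{cone}(\Delta)$ (nonnegative combinations) and $\Phi^-=-\Phi^+$. The inversion set of $w\in W$ is $N(w)=\Phi^+\cap w(\Phi^-)$; $\ell(w)=|N(w)|$. Dominance order on $\Phi^+$: $\alpha\preceq_{\mathrm{dom}}\beta$ iff for all $w\in W$, $\beta\in N(w)$ implies $\alpha\in N(w)$. A positive root is small if it dominates no root other than itself; $\Sigma(W,S)$ denotes the (finite) set of small roots. An element $w\in W$ is low if $N(w)=\operatorname{cone}(\Sigma(W,S)\cap N(w))\cap\Phi$; $L(W,S)$ is the set of low elements. Let $W$ act on the dual $V^*$ by $(wf)(x)=f(w^{-1}x)$. For $\alpha\in\Phi$ put $H_\alpha=\{f\in V^*:f(\alpha)=0\}$. Let $C=\{f\in V^*:f(\alpha_s)>0\ \forall s\in S\}$, $D=\overline{C}$, and let $\mathcal U(W)=\bigcup_{w\in W}wD$ be the Tits cone. The Shi regions are the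 connected components of $\mathcal U(W)\setminus\bigcup_{\alpha\in\Sigma(W,S)}H_\alpha$. Write $u\sim_{\mathrm{Shi}}w$ if the chambers $uC$ and $wC$ lie in the same Shi region, and $L_{\mathrm{Shi}}(W,S)=\{w\in W: u\sim_{\mathrm{Shi}}w\Rightarrow \ell(w)\le\ell(u)\}$. *)

theory Defs
  imports "HOL-Analysis.Analysis" "HOL-Algebra.Generated_Groups" "HOL-Algebra.Multiplicative_Group"
begin

subsection \<open>Coxeter systems\<close>

text \<open>
  The entry \<open>m\<^sub>s\<^sub>t\<close> is the order of \<open>st\<close>; as usual for \<^const>\<open>group.ord\<close>, the value \<open>0\<close> stands
  for \<open>\<infinity>\<close>.
\<close>

definition cox_entry :: "('w, 'b) monoid_scheme \<Rightarrow> 'w \<Rightarrow> 'w \<Rightarrow> nat" where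
  "cox_entry W s t = group.ord W (s \<otimes>\<^bsub>W\<^esub> t)"

definition word_value :: "('w, 'b) monoid_scheme \<Rightarrow> 'w list \<Rightarrow> 'w" where
  "word_value W ws = foldr (\<lambda>s x. s \<otimes>\<^bsub>W\<^esub> x) ws \<one>\<^bsub>W\<^esub>"

text \<open>
  The congruence on words over \<open>S\<close> generated by \<open>(st)\<^sup>m = 1\<close>, \<open>m = m\<^sub>s\<^sub>t\<close>. For \<open>s = t\<close> the relation
  reads \<open>ss = 1\<close>, so formal inverses of generators are not needed: the monoid with this presentation
  is the group with this presentation. For \<open>m\<^sub>s\<^sub>t = \<infinity>\<close> (encoded by \<open>0\<close>) the relation is void.
\<close>

inductive cox_cong :: "('w, 'b) monoid_scheme \<Rightarrow> 'w set \<Rightarrow> 'w list \<Rightarrow> 'w list \<Rightarrow> bool"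
  for W and S where
  rel: "us \<in> lists S \<Longrightarrow> vs \<in> lists S \<Longrightarrow> s \<in> S \<Longrightarrow> t \<in> S \<Longrightarrow>
    cox_cong W S (us @ concat (replicate (cox_entry W s t) [s, t]) @ vs) (us @ vs)"
| refl: "us \<in> lists S \<Longrightarrow> cox_cong W S us us"
| sym: "cox_cong W S us vs \<Longrightarrow> cox_cong W S vs us"
| trans: "cox_cong W S us vs \<Longrightarrow> cox_cong W S vs xs \<Longrightarrow> cox_cong W S us xs"

locale coxeter_system = group W for W :: "('w, 'b) monoid_scheme" (structure) +
  fixes S :: "'w set"
  assumes gens_closed: "S \<subseteq> carrier W"
    and gens_order_two: "s \<in> S \<Longrightarrow> s \<noteq> \<one> \<and> s \<otimes> s = \<one>"
    and gens_generate: "generate W S = carrier W"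
    and presentation: "us \<in> lists S \<Longrightarrow> vs \<in> lists S \<Longrightarrow> word_value W us = word_value W vs \<Longrightarrow>
      cox_cong W S us vs"
begin

definition len :: "'w \<Rightarrow> nat" where
  "len w = (LEAST n. \<exists>ws\<in>lists S. length ws = n \<and> word_value W ws = w)"

definition cox_graph :: "('w \<times> 'w) set" where
  "cox_graph = {(s, t). s \<in> S \<and> t \<in> S \<and> s \<noteq> t \<and> cox_entry W s t \<noteq> 2}"

definition irreducible_components :: "'w set set" where
  "irreducible_components = {cox_graph\<^sup>* `` {s} | s. s \<in> S}"

end


subsection \<open>The geometric representation and its root system\<close>

text \<open>
  \<open>V\<close> is the whole type \<open>'v\<close>, with basis \<open>\<alpha>\<^sub>s\<close> for \<open>s \<in> S\<close>.
\<close>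

locale coxeter_geometric = coxeter_system W S
  for W :: "('w, 'b) monoid_scheme" (structure) and S :: "'w set" +
  fixes \<alpha> :: "'w \<Rightarrow> 'v::real_vector"
  assumes finite_gens: "finite S"
    and simple_inj: "inj_on \<alpha> S"
    and simple_independent: "independent (\<alpha> ` S)"
    and simple_span: "span (\<alpha> ` S) = UNIV"
begin

definition coord :: "'v \<Rightarrow> 'w \<Rightarrow> real" where
  "coord x s = representation (\<alpha> ` S) x (\<alpha> s)"

definition form :: "'v \<Rightarrow> 'v \<Rightarrow> real" where
  "form x y = (\<Sum>s\<in>S. \<Sum>t\<in>S. coord x s * coord y t *
     (if cox_entry W s t = 0 then -1 else - cos (pi / real (cox_entry W s t))))"

definition refl_by :: "'w \<Rightarrow> 'v \<Rightarrow> 'v" where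
  "refl_by s x = x - (2 * form (\<alpha> s) x) *\<^sub>R \<alpha> s"

text \<open>
  An element \<open>w = s\<^sub>1 \<cdots> s\<^sub>k\<close> acts as the composite of the reflections in \<open>s\<^sub>1, \<dots>, s\<^sub>k\<close>. This
  does not depend on the word chosen, since the reflections satisfy the defining relations.
\<close>

definition act :: "'w \<Rightarrow> 'v \<Rightarrow> 'v" where
  "act w = foldr (\<lambda>s f. refl_by s \<circ> f) (SOME ws. ws \<in> lists S \<and> word_value W ws = w) id"

definition roots :: "'v set" where
  "roots = {act w (\<alpha> s) | w s. w \<in> carrier W \<and> s \<in> S}"

text \<open>
  \<open>cone(A)\<close>, the set of nonnegative combinations of \<open>A\<close> (with \<open>cone({}) = {0}\<close>), is
  \<open>convex_cone hull A\<close>; see the lemma at the end.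
\<close>

definition pos_roots :: "'v set" where
  "pos_roots = roots \<inter> (convex_cone hull (\<alpha> ` S))"

definition neg_roots :: "'v set" where
  "neg_roots = uminus ` pos_roots"

definition inv_set :: "'w \<Rightarrow> 'v set" where
  "inv_set w = pos_roots \<inter> act w ` neg_roots"

text \<open>\<open>dom_le a b\<close> means that \<open>b\<close> dominates \<open>a\<close>.\<close>

definition dom_le :: "'v \<Rightarrow> 'v \<Rightarrow> bool" where
  "dom_le a b \<longleftrightarrow> a \<in> pos_roots \<and> b \<in> pos_roots \<and>
     (\<forall>w\<in>carrier W. b \<in> inv_set w \<longrightarrow> a \<in> inv_set w)"

definition small_roots :: "'v set" where
  "small_roots = {b \<in> pos_roots. \<forall>a\<in>pos_roots. dom_le a b \<longrightarrow> a = b}"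

definition low_elements :: "'w set" where
  "low_elements = {w \<in> carrier W.
     inv_set w = (convex_cone hull (small_roots \<inter> inv_set w)) \<inter> roots}"


subsection \<open>The Tits cone and the Shi arrangement\<close>

text \<open>
  The dual space is a closed subset of \<open>'v \<Rightarrow> real\<close> with the product topology. The topology induced
  on it is that of pointwise convergence, which is the usual one as \<open>V\<close> is finite-dimensional, so
  closures and components may be taken in \<open>'v \<Rightarrow> real\<close>.
\<close>

definition dual_space :: "('v \<Rightarrow> real) set" where
  "dual_space = {f. linear f}"

definition dual_act :: "'w \<Rightarrow> ('v \<Rightarrow> real) \<Rightarrow> 'v \<Rightarrow> real" where
  "dual_act w f = (\<lambda>x. f (act (inv w) x))"

definition hyperplane :: "'v \<Rightarrow> ('v \<Rightarrow> real) set" where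
  "hyperplane a = {f \<in> dual_space. f a = 0}"

definition fund_chamber :: "('v \<Rightarrow> real) set" where
  "fund_chamber = {f \<in> dual_space. \<forall>s\<in>S. f (\<alpha> s) > 0}"

definition tits_cone :: "('v \<Rightarrow> real) set" where
  "tits_cone = (\<Union>w\<in>carrier W. dual_act w ` closure fund_chamber)"

definition shi_regions :: "('v \<Rightarrow> real) set set" where
  "shi_regions = components (tits_cone - (\<Union>a\<in>small_roots. hyperplane a))"

definition shi_equiv :: "'w \<Rightarrow> 'w \<Rightarrow> bool" where
  "shi_equiv u w \<longleftrightarrow>
     (\<exists>R\<in>shi_regions. dual_act u ` fund_chamber \<subseteq> R \<and> dual_act w ` fund_chamber \<subseteq> R)"

definition shi_minimal_elements :: "'w set" where
  "shi_minimal_elements = {w \<in> carrier W. \<forall>u\<in>carrier W. shi_equiv u w \<longrightarrow> len w \<le> len u}"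


subsection \<open>Affine type\<close>

text \<open>
  An irreducible component \<open>J\<close> is of affine type if the form, restricted to the span of the \<open>\<alpha>\<^sub>s\<close>
  with \<open>s \<in> J\<close>, is positive semidefinite but not positive definite.
\<close>

definition affine_type :: "'w set \<Rightarrow> bool" where
  "affine_type J \<longleftrightarrow> (\<forall>x\<in>span (\<alpha> ` J). form x x \<ge> 0) \<and>
     \<not> (\<forall>x\<in>span (\<alpha> ` J). x \<noteq> 0 \<longrightarrow> form x x > 0)"

definition affine_system :: bool where
  "affine_system \<longleftrightarrow> (\<forall>J\<in>irreducible_components. affine_type J)"

end

lemma convex_cone_hull_nonneg_combinations:
  fixes A :: "'v::real_vector set"
  shows "convex_cone hull A =
    {\<Sum>a\<in>F. c a *\<^sub>R a | F c. finite F \<and> F \<subseteq> A \<and> (\<forall>a\<in>F. 0 \<le> c a)}" (is "_ = ?N")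
proof (rule hull_unique)
  show "A \<subseteq> ?N"
  proof
    fix a assume "a \<in> A"
    then show "a \<in> ?N"
      by (auto intro!: exI[of _ "{a}"] exI[of _ "\<lambda>_. 1 :: real"])
  qed
  show "convex_cone ?N"
    unfolding convex_cone_iff
  proof (intro conjI ballI allI impI)
    show "0 \<in> ?N"
      by (auto intro!: exI[of _ "{}"])
  next
    fix x y assume "x \<in> ?N" "y \<in> ?N"
    then obtain F c G d where x: "x = (\<Sum>a\<in>F. c a *\<^sub>R a)" "finite F" "F \<subseteq> A" "\<forall>a\<in>F. 0 \<le> c a"
      and y: "y = (\<Sum>a\<in>G. d a *\<^sub>R a)" "finite G" "G \<subseteq> A" "\<forall>a\<in>G. 0 \<le> d a"
      by blast
    define e where "e a = (if a \<in> F then c a else 0) + (if a \<in> G then d a else 0)" for a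
    have "x = (\<Sum>a\<in>F \<union> G. (if a \<in> F then c a else 0) *\<^sub>R a)"
      unfolding x(1) using x(2) y(2) by (intro sum.mono_neutral_cong_left) auto
    moreover have "y = (\<Sum>a\<in>F \<union> G. (if a \<in> G then d a else 0) *\<^sub>R a)"
      unfolding y(1) using x(2) y(2) by (intro sum.mono_neutral_cong_left) auto
    ultimately have "x + y = (\<Sum>a\<in>F \<union> G. e a *\<^sub>R a)"
      by (simp add: e_def scaleR_add_left sum.distrib)
    moreover have "\<forall>a\<in>F \<union> G. 0 \<le> e a"
      using x(4) y(4) by (auto simp: e_def)
    ultimately show "x + y \<in> ?N"
      using x(2,3) y(2,3) by (intro CollectI exI[of _ "F \<union> G"] exI[of _ e]) auto
  next
    fix x and r :: real assume "x \<in> ?N" "0 \<le> r"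
    then obtain F c where x: "x = (\<Sum>a\<in>F. c a *\<^sub>R a)" "finite F" "F \<subseteq> A" "\<forall>a\<in>F. 0 \<le> c a"
      by blast
    then have "r *\<^sub>R x = (\<Sum>a\<in>F. (r * c a) *\<^sub>R a)" "\<forall>a\<in>F. 0 \<le> r * c a"
      using \<open>0 \<le> r\<close> by (auto simp: scaleR_sum_right)
    then show "r *\<^sub>R x \<in> ?N"
      using x(2,3) by (intro CollectI exI[of _ F] exI[of _ "\<lambda>a. r * c a"]) auto
  qed
next
  fix K assume K: "A \<subseteq> K" "convex_cone K"
  show "?N \<subseteq> K"
  proof
    fix x assume "x \<in> ?N"
    then obtain F c where x: "x = (\<Sum>a\<in>F. c a *\<^sub>R a)" "finite F" "F \<subseteq> A" "\<forall>a\<in>F. 0 \<le> c a"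
      by blast
    have "(\<Sum>a\<in>F. c a *\<^sub>R a) \<in> K"
      using x(2-4)
    proof (induction F rule: finite_induct)
      case empty
      then show ?case using K(2) by (simp add: convex_cone_contains_0)
    next
      case (insert a F)
      then show ?case using K by (auto intro!: convex_cone_add convex_cone_scaleR)
    qed
    then show "x \<in> K" using x(1) by simp
  qed
qed

end

theory Submission
  imports Defs
begin

text \<open>
  Fix \<open>w\<close> and let \<open>R\<close> be the set of all \<open>u\<close>
  whose inversion set contains the small inversions of \<open>w\<close>. Small roots are bipodal: if a small root
  lies in a finite rank two system \<open>u \<Phi>\<^sub>s\<^sub>,\<^sub>t\<close> with positive simple roots and is not simple there, then
  both simple roots are small. Hence, if \<open>us, ut < u\<close> all lie in \<open>R\<close>, so does the minimal element of
  the coset \<open>u W\<^sub>s\<^sub>,\<^sub>t\<close>. By Newman's diamond argument every connected piece of \<open>R\<close> has a unique locally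
  minimal element. If all right descent roots of \<open>w\<close> are small, then \<open>w\<close> is locally minimal, so
  \<open>N(w) \<subseteq> N(u)\<close> for every \<open>u\<close> reached from \<open>w\<close> inside \<open>R\<close>. A root of \<open>N(w)\<close> outside
  \<open>cone(\<Sigma> \<inter> N(w))\<close> would be separated from this cone by a functional, which can be moved into the
  interior of the Tits cone; walking towards it leads to a \<open>u\<close> violating the inclusion. So \<open>w\<close> is low.
  A Shi-minimal \<open>w\<close> has small descent roots, because otherwise \<open>wC\<close> and \<open>wsC\<close> share a facet that lies
  on no small hyperplane. Conversely, elements in the same Shi region have the same small inversions,
  and these generate \<open>N(w)\<close> as a cone when \<open>w\<close> is low.
\<close>

subsection \<open>Words and length in a Coxeter system\<close>

text \<open>Affine type enters through the radical of the form. The form is semidefinite, and the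
  nonnegative radical vectors of one component lie on a single ray, with full support. If b properly
  dominates a, then B(a, b) >= 1 forces b - a to have norm <= 0, so b - a is a nonnegative radical
  vector, and W fixes it. Dominance thus becomes translation along the radical, and bipodality
  amounts to carrying such a translation through a rank two system by reflections.

  The obstacle is the final separation. A walk towards a functional is known to stop when only
  finitely many positive roots are negative on it, and this holds once it is positive on all nonzero
  nonnegative radical vectors. A functional from Farkas' lemma has no reason to be. Dominance helps
  again: a root b of N(w) outside the cone properly dominates a small root a, which is then an
  inversion of w and lies in the cone. The functional therefore has a strict sign on b - a, hence on
  the radical ray of the component of b. On the other components it is replaced by a point of the
  chamber of w.\<close>

fun alternating_word :: "'a \<Rightarrow> 'a \<Rightarrow> nat \<Rightarrow> 'a list" where
  "alternating_word s t 0 = []"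
| "alternating_word s t (Suc k) = (if even k then t else s) # alternating_word s t k"

lemma length_alternating_word [simp]: "length (alternating_word s t k) = k"
  by (induction k) auto

lemma alternating_word_in_lists: "s \<in> A \<Longrightarrow> t \<in> A \<Longrightarrow> alternating_word s t k \<in> lists A"
  by (induction k) auto

lemma alternating_word_add:
  "\<exists>us. us \<in> lists {s, t} \<and> alternating_word s t (j + k) = us @ alternating_word s t k"
proof (induction j)
  case (Suc j)
  then obtain us where "us \<in> lists {s, t}" "alternating_word s t (j + k) = us @ alternating_word s t k"
    by blast
  then show ?case
    by (intro exI[of _ "(if even (j + k) then t else s) # us"]) auto
qed auto

lemma concat_replicate_pair: "concat (replicate m [s, t]) = alternating_word s t (2 * m)"
  by (induction m) auto

context coxeter_system
begin

lemma word_value_simps [simp]: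
  "word_value W [] = \<one>" "word_value W (s # ws) = s \<otimes> word_value W ws"
  by (simp_all add: word_value_def)

lemma gen_closed [simp]: "s \<in> S \<Longrightarrow> s \<in> carrier W"
  using gens_closed by blast

lemma word_value_closed [simp]: "ws \<in> lists S \<Longrightarrow> word_value W ws \<in> carrier W"
  by (induction ws) auto

lemma word_value_append [simp]:
  "us \<in> lists S \<Longrightarrow> vs \<in> lists S \<Longrightarrow> word_value W (us @ vs) = word_value W us \<otimes> word_value W vs"
  by (induction us) (auto simp: m_assoc)

lemma gen_square [simp]: "s \<in> S \<Longrightarrow> s \<otimes> s = \<one>"
  using gens_order_two by blast

lemma gen_inv [simp]: "s \<in> S \<Longrightarrow> inv s = s"
  using gen_square inv_equality by fastforce

lemma gen_cancel_right [simp]: "s \<in> S \<Longrightarrow> w \<in> carrier W \<Longrightarrow> w \<otimes> s \<otimes> s = w"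
  by (simp add: m_assoc)

lemma gen_cancel_left [simp]: "s \<in> S \<Longrightarrow> w \<in> carrier W \<Longrightarrow> s \<otimes> (s \<otimes> w) = w"
  by (simp flip: m_assoc)

lemma word_value_rev: "ws \<in> lists S \<Longrightarrow> word_value W (rev ws) = inv (word_value W ws)"
proof (induction ws)
  case (Cons s ws)
  then have "rev ws \<in> lists S" "[s] \<in> lists S" "ws \<in> lists S" "s \<in> S"
    by auto
  then show ?case
    using Cons.IH word_value_append[of "rev ws" "[s]"] inv_mult_group[of s "word_value W ws"]
    by simp
qed simp

lemma ex_word:
  assumes "w \<in> carrier W"
  shows "\<exists>ws\<in>lists S. word_value W ws = w"
proof -
  have "w \<in> generate W S"
    using assms gens_generate by simp
  then show ?thesis
  proof induction
    case one
    then show ?case by (intro bexI[of _ "[]"]) auto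
  next
    case (incl h)
    then show ?case by (intro bexI[of _ "[h]"]) auto
  next
    case (inv h)
    then show ?case by (intro bexI[of _ "[h]"]) auto
  next
    case (eng h1 h2)
    then obtain us vs where "us \<in> lists S" "word_value W us = h1" "vs \<in> lists S" "word_value W vs = h2"
      by blast
    then show ?case by (intro bexI[of _ "us @ vs"]) auto
  qed
qed

lemma len_word_value_le: "ws \<in> lists S \<Longrightarrow> len (word_value W ws) \<le> length ws"
  unfolding len_def by (rule Least_le) auto

lemma ex_reduced_word:
  assumes "w \<in> carrier W"
  shows "\<exists>ws\<in>lists S. length ws = len w \<and> word_value W ws = w"
proof -
  have "\<exists>n. \<exists>ws\<in>lists S. length ws = n \<and> word_value W ws = w"
    using ex_word[OF assms] by auto
  from LeastI_ex[OF this] show ?thesis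
    by (simp add: len_def)
qed

lemma len_one [simp]: "len \<one> = 0"
  using len_word_value_le[of "[]"] by simp

lemma len_eq_0: "w \<in> carrier W \<Longrightarrow> len w = 0 \<Longrightarrow> w = \<one>"
  using ex_reduced_word by fastforce

lemma len_mult_le:
  assumes "v \<in> carrier W" "w \<in> carrier W"
  shows "len (v \<otimes> w) \<le> len v + len w"
proof -
  obtain us vs where "us \<in> lists S" "length us = len v" "word_value W us = v"
    "vs \<in> lists S" "length vs = len w" "word_value W vs = w"
    using assms ex_reduced_word by meson
  then show ?thesis
    using len_word_value_le[of "us @ vs"] by simp
qed

lemma len_gen_le: "s \<in> S \<Longrightarrow> len s \<le> 1"
  using len_word_value_le[of "[s]"] by simp

text \<open>A relator (st)^m has even length 2m, so parity of length is an invariant of the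
  congruence. This is what excludes that a generator leaves the length unchanged.\<close>

lemma cox_cong_parity: "cox_cong W S us vs \<Longrightarrow> even (length us) = even (length vs)"
  by (induction rule: cox_cong.induct) (auto simp: concat_replicate_pair)

lemma parity_len:
  assumes "ws \<in> lists S"
  shows "even (len (word_value W ws)) = even (length ws)"
proof -
  obtain vs where "vs \<in> lists S" "length vs = len (word_value W ws)" "word_value W vs = word_value W ws"
    using assms ex_reduced_word word_value_closed by meson
  then show ?thesis
    using presentation[of vs ws] assms cox_cong_parity by fastforce
qed

lemma len_mult_gen_parity:
  assumes "w \<in> carrier W" "s \<in> S"
  shows "even (len (w \<otimes> s)) \<noteq> even (len w)"
proof -
  obtain ws where "ws \<in> lists S" "word_value W ws = w"
    using assms ex_word by blast
  then show ?thesis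
    using parity_len[of ws] parity_len[of "ws @ [s]"] assms by simp
qed

lemma len_mult_gen_cases:
  assumes "w \<in> carrier W" "s \<in> S"
  shows "len (w \<otimes> s) = len w + 1 \<or> len w = len (w \<otimes> s) + 1"
proof -
  have "len (w \<otimes> s) \<le> len w + 1"
    using len_mult_le[of w s] len_gen_le[of s] assms by simp
  moreover have "len w \<le> len (w \<otimes> s) + 1"
    using len_mult_le[of "w \<otimes> s" s] len_gen_le[of s] assms by simp
  ultimately show ?thesis
    using len_mult_gen_parity[OF assms] by (cases "len w = len (w \<otimes> s)") auto
qed

lemma ex_right_descent:
  assumes "w \<in> carrier W" "w \<noteq> \<one>"
  shows "\<exists>s\<in>S. len w = len (w \<otimes> s) + 1"
proof -
  obtain ws where ws: "ws \<in> lists S" "length ws = len w" "word_value W ws = w"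
    using assms ex_reduced_word by blast
  with assms have "ws \<noteq> []" by auto
  then obtain us s where us: "ws = us @ [s]"
    using rev_exhaust by blast
  with ws have s: "s \<in> S" "us \<in> lists S" "w = word_value W us \<otimes> s"
    by auto
  then have "len (w \<otimes> s) \<le> length us"
    using len_word_value_le by simp
  with us ws s assms len_mult_gen_cases[of w s] show ?thesis
    by (intro bexI[of _ s]) auto
qed

lemma cox_entry_commute:
  assumes "s \<in> S" "t \<in> S"
  shows "cox_entry W s t = cox_entry W t s"
proof -
  have "inv (s \<otimes> t) = t \<otimes> s"
    using assms by (simp add: inv_mult_group)
  then show ?thesis
    using ord_inv[of "s \<otimes> t"] assms by (simp add: cox_entry_def)
qed

lemma cox_entry_refl: "s \<in> S \<Longrightarrow> cox_entry W s s = 1"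
  by (simp add: cox_entry_def)

lemma cox_entry_eq_1:
  assumes "s \<in> S" "t \<in> S" "cox_entry W s t = 1"
  shows "s = t"
proof -
  have "s \<otimes> t = \<one>"
    using assms ord_eq_1[of "s \<otimes> t"] by (auto simp: cox_entry_def)
  then show ?thesis
    using assms by (metis gen_closed gen_inv inv_equality)
qed

text \<open>The relation (st)^m = 1 is cut in the middle: its left half, inverted, spells the other
  alternating word. For \<open>m = 0\<close>, the code for infinity, both words are empty.\<close>

lemma alternating_word_braid:
  assumes "s \<in> S" "t \<in> S" "m = cox_entry W s t"
  shows "word_value W (alternating_word s t m) = word_value W (alternating_word t s m)"
proof -
  let ?A = "\<lambda>k. word_value W (alternating_word s t k)"
  let ?B = "\<lambda>k. word_value W (alternating_word t s k)"
  have cl [simp]: "?A k \<in> carrier W" "?B k \<in> carrier W" for k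
    using assms by (simp_all add: alternating_word_in_lists)
  have pow: "?A (2 * k) = (s \<otimes> t) [^] k" for k
    using assms
  proof (induction k)
    case (Suc k)
    then have "?A (2 * Suc k) = (s \<otimes> t) \<otimes> (s \<otimes> t) [^] k"
      by (simp add: m_assoc)
    also have "\<dots> = (s \<otimes> t) [^] Suc k"
      using assms nat_pow_Suc2[of "s \<otimes> t" k] by simp
    finally show ?case .
  qed simp
  \<comment> \<open>The first \<open>j\<close> letters of the long word, read backwards, spell
    \<open>?B j\<close>; the case \<open>j = m\<close> compares its two halves.\<close>
  have "?A (2 * m) = inv (?B j) \<otimes> ?A (2 * m - j)" if "j \<le> 2 * m" for j
    using that
  proof (induction j)
    case (Suc j)
    let ?x = "if even j then s else t"
    have x: "?x \<in> S"
      using assms by simp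
    obtain i where i: "2 * m - j = Suc i" "even i \<longleftrightarrow> odd j"
      using Suc.prems by (intro that[of "2 * m - Suc j"]) (auto simp: Suc_diff_le)
    then have "?A (2 * m - j) = ?x \<otimes> ?A i"
      by simp
    moreover have "?B (Suc j) = ?x \<otimes> ?B j"
      by simp
    then have "inv (?B (Suc j)) = inv (?B j) \<otimes> ?x"
      using inv_mult_group[OF gen_closed[OF x] cl(2)[of j]] gen_inv[OF x] by (simp only:)
    moreover have "?A (2 * m) = inv (?B j) \<otimes> ?A (2 * m - j)"
      using Suc.IH Suc.prems by simp
    moreover have "2 * m - Suc j = i"
      using i(1) by simp
    ultimately have "?A (2 * m) = inv (?B j) \<otimes> (?x \<otimes> ?A i)"
      by (simp only:)
    also have "\<dots> = inv (?B j) \<otimes> ?x \<otimes> ?A i"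
      using x by (intro m_assoc[symmetric]) auto
    also have "\<dots> = inv (?B (Suc j)) \<otimes> ?A (2 * m - Suc j)"
      using \<open>inv (?B (Suc j)) = inv (?B j) \<otimes> ?x\<close> \<open>2 * m - Suc j = i\<close> by (simp only:)
    finally show ?case .
  qed (use cl in \<open>simp del: alternating_word.simps(2)\<close>)
  from this[of m] have "\<one> = inv (?B m) \<otimes> ?A m"
    using pow[of m] assms by (simp add: cox_entry_def mult_2)
  then show ?thesis
    by (metis cl inv_closed inv_equality inv_inv)
qed

end


subsection \<open>The geometric representation\<close>

context coxeter_geometric
begin

definition gram :: "'w \<Rightarrow> 'w \<Rightarrow> real" where
  "gram s t = (if cox_entry W s t = 0 then -1 else - cos (pi / real (cox_entry W s t)))"

lemma gram_commute: "s \<in> S \<Longrightarrow> t \<in> S \<Longrightarrow> gram s t = gram t s"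
  by (simp add: gram_def cox_entry_commute)

lemma gram_refl [simp]: "s \<in> S \<Longrightarrow> gram s s = 1"
  by (simp add: gram_def cox_entry_refl)

lemma cox_entry_ge_2:
  assumes "s \<in> S" "t \<in> S" "s \<noteq> t" "cox_entry W s t \<noteq> 0"
  shows "cox_entry W s t \<ge> 2"
proof -
  have "cox_entry W s t \<noteq> 1"
    using assms cox_entry_eq_1 by blast
  with assms show ?thesis
    by linarith
qed

lemma gram_nonpos:
  assumes "s \<in> S" "t \<in> S" "s \<noteq> t"
  shows "gram s t \<le> 0"
proof (cases "cox_entry W s t = 0")
  case False
  with assms have "cox_entry W s t \<ge> 2"
    by (intro cox_entry_ge_2)
  then have "pi / real (cox_entry W s t) \<le> pi / 2"
    by (intro divide_left_mono) auto
  moreover have "- (pi / 2) \<le> 0" "0 \<le> pi / real (cox_entry W s t)"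
    by auto
  ultimately have "cos (pi / real (cox_entry W s t)) \<ge> 0"
    by (intro cos_ge_zero) linarith+
  then show ?thesis
    using False by (simp add: gram_def)
qed (simp add: gram_def)

lemma gram_neg:
  assumes "s \<in> S" "t \<in> S" "s \<noteq> t" "cox_entry W s t \<noteq> 2"
  shows "gram s t < 0"
proof (cases "cox_entry W s t = 0")
  case False
  with assms cox_entry_ge_2[of s t] have "cox_entry W s t \<ge> 3"
    by linarith
  then have "pi / real (cox_entry W s t) < pi / 2"
    by (intro divide_strict_left_mono) auto
  moreover have "- (pi / 2) < 0" "0 \<le> pi / real (cox_entry W s t)"
    by auto
  ultimately have "cos (pi / real (cox_entry W s t)) > 0"
    by (intro cos_gt_zero_pi) linarith+
  then show ?thesis
    using False by (simp add: gram_def)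
qed (simp add: gram_def)

lemma coord_add: "coord (x + y) s = coord x s + coord y s"
  and coord_scale: "coord (r *\<^sub>R x) s = r * coord x s"
  and coord_diff: "coord (x - y) s = coord x s - coord y s"
  and coord_neg: "coord (- x) s = - coord x s"
  and coord_zero: "coord 0 s = 0"
  using simple_independent simple_span
  by (simp_all add: coord_def real_vector.representation_add real_vector.representation_scale
      real_vector.representation_diff real_vector.representation_neg real_vector.representation_zero)

lemmas coord_simps = coord_add coord_scale coord_diff coord_neg coord_zero

lemma coord_simple: "s \<in> S \<Longrightarrow> t \<in> S \<Longrightarrow> coord (\<alpha> t) s = (if s = t then 1 else 0)"
  using simple_independent simple_inj
  by (auto simp: coord_def real_vector.representation_basis inj_on_def)

lemma linear_coord: "linear (\<lambda>x. coord x s)"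
  by (intro linearI) (simp_all add: coord_simps)

lemma coord_sum: "coord (\<Sum>a\<in>A. g a) s = (\<Sum>a\<in>A. coord (g a) s)"
  using linear_sum[OF linear_coord] .

lemma expand: "x = (\<Sum>s\<in>S. coord x s *\<^sub>R \<alpha> s)"
proof -
  have "x = (\<Sum>b\<in>\<alpha> ` S. representation (\<alpha> ` S) x b *\<^sub>R b)"
    using simple_independent simple_span finite_gens
    by (intro real_vector.sum_representation_eq[symmetric]) auto
  also have "\<dots> = (\<Sum>s\<in>S. coord x s *\<^sub>R \<alpha> s)"
    using simple_inj by (subst sum.reindex) (auto simp: coord_def)
  finally show ?thesis .
qed

lemma coord_eqI: "(\<And>s. s \<in> S \<Longrightarrow> coord x s = coord y s) \<Longrightarrow> x = y"
  by (subst expand, subst (2) expand) simp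

lemma linear_expand:
  fixes f :: "'v \<Rightarrow> 'a::real_vector"
  assumes "linear f"
  shows "f x = (\<Sum>s\<in>S. coord x s *\<^sub>R f (\<alpha> s))"
  using assms by (subst expand) (simp add: linear_sum linear_scale)

lemma coord_combination:
  "s \<in> S \<Longrightarrow> coord (\<Sum>t\<in>S. c t *\<^sub>R \<alpha> t) s = c s"
  using finite_gens by (simp add: coord_sum coord_simps coord_simple if_distrib cong: if_cong)

lemma form_gram: "form x y = (\<Sum>s\<in>S. \<Sum>t\<in>S. coord x s * coord y t * gram s t)"
  by (simp add: form_def gram_def)

lemma form_add_left: "form (x + y) z = form x z + form y z"
  and form_scale_left: "form (r *\<^sub>R x) z = r * form x z"
  by (simp_all add: form_gram coord_simps algebra_simps sum.distrib sum_distrib_left)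

lemma form_commute: "form x y = form y x"
  unfolding form_gram
  by (subst sum.swap) (auto intro!: sum.cong simp: gram_commute)

lemma form_add_right: "form z (x + y) = form z x + form z y"
  and form_scale_right: "form z (r *\<^sub>R x) = r * form z x"
  using form_add_left form_scale_left form_commute by metis+

lemma form_neg_left: "form (- x) z = - form x z"
  and form_neg_right: "form z (- x) = - form z x"
  using form_scale_left[of "-1"] form_scale_right[of _ "-1"] by auto

lemma form_diff_left: "form (x - y) z = form x z - form y z"
  and form_diff_right: "form z (x - y) = form z x - form z y"
  using form_add_left[of x "- y"] form_add_right[of z x "- y"]
  by (auto simp: form_neg_left form_neg_right)

lemma form_zero_left: "form 0 z = 0" and form_zero_right: "form z 0 = 0"
  using form_scale_left[of 0] form_scale_right[of _ 0] by auto

lemmas form_simps = form_add_left form_add_right form_scale_left form_scale_right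
  form_diff_left form_diff_right form_neg_left form_neg_right form_zero_left form_zero_right

lemma linear_form: "linear (form x)"
  by (intro linearI) (simp_all add: form_simps)

lemma form_simple: "s \<in> S \<Longrightarrow> t \<in> S \<Longrightarrow> form (\<alpha> s) (\<alpha> t) = gram s t"
  using finite_gens
  by (simp add: form_gram coord_simple if_distrib[where f = "\<lambda>x. x * _"] if_distrib[where f = "\<lambda>x. _ * x"]
      sum.delta' cong: if_cong)

lemma form_expand: "form x y = (\<Sum>s\<in>S. coord y s * form x (\<alpha> s))"
  using linear_expand[OF linear_form, of x y] by simp

section \<open>Reflections and the action of W on V\<close>

definition reflect :: "'v \<Rightarrow> 'v \<Rightarrow> 'v" where
  "reflect a x = x - (2 * form a x) *\<^sub>R a"

lemma refl_by_reflect: "refl_by s = reflect (\<alpha> s)"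
  by (simp add: refl_by_def reflect_def fun_eq_iff)

lemma linear_reflect: "linear (reflect a)"
  by (intro linearI) (simp_all add: reflect_def form_simps algebra_simps)

lemma reflect_self: "form a a = 1 \<Longrightarrow> reflect a a = - a"
  by (simp add: reflect_def scaleR_2)

lemma reflect_reflect: "form a a = 1 \<Longrightarrow> reflect a (reflect a x) = x"
  by (simp add: reflect_def form_simps algebra_simps)

lemma form_reflect: "form a a = 1 \<Longrightarrow> form (reflect a x) (reflect a y) = form x y"
  by (simp add: reflect_def form_simps algebra_simps form_commute[of x a])

abbreviation sref :: "'w \<Rightarrow> 'v \<Rightarrow> 'v" where
  "sref s \<equiv> reflect (\<alpha> s)"

lemma form_simple_self [simp]: "s \<in> S \<Longrightarrow> form (\<alpha> s) (\<alpha> s) = 1"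
  by (simp add: form_simple)

text \<open>\<open>act\<close> evaluates a word obtained by choice. Arbitrary words are treated
  first; invariance under \<open>cox_cong\<close> then makes the choice harmless.\<close>

definition word_act :: "'w list \<Rightarrow> 'v \<Rightarrow> 'v" where
  "word_act ws = foldr (\<lambda>s f. sref s \<circ> f) ws id"

lemma word_act_simps [simp]:
  "word_act [] x = x" "word_act (s # ws) x = sref s (word_act ws x)"
  by (simp_all add: word_act_def)

lemma word_act_append [simp]: "word_act (us @ vs) x = word_act us (word_act vs x)"
  by (induction us) auto

lemma linear_word_act: "linear (word_act ws)"
proof (induction ws)
  case (Cons s ws)
  then show ?case
    using linear_compose[OF Cons.IH linear_reflect[of "\<alpha> s"]] by (simp add: comp_def word_act_def)
qed (simp add: word_act_def id_def real_vector.linear_ident)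

text \<open>
  These Chebyshev values are the coordinates of the roots of a rank two system; \<open>k\<close> is the limit of
  \<open>sin (k \<theta>) / sin \<theta>\<close> for \<open>\<theta> \<rightarrow> 0\<close>.
\<close>

definition dihedral_coeff :: "'w \<Rightarrow> 'w \<Rightarrow> nat \<Rightarrow> real" where
  "dihedral_coeff s t k = (if cox_entry W s t = 0 then real k
     else sin (real k * pi / real (cox_entry W s t)) / sin (pi / real (cox_entry W s t)))"

lemma sin_cox_entry_pos:
  assumes "s \<in> S" "t \<in> S" "s \<noteq> t" "cox_entry W s t \<noteq> 0"
  shows "sin (pi / real (cox_entry W s t)) > 0"
proof (intro sin_gt_zero)
  have "cox_entry W s t \<ge> 2"
    using assms by (rule cox_entry_ge_2)
  then show "pi / real (cox_entry W s t) < pi" "0 < pi / real (cox_entry W s t)"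
    by (auto simp: field_simps)
qed

lemma dihedral_coeff_commute:
  "s \<in> S \<Longrightarrow> t \<in> S \<Longrightarrow> dihedral_coeff s t = dihedral_coeff t s"
  by (simp add: dihedral_coeff_def cox_entry_commute fun_eq_iff)

text \<open>With theta = pi / m and \<open>gram s t\<close> = - cos theta, the recurrence is sin
  (k+2)theta = 2 cos theta sin (k+1)theta - sin k theta. For m infinite it says that k is an
  arithmetic progression.\<close>

lemma dihedral_coeff_simps:
  assumes "s \<in> S" "t \<in> S" "s \<noteq> t"
  shows "dihedral_coeff s t 0 = 0" "dihedral_coeff s t (Suc 0) = 1"
    "dihedral_coeff s t (Suc (Suc k)) = - 2 * gram s t * dihedral_coeff s t (Suc k) - dihedral_coeff s t k"
proof -
  show "dihedral_coeff s t 0 = 0" "dihedral_coeff s t (Suc 0) = 1"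
    using sin_cox_entry_pos[OF assms] by (cases "cox_entry W s t = 0"; simp add: dihedral_coeff_def)+
  show "dihedral_coeff s t (Suc (Suc k)) = - 2 * gram s t * dihedral_coeff s t (Suc k) - dihedral_coeff s t k"
  proof (cases "cox_entry W s t = 0")
    case False
    define m where "m = real (cox_entry W s t)"
    have m: "m \<noteq> 0" "sin (pi / m) \<noteq> 0"
      using False sin_cox_entry_pos[OF assms] by (auto simp: m_def)
    define y where "y = real (Suc k) * pi / m"
    have "real (Suc (Suc k)) * pi / m = y + pi / m" "real k * pi / m = y - pi / m"
      using m by (auto simp: y_def field_simps)
    then have "sin (real (Suc (Suc k)) * pi / m) = 2 * cos (pi / m) * sin y - sin (real k * pi / m)"
      by (simp add: sin_add sin_diff)
    moreover have "dihedral_coeff s t j = sin (real j * pi / m) / sin (pi / m)" for j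
      using False by (simp add: dihedral_coeff_def m_def)
    moreover have "gram s t = - cos (pi / m)"
      using False by (simp add: gram_def m_def)
    ultimately show ?thesis
      by (simp only: y_def[symmetric]) (simp add: diff_divide_distrib)
  qed (simp add: dihedral_coeff_def gram_def)
qed

lemma dihedral_coeff_nonneg:
  assumes "s \<in> S" "t \<in> S" "s \<noteq> t" "cox_entry W s t = 0 \<or> k \<le> cox_entry W s t"
  shows "dihedral_coeff s t k \<ge> 0"
proof (cases "cox_entry W s t = 0")
  case False
  with assms have "k \<le> cox_entry W s t"
    by simp
  then have "sin (real k * pi / real (cox_entry W s t)) \<ge> 0"
    using False by (intro sin_ge_zero) (auto simp: field_simps)
  then show ?thesis
    using False sin_cox_entry_pos[OF assms(1-3)] by (simp add: dihedral_coeff_def)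
qed (simp add: dihedral_coeff_def)

text \<open>Each new letter reflects in the simple root that carries the older of the two
  coefficients and replaces it by the next Chebyshev value; hence the split by parity.\<close>

lemma word_act_alternating:
  assumes "s \<in> S" "t \<in> S" "s \<noteq> t"
  shows "word_act (alternating_word s t k) (\<alpha> s) =
    (if even k then dihedral_coeff s t (Suc k) *\<^sub>R \<alpha> s + dihedral_coeff s t k *\<^sub>R \<alpha> t
     else dihedral_coeff s t (Suc k) *\<^sub>R \<alpha> t + dihedral_coeff s t k *\<^sub>R \<alpha> s)"
proof (induction k)
  case 0
  then show ?case
    using dihedral_coeff_simps[OF assms] by simp
next
  case (Suc k)
  have *: "sref a (p *\<^sub>R \<alpha> b + q *\<^sub>R \<alpha> a) = (- 2 * gram s t * p - q) *\<^sub>R \<alpha> a + p *\<^sub>R \<alpha> b"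
    if "{a, b} = {s, t}" for a b p q
  proof -
    have ab: "a \<in> S" "b \<in> S" "gram a b = gram s t"
      using that assms gram_commute by (auto simp: doubleton_eq_iff)
    then show ?thesis
      by (simp add: reflect_def form_simps form_simple algebra_simps flip: scaleR_2)
  qed
  show ?case
    using Suc.IH *[of t s] *[of s t] dihedral_coeff_simps(3)[OF assms, of k] by (auto simp: insert_commute)
qed

text \<open>For finite m the plane of the two simple roots is nondegenerate, so V is its sum with
  the orthogonal complement. The complement is fixed by both reflections; in the plane the
  coefficients return after the angle 2 pi.\<close>

lemma word_act_relation:
  assumes "s \<in> S" "t \<in> S"
  shows "word_act (concat (replicate (cox_entry W s t) [s, t])) x = x"
proof -
  define m where "m = cox_entry W s t"
  consider "s = t" | "m = 0" | "s \<noteq> t" "m \<noteq> 0"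
    by blast
  then show ?thesis
  proof cases
    case 1
    then show ?thesis
      using assms by (simp add: cox_entry_refl reflect_reflect)
  next
    case 2
    then show ?thesis
      by (simp add: m_def)
  next
    case 3
    let ?A = "word_act (alternating_word s t (2 * m))"
    have m2: "m \<ge> 2"
      using 3 assms cox_entry_ge_2 by (simp add: m_def)
    have sin0: "sin (pi / real m) \<noteq> 0"
      using sin_cox_entry_pos[OF assms] 3 by (simp add: m_def)
    have d: "dihedral_coeff s t (2 * m) = 0" "dihedral_coeff s t (Suc (2 * m)) = 1"
      "dihedral_coeff s t (2 * m - 1) = -1"
    proof -
      have "real (2 * m) * pi / real m = 2 * pi" "real (Suc (2 * m)) * pi / real m = pi / real m + 2 * pi"
        "real (2 * m - 1) * pi / real m = - (pi / real m) + 2 * pi"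
        using m2 by (auto simp: field_simps)
      then show "dihedral_coeff s t (2 * m) = 0" "dihedral_coeff s t (Suc (2 * m)) = 1"
        "dihedral_coeff s t (2 * m - 1) = -1"
        using 3 sin0 unfolding dihedral_coeff_def m_def[symmetric]
        by (simp_all only: sin_periodic sin_minus sin_two_pi if_False) (simp_all)
    qed
    have s: "?A (\<alpha> s) = \<alpha> s"
      using word_act_alternating[OF assms \<open>s \<noteq> t\<close>, of "2 * m"] d by simp
    \<comment> \<open>The last letter \<open>t\<close> only negates \<open>\<alpha> t\<close>. What
      remains is the formula for the starting root, with \<open>s\<close> and \<open>t\<close>
      exchanged.\<close>
    have split: "word_act (alternating_word s t (Suc k)) (\<alpha> t) = - word_act (alternating_word t s k) (\<alpha> t)" for k
    proof (induction k)
      case 0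
      then show ?case using assms by (simp add: reflect_self)
    next
      case (Suc k)
      then show ?case
        using linear_neg[OF linear_reflect] by (simp)
    qed
    have t: "?A (\<alpha> t) = \<alpha> t"
    proof -
      have "?A (\<alpha> t) = - word_act (alternating_word t s (2 * m - 1)) (\<alpha> t)"
        using split[of "2 * m - 1"] m2 by (simp del: alternating_word.simps)
      also have "\<dots> = \<alpha> t"
        using word_act_alternating[of t s "2 * m - 1"] assms \<open>s \<noteq> t\<close> d m2
        by (simp add: dihedral_coeff_commute[of t s])
      finally show ?thesis .
    qed
    have orth: "word_act ws y = y" if "ws \<in> lists {s, t}" "form (\<alpha> s) y = 0" "form (\<alpha> t) y = 0" for ws y
      using that by (induction ws) (auto simp: reflect_def)
    define b where "b = gram s t"
    have "b\<^sup>2 = (cos (pi / real m))\<^sup>2"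
      using 3 by (simp add: b_def gram_def m_def)
    then have "1 - b\<^sup>2 = (sin (pi / real m))\<^sup>2"
      by (simp add: sin_squared_eq)
    then have b: "1 - b\<^sup>2 \<noteq> 0"
      using sin0 by simp
    \<comment> \<open>Cramer's rule for the Gram matrix of the plane: \<open>p\<close> and
      \<open>q\<close> are the coordinates of the orthogonal projection of \<open>x\<close>, and
      \<open>y\<close> is the remainder.\<close>
    define p where "p = (form (\<alpha> s) x - b * form (\<alpha> t) x) / (1 - b\<^sup>2)"
    define q where "q = (form (\<alpha> t) x - b * form (\<alpha> s) x) / (1 - b\<^sup>2)"
    define y where "y = x - (p *\<^sub>R \<alpha> s + q *\<^sub>R \<alpha> t)"
    have st: "form (\<alpha> s) (\<alpha> t) = b" "form (\<alpha> t) (\<alpha> s) = b"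
      using assms by (auto simp: form_simple b_def gram_commute)
    have pq: "p + q * b = form (\<alpha> s) x" "p * b + q = form (\<alpha> t) x"
      using b by (simp_all add: p_def q_def divide_simps) (simp_all add: power2_eq_square algebra_simps)
    have "form (\<alpha> s) y = 0" "form (\<alpha> t) y = 0"
      using st pq assms by (simp_all add: y_def form_simps)
    then have "?A y = y"
      by (intro orth alternating_word_in_lists) auto
    then have "?A (p *\<^sub>R \<alpha> s + q *\<^sub>R \<alpha> t + y) = p *\<^sub>R \<alpha> s + q *\<^sub>R \<alpha> t + y"
      using s t linear_word_act[of "alternating_word s t (2 * m)"]
      by (simp add: linear_add linear_scale del: alternating_word.simps)
    then show ?thesis
      by (simp add: y_def concat_replicate_pair m_def)
  qed
qed

lemma word_act_cong: "cox_cong W S us vs \<Longrightarrow> word_act us x = word_act vs x"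
  by (induction arbitrary: x rule: cox_cong.induct) (auto simp: word_act_relation)

lemma act_word_value:
  assumes "ws \<in> lists S"
  shows "act (word_value W ws) = word_act ws"
proof -
  let ?P = "\<lambda>us. us \<in> lists S \<and> word_value W us = word_value W ws"
  have "?P (SOME us. ?P us)"
    using assms by (intro someI[of ?P ws]) simp
  then have "word_act (SOME us. ?P us) x = word_act ws x" for x
    using presentation assms word_act_cong by metis
  then show ?thesis
    by (simp add: act_def word_act_def refl_by_reflect fun_eq_iff)
qed

lemma act_one [simp]: "act \<one> x = x"
  using act_word_value[of "[]"] by simp

lemma act_gen [simp]: "s \<in> S \<Longrightarrow> act s x = sref s x"
  using act_word_value[of "[s]"] by simp

lemma act_mult [simp]:
  assumes "v \<in> carrier W" "w \<in> carrier W"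
  shows "act (v \<otimes> w) x = act v (act w x)"
proof -
  obtain us vs where us: "us \<in> lists S" "word_value W us = v" and vs: "vs \<in> lists S" "word_value W vs = w"
    using assms ex_word by meson
  show ?thesis
    using us vs act_word_value[OF us(1)] act_word_value[OF vs(1)] act_word_value[of "us @ vs"]
    by auto
qed

lemma linear_act [simp]: "w \<in> carrier W \<Longrightarrow> linear (act w)"
  using ex_word[of w] act_word_value linear_word_act by metis

lemma act_inv_act [simp]: "w \<in> carrier W \<Longrightarrow> act (inv w) (act w x) = x"
  and act_act_inv [simp]: "w \<in> carrier W \<Longrightarrow> act w (act (inv w) x) = x"
  using act_mult[of "inv w" w x] act_mult[of w "inv w" x] by simp_all

lemma act_minus [simp]: "w \<in> carrier W \<Longrightarrow> act w (- x) = - act w x"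
  by (simp add: linear_neg)

lemma act_linear_simps:
  assumes "w \<in> carrier W"
  shows "act w (x + y) = act w x + act w y" "act w (x - y) = act w x - act w y"
    "act w (r *\<^sub>R x) = r *\<^sub>R act w x"
  using assms linear_act by (auto simp: linear_add linear_diff linear_scale)

lemma form_act:
  assumes "w \<in> carrier W"
  shows "form (act w x) (act w y) = form x y"
proof -
  have "form (word_act ws x) (word_act ws y) = form x y" if "ws \<in> lists S" for ws
    using that by (induction ws) (auto simp: form_reflect)
  then show ?thesis
    using assms ex_word act_word_value by metis
qed

lemma act_induct [consumes 1, case_names one gen]:
  assumes "w \<in> carrier W" "P \<one>"
    and "\<And>s w. s \<in> S \<Longrightarrow> w \<in> carrier W \<Longrightarrow> P w \<Longrightarrow> P (s \<otimes> w)"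
  shows "P w"
proof -
  have "P (word_value W ws)" if "ws \<in> lists S" for ws
    using that by (induction ws) (auto simp: assms)
  then show ?thesis
    using assms(1) ex_word by metis
qed

end


subsection \<open>Positive roots and inversion sets\<close>

lemma alternating_word_snoc: "alternating_word s t (Suc k) = alternating_word t s k @ [t]"
  by (induction k) auto

context coxeter_geometric
begin

definition nonneg :: "'v \<Rightarrow> bool" where
  "nonneg x \<longleftrightarrow> (\<forall>s\<in>S. 0 \<le> coord x s)"

lemma nonneg_add: "nonneg x \<Longrightarrow> nonneg y \<Longrightarrow> nonneg (x + y)"
  and nonneg_scale: "0 \<le> r \<Longrightarrow> nonneg x \<Longrightarrow> nonneg (r *\<^sub>R x)"
  by (simp_all add: nonneg_def coord_simps)

lemma nonneg_simple: "s \<in> S \<Longrightarrow> nonneg (\<alpha> s)"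
  by (simp add: nonneg_def coord_simple)

lemma nonneg_sum: "(\<And>a. a \<in> A \<Longrightarrow> nonneg (g a)) \<Longrightarrow> nonneg (\<Sum>a\<in>A. g a)"
  by (simp add: nonneg_def coord_sum sum_nonneg)

lemma nonneg_antisym: "nonneg x \<Longrightarrow> nonneg (- x) \<Longrightarrow> x = 0"
  by (intro coord_eqI) (force simp: nonneg_def coord_simps)

lemma convex_cone_hull_simple: "convex_cone hull (\<alpha> ` S) = {x. nonneg x}"
proof (intro equalityI subsetI)
  fix x assume "x \<in> convex_cone hull (\<alpha> ` S)"
  then obtain F c where "x = (\<Sum>a\<in>F. c a *\<^sub>R a)" "F \<subseteq> \<alpha> ` S" "\<forall>a\<in>F. 0 \<le> c a"
    unfolding convex_cone_hull_nonneg_combinations by blast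
  then show "x \<in> {x. nonneg x}"
    by (auto intro!: nonneg_sum nonneg_scale nonneg_simple)
next
  fix x assume "x \<in> {x. nonneg x}"
  then have x: "\<And>s. s \<in> S \<Longrightarrow> 0 \<le> coord x s"
    by (simp add: nonneg_def)
  have "(\<Sum>s\<in>S. coord x s *\<^sub>R \<alpha> s) = (\<Sum>a\<in>\<alpha> ` S. coord x (inv_into S \<alpha> a) *\<^sub>R a)"
    using simple_inj by (subst sum.reindex) auto
  then have "x = (\<Sum>a\<in>\<alpha> ` S. coord x (inv_into S \<alpha> a) *\<^sub>R a)"
    using expand[of x] by simp
  then show "x \<in> convex_cone hull (\<alpha> ` S)"
    unfolding convex_cone_hull_nonneg_combinations
    using finite_gens x simple_inj
    by (intro CollectI exI[of _ "\<alpha> ` S"] exI[of _ "\<lambda>a. coord x (inv_into S \<alpha> a)"]) auto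
qed

text \<open>Minimality forbids repeated letters, and \<open>asc\<close> forbids the last letter
  \<open>s\<close>, so the word alternates and ends in \<open>t\<close>. If it had at least m
  letters, the braid relation would rewrite its end into a word ending in \<open>s\<close>;
  cancelling this \<open>s\<close> against the appended one would contradict
  \<open>asc\<close>.\<close>

lemma geodesic_dihedral_word:
  assumes st: "s \<in> S" "t \<in> S" "s \<noteq> t" and x: "x \<in> lists {s, t}"
    and min: "\<And>y. y \<in> lists {s, t} \<Longrightarrow> word_value W y = word_value W x \<Longrightarrow> length x \<le> length y"
    and asc: "\<And>y. y \<in> lists {s, t} \<Longrightarrow> word_value W y = word_value W x \<otimes> s \<Longrightarrow> length x < length y"
  shows "x = alternating_word s t (length x) \<and> (cox_entry W s t = 0 \<or> length x < cox_entry W s t)"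
proof
  have sub: "lists {s, t} \<subseteq> lists S"
    using st by auto
  show alt: "x = alternating_word s t (length x)"
    using x min asc
  proof (induction x rule: list.induct)
    case (Cons a x)
    have a: "a \<in> {s, t}" "a \<in> S" "x \<in> lists {s, t}" "x \<in> lists S"
      using Cons.prems(1) st by auto
    have IH: "x = alternating_word s t (length x)"
    proof (rule Cons.IH)
      show "x \<in> lists {s, t}" by fact
      show "length x \<le> length y" if "y \<in> lists {s, t}" "word_value W y = word_value W x" for y
        using Cons.prems(2)[of "a # y"] that a by simp
      show "length x < length y" if "y \<in> lists {s, t}" "word_value W y = word_value W x \<otimes> s" for y
        using Cons.prems(3)[of "a # y"] that a st by (simp add: m_assoc)
    qed
    show ?case
    proof (cases "length x")
      case 0
      then have "a \<noteq> s"
        using Cons.prems(3)[of "[]"] st by auto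
      with 0 a show ?thesis by auto
    next
      case (Suc j)
      define c where "c = (if even j then t else s)"
      have x: "x = c # alternating_word s t j"
        using IH Suc by (simp add: c_def)
      have "a \<noteq> c"
      proof
        assume "a = c"
        have al: "alternating_word s t j \<in> lists {s, t}" "alternating_word s t j \<in> lists S"
          using st by (simp_all add: alternating_word_in_lists)
        then have "word_value W (a # x) = word_value W (alternating_word s t j)"
          using x \<open>a = c\<close> a(2) by simp
        then show False
          using Cons.prems(2)[OF al(1)] Suc by simp
      qed
      then show ?thesis
        using a IH Suc by (auto simp: c_def split: if_splits)
    qed
  qed simp
  show "cox_entry W s t = 0 \<or> length x < cox_entry W s t"
  proof (rule ccontr)
    define m where "m = cox_entry W s t"
    assume "\<not> ?thesis"
    then have "m \<noteq> 0" "m \<le> length x"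
      by (auto simp: m_def)
    then obtain i where i: "m = Suc i"
      using not0_implies_Suc by blast
    obtain us where us: "us \<in> lists {s, t}" "x = us @ alternating_word s t m"
      using alternating_word_add[of s t "length x - m" m] alt \<open>m \<le> length x\<close> by auto
    have "us \<in> lists S"
      using us(1) sub by blast
    moreover have al: "alternating_word a b k \<in> lists S" if "{a, b} = {s, t}" for a b k
      using st that by (intro alternating_word_in_lists) (auto simp: doubleton_eq_iff)
    ultimately have "word_value W x = word_value W us \<otimes> word_value W (alternating_word t s m)"
      using us(2) alternating_word_braid[OF st(1,2) m_def] al[of s t m]
      by simp
    also have "\<dots> = word_value W (us @ alternating_word s t i) \<otimes> s"
      using \<open>us \<in> lists S\<close> al[of s t i] st(1)
      by (simp add: i alternating_word_snoc m_assoc del: alternating_word.simps)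
    finally have "word_value W (us @ alternating_word s t i) = word_value W x \<otimes> s"
      using \<open>us \<in> lists S\<close> al[of s t i] st(1) by simp
    moreover have "us @ alternating_word s t i \<in> lists {s, t}"
      using us(1) alternating_word_in_lists[of s "{s, t}" t i] by (simp add: Ball_def)
    ultimately have "length x < length (us @ alternating_word s t i)"
      using asc by blast
    then show False
      using us(2) i by simp
  qed
qed

text \<open>
  The induction splits off a maximal right factor in the dihedral group of \<open>s\<close> and a right descent.
\<close>

lemma ascent_nonneg:
  assumes "w \<in> carrier W" "s \<in> S" "len (w \<otimes> s) = len w + 1"
  shows "nonneg (act w (\<alpha> s))"
  using assms
proof (induction "len w" arbitrary: w s rule: less_induct)
  case less
  show ?case
  proof (cases "w = \<one>")
    case True
    then show ?thesis
      using less.prems nonneg_simple by simp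
  next
    case False
    obtain t where t: "t \<in> S" "len w = len (w \<otimes> t) + 1"
      using ex_right_descent[OF less.prems(1) False] by blast
    then have "s \<noteq> t"
      using less.prems by auto
    \<comment> \<open>Factorizations of \<open>w\<close> with a right factor in the dihedral group
      and additive lengths. Taking the left factor \<open>v\<close> as short as possible makes both
      \<open>s\<close> and \<open>t\<close> ascents of \<open>v\<close>; the factorization with
      \<open>x = [t]\<close> ensures that \<open>v\<close> is shorter than \<open>w\<close>.\<close>
    define Q where "Q n v x \<longleftrightarrow> v \<in> carrier W \<and> x \<in> lists {s, t} \<and> w = v \<otimes> word_value W x \<and>
      len w = len v + length x \<and> len v = n" for n v x
    define n where "n = (LEAST n. \<exists>v x. Q n v x)"
    have Qt: "Q (len (w \<otimes> t)) (w \<otimes> t) [t]"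
      using less.prems t by (auto simp: Q_def)
    then have "\<exists>v x. Q n v x"
      unfolding n_def using LeastI_ex[of "\<lambda>n. \<exists>v x. Q n v x"] by blast
    then obtain v x where "Q n v x" by blast
    then have v: "v \<in> carrier W" "x \<in> lists {s, t}" "w = v \<otimes> word_value W x"
      "len w = len v + length x" "len v = n"
      by (auto simp: Q_def)
    have xS: "x \<in> lists S"
      using v(2) less.prems(2) t(1) by auto
    have "n \<le> len (w \<otimes> t)"
      unfolding n_def using Qt Least_le[of "\<lambda>n. \<exists>v x. Q n v x"] by blast
    then have small: "len v < len w"
      using v t by simp
    have up: "nonneg (act v (\<alpha> r))" if r: "r \<in> {s, t}" for r
    proof -
      have rS: "r \<in> S"
        using r t less.prems by auto
      have "len (v \<otimes> r) = len v + 1"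
      proof (rule ccontr)
        assume "\<not> ?thesis"
        then have l: "len v = len (v \<otimes> r) + 1"
          using len_mult_gen_cases[OF v(1) rS] by simp
        have "w = (v \<otimes> r) \<otimes> word_value W (r # x)"
          using v(1,3) rS xS by (simp add: m_assoc)
        then have "Q (len (v \<otimes> r)) (v \<otimes> r) (r # x)"
          using v l r rS by (auto simp: Q_def)
        then have "n \<le> len (v \<otimes> r)"
          unfolding n_def using Least_le[of "\<lambda>n. \<exists>v x. Q n v x"] by blast
        then show False
          using l v by simp
      qed
      then show ?thesis
        using less.hyps[OF small v(1) rS] by simp
    qed
    have lower: "len (v \<otimes> word_value W y) \<le> len v + length y" if "y \<in> lists {s, t}" for y
    proof -
      have "y \<in> lists S"
        using that less.prems(2) t(1) by auto
      then show ?thesis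
        using len_mult_le[OF v(1), of "word_value W y"] len_word_value_le[of y] by simp
    qed
    have "x = alternating_word s t (length x) \<and> (cox_entry W s t = 0 \<or> length x < cox_entry W s t)"
    proof (rule geodesic_dihedral_word)
      show "length x \<le> length y" if "y \<in> lists {s, t}" "word_value W y = word_value W x" for y
        using lower[OF that(1)] that(2) v by simp
      show "length x < length y" if "y \<in> lists {s, t}" "word_value W y = word_value W x \<otimes> s" for y
      proof -
        have "v \<otimes> word_value W y = w \<otimes> s"
          using that(2) v(1,3) less.prems(2) xS by (simp add: m_assoc)
        then show ?thesis
          using lower[OF that(1)] v less.prems(3) by simp
      qed
    qed (use less.prems t v \<open>s \<noteq> t\<close> in auto)
    then have x: "x = alternating_word s t (length x)"
      and lt: "cox_entry W s t = 0 \<or> length x < cox_entry W s t"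
      by auto
    \<comment> \<open>The index \<open>Suc (length x)\<close> is at most m, so neither sine has
      passed the angle pi.\<close>
    have "dihedral_coeff s t (length x) \<ge> 0" "dihedral_coeff s t (Suc (length x)) \<ge> 0"
      using lt dihedral_coeff_nonneg[OF less.prems(2) t(1) \<open>s \<noteq> t\<close>] by auto
    moreover have "act (word_value W x) (\<alpha> s) = word_act (alternating_word s t (length x)) (\<alpha> s)"
      using act_word_value[OF xS] x by simp
    ultimately obtain c d where "c \<ge> 0" "d \<ge> 0" "act (word_value W x) (\<alpha> s) = c *\<^sub>R \<alpha> s + d *\<^sub>R \<alpha> t"
      using word_act_alternating[OF less.prems(2) t(1) \<open>s \<noteq> t\<close>, of "length x"]
      by (metis add.commute)
    then have "act w (\<alpha> s) = c *\<^sub>R act v (\<alpha> s) + d *\<^sub>R act v (\<alpha> t)"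
      using v(1,3) xS by (simp add: act_linear_simps)
    then show ?thesis
      using up \<open>c \<ge> 0\<close> \<open>d \<ge> 0\<close> by (simp add: nonneg_add nonneg_scale)
  qed
qed

lemma descent_nonpos:
  assumes "w \<in> carrier W" "s \<in> S" "len w = len (w \<otimes> s) + 1"
  shows "nonneg (- act w (\<alpha> s))"
proof -
  have "nonneg (act (w \<otimes> s) (\<alpha> s))"
    using assms by (intro ascent_nonneg) auto
  then show ?thesis
    using assms by (simp add: reflect_self)
qed

section \<open>Signs of roots and inversion sets\<close>

lemma form_root: "a \<in> roots \<Longrightarrow> form a a = 1"
  by (auto simp: roots_def form_act)

lemma root_nonzero: "a \<in> roots \<Longrightarrow> a \<noteq> 0"
  using form_root form_zero_left by fastforce

lemma root_sign: "a \<in> roots \<Longrightarrow> nonneg a \<or> nonneg (- a)"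
  unfolding roots_def using ascent_nonneg descent_nonpos len_mult_gen_cases by blast

lemma root_not_both: "a \<in> roots \<Longrightarrow> nonneg a \<Longrightarrow> \<not> nonneg (- a)"
  using nonneg_antisym root_nonzero by blast

lemma simple_root: "s \<in> S \<Longrightarrow> \<alpha> s \<in> roots"
  unfolding roots_def by (intro CollectI exI[of _ \<one>] exI[of _ s]) auto

lemma act_root:
  assumes "w \<in> carrier W" "a \<in> roots"
  shows "act w a \<in> roots"
proof -
  obtain v s where "v \<in> carrier W" "s \<in> S" "a = act v (\<alpha> s)"
    using assms by (auto simp: roots_def)
  then show ?thesis
    unfolding roots_def using assms
    by (intro CollectI exI[of _ "w \<otimes> v"] exI[of _ s]) auto
qed

lemma minus_root:
  assumes "a \<in> roots"
  shows "- a \<in> roots"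
proof -
  obtain v s where "v \<in> carrier W" "s \<in> S" "a = act v (\<alpha> s)"
    using assms by (auto simp: roots_def)
  then show ?thesis
    unfolding roots_def
    by (intro CollectI exI[of _ "v \<otimes> s"] exI[of _ s]) (auto simp: reflect_self)
qed

lemma pos_roots_iff: "a \<in> pos_roots \<longleftrightarrow> a \<in> roots \<and> nonneg a"
  by (simp add: pos_roots_def convex_cone_hull_simple)

lemma ascent_iff:
  assumes "w \<in> carrier W" "s \<in> S"
  shows "len (w \<otimes> s) = len w + 1 \<longleftrightarrow> act w (\<alpha> s) \<in> pos_roots"
  using assms len_mult_gen_cases[OF assms] ascent_nonneg[OF assms] descent_nonpos[OF assms]
    root_not_both[OF act_root[OF assms(1) simple_root[OF assms(2)]]]
    act_root[OF assms(1) simple_root[OF assms(2)]]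
  by (auto simp: pos_roots_iff)

lemma root_act_inv_iff:
  assumes "w \<in> carrier W"
  shows "act (inv w) a \<in> roots \<longleftrightarrow> a \<in> roots"
  using assms act_root[of "inv w" a] act_root[of w "act (inv w) a"] by auto

lemma inv_set_iff:
  assumes "w \<in> carrier W"
  shows "a \<in> inv_set w \<longleftrightarrow> a \<in> pos_roots \<and> \<not> nonneg (act (inv w) a)"
proof -
  have "a \<in> act w ` neg_roots \<longleftrightarrow> - act (inv w) a \<in> pos_roots"
  proof
    assume "- act (inv w) a \<in> pos_roots"
    then have "act (inv w) a \<in> neg_roots"
      unfolding neg_roots_def by (metis image_eqI minus_minus)
    then show "a \<in> act w ` neg_roots"
      using assms by (metis act_act_inv image_eqI)
  next
    assume "a \<in> act w ` neg_roots"
    then obtain b where "b \<in> pos_roots" "a = act w (- b)"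
      by (auto simp: neg_roots_def)
    then show "- act (inv w) a \<in> pos_roots"
      using assms act_inv_act[OF assms, of "- b"] by (simp del: act_minus)
  qed
  moreover have "- act (inv w) a \<in> pos_roots \<longleftrightarrow> \<not> nonneg (act (inv w) a)" if "a \<in> pos_roots"
  proof -
    have "act (inv w) a \<in> roots"
      using that assms by (simp add: root_act_inv_iff pos_roots_iff)
    then show ?thesis
      using root_sign[of "act (inv w) a"] root_not_both[of "act (inv w) a"] minus_root[of "act (inv w) a"]
      by (auto simp: pos_roots_iff)
  qed
  ultimately show ?thesis
    by (auto simp: inv_set_def)
qed

lemma inv_set_pos: "w \<in> carrier W \<Longrightarrow> inv_set w \<subseteq> pos_roots"
  by (auto simp: inv_set_iff)

lemma inv_set_nonpos:
  assumes "w \<in> carrier W" "a \<in> inv_set w"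
  shows "nonneg (- act (inv w) a)"
  using assms root_sign[of "act (inv w) a"] root_act_inv_iff[of w a]
  by (auto simp: inv_set_iff pos_roots_iff)

lemma inv_setI:
  assumes "w \<in> carrier W" "a \<in> pos_roots" "nonneg (- act (inv w) a)"
  shows "a \<in> inv_set w"
  using assms root_not_both[of "act (inv w) a"] root_act_inv_iff[of w a]
  by (auto simp: inv_set_iff pos_roots_iff)

lemma root_multiple_simple:
  assumes "a \<in> pos_roots" "s \<in> S" "\<And>t. t \<in> S \<Longrightarrow> t \<noteq> s \<Longrightarrow> coord a t = 0"
  shows "a = \<alpha> s"
proof -
  have a: "a = coord a s *\<^sub>R \<alpha> s"
    using assms by (intro coord_eqI) (auto simp: coord_simps coord_simple)
  have "1 = form a a"
    using assms form_root by (simp add: pos_roots_iff)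
  also have "form a a = (coord a s)\<^sup>2"
    using assms(2) by (subst (1 2) a) (simp add: form_simps power2_eq_square)
  finally have "(coord a s)\<^sup>2 = 1"
    by simp
  moreover have "coord a s \<ge> 0"
    using assms by (simp add: pos_roots_iff nonneg_def)
  ultimately have "coord a s = 1"
    by (simp add: power2_eq_1_iff)
  then show ?thesis
    using a by simp
qed

lemma coord_sref_other: "s \<in> S \<Longrightarrow> t \<in> S \<Longrightarrow> t \<noteq> s \<Longrightarrow> coord (sref s x) t = coord x t"
  by (simp add: reflect_def coord_simps coord_simple)

lemma sref_root: "s \<in> S \<Longrightarrow> a \<in> roots \<Longrightarrow> sref s a \<in> roots"
  using act_root[of s a] by simp

text \<open>Only the coordinate at \<open>s\<close> changes. A positive root other than
  \<open>\<alpha> s\<close> has a further positive coordinate, and this survives the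
  reflection.\<close>

lemma sref_pos_root:
  assumes "s \<in> S" "a \<in> pos_roots" "a \<noteq> \<alpha> s"
  shows "sref s a \<in> pos_roots"
proof (rule ccontr)
  assume "sref s a \<notin> pos_roots"
  then have "nonneg (- sref s a)"
    using assms sref_root root_sign by (auto simp: pos_roots_iff)
  then have "coord a t = 0" if "t \<in> S" "t \<noteq> s" for t
    using that assms coord_sref_other[of s t a] by (force simp: nonneg_def pos_roots_iff coord_simps)
  then show False
    using root_multiple_simple assms by blast
qed

text \<open>After pulling back by \<open>w\<close> this says that \<open>sref s\<close> changes the
  sign of no root except plus or minus \<open>\<alpha> s\<close>.\<close>

lemma inv_set_mult_ascent:
  assumes "w \<in> carrier W" "s \<in> S" "act w (\<alpha> s) \<in> pos_roots"
  shows "inv_set (w \<otimes> s) = insert (act w (\<alpha> s)) (inv_set w)" "act w (\<alpha> s) \<notin> inv_set w"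
proof -
  show "act w (\<alpha> s) \<notin> inv_set w"
    using assms nonneg_simple by (simp add: inv_set_iff)
  have "a \<in> inv_set (w \<otimes> s) \<longleftrightarrow> a = act w (\<alpha> s) \<or> a \<in> inv_set w" if a: "a \<in> pos_roots" for a
  proof -
    define b where "b = act (inv w) a"
    have ab: "a = act w b"
      using assms by (simp add: b_def)
    have b: "b \<in> roots"
      using a assms by (simp add: b_def root_act_inv_iff pos_roots_iff)
    have "act (inv (w \<otimes> s)) a = sref s b"
      using assms by (simp add: inv_mult_group b_def)
    then have 1: "a \<in> inv_set (w \<otimes> s) \<longleftrightarrow> \<not> nonneg (sref s b)"
      using a assms by (simp add: inv_set_iff)
    have 2: "a \<in> inv_set w \<longleftrightarrow> \<not> nonneg b"
      using a assms by (simp add: inv_set_iff b_def)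
    show ?thesis
    proof (cases "nonneg b")
      case True
      then have bp: "b \<in> pos_roots"
        using b by (simp add: pos_roots_iff)
      show ?thesis
      proof (cases "b = \<alpha> s")
        case True
        then have "\<not> nonneg (sref s b)"
          using assms(2) simple_root root_not_both nonneg_simple by (simp add: reflect_self)
        then show ?thesis
          using 1 True ab by simp
      next
        case False
        then have "nonneg (sref s b)"
          using sref_pos_root[OF assms(2) bp] by (simp add: pos_roots_iff)
        moreover have "a \<noteq> act w (\<alpha> s)"
          using False assms(1) b_def by auto
        ultimately show ?thesis
          using 1 2 True by simp
      qed
    next
      case False
      then have bn: "- b \<in> pos_roots"
        using b root_sign minus_root by (auto simp: pos_roots_iff)
      have "- b \<noteq> \<alpha> s"
      proof
        assume "- b = \<alpha> s"
        then have "a = - act w (\<alpha> s)"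
          using ab assms(1) by (metis act_minus minus_minus)
        then show False
          using a assms(3) root_not_both by (auto simp: pos_roots_iff)
      qed
      then have "sref s (- b) \<in> pos_roots"
        using sref_pos_root[OF assms(2) bn] by simp
      then have "\<not> nonneg (sref s b)"
        using root_not_both[of "sref s (- b)"] linear_neg[OF linear_reflect, of "\<alpha> s" b]
        by (auto simp: pos_roots_iff)
      then show ?thesis
        using 1 2 False by simp
    qed
  qed
  moreover have "inv_set (w \<otimes> s) \<subseteq> pos_roots" "inv_set w \<subseteq> pos_roots"
    using assms by (auto intro!: inv_set_pos)
  ultimately show "inv_set (w \<otimes> s) = insert (act w (\<alpha> s)) (inv_set w)"
    using assms(3) by auto
qed

lemma inv_set_one [simp]: "inv_set \<one> = {}"
  by (auto simp: inv_set_iff pos_roots_iff)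

lemma finite_inv_set: "w \<in> carrier W \<Longrightarrow> finite (inv_set w)"
  and card_inv_set: "w \<in> carrier W \<Longrightarrow> card (inv_set w) = len w"
proof -
  have "finite (inv_set w) \<and> card (inv_set w) = len w" if "w \<in> carrier W" for w
    using that
  proof (induction "len w" arbitrary: w)
    case 0
    then show ?case
      using len_eq_0[of w] by simp
  next
    case (Suc n)
    then have "w \<noteq> \<one>"
      by auto
    obtain s where s: "s \<in> S" "len w = len (w \<otimes> s) + 1"
      using ex_right_descent[OF Suc.prems \<open>w \<noteq> \<one>\<close>] by blast
    define v where "v = w \<otimes> s"
    have v: "v \<in> carrier W" "w = v \<otimes> s" "len w = len v + 1"
      using s Suc.prems by (auto simp: v_def)
    then have "act v (\<alpha> s) \<in> pos_roots"
      using ascent_iff[of v s] s by simp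
    then show ?case
      using inv_set_mult_ascent[of v s] v s Suc by simp
  qed
  then show "w \<in> carrier W \<Longrightarrow> finite (inv_set w)" "w \<in> carrier W \<Longrightarrow> card (inv_set w) = len w"
    by auto
qed

lemma len_mono_inv_set:
  "v \<in> carrier W \<Longrightarrow> w \<in> carrier W \<Longrightarrow> inv_set v \<subseteq> inv_set w \<Longrightarrow> len v \<le> len w"
  using card_mono[OF finite_inv_set, of w "inv_set v"] by (simp add: card_inv_set)

text \<open>\<open>- act w (\<alpha> s)\<close> is the root of the wall between the chambers of
  \<open>w\<close> and \<open>w \<otimes> s\<close>, the only inversion lost in crossing it.\<close>

lemma descent_root:
  assumes "w \<in> carrier W" "s \<in> S" "act w (\<alpha> s) \<notin> pos_roots"
  shows "- act w (\<alpha> s) \<in> pos_roots" "inv_set w = insert (- act w (\<alpha> s)) (inv_set (w \<otimes> s))"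
    "- act w (\<alpha> s) \<notin> inv_set (w \<otimes> s)" "len w = len (w \<otimes> s) + 1"
proof -
  have "act w (\<alpha> s) \<in> roots"
    using assms by (simp add: act_root simple_root)
  then show neg: "- act w (\<alpha> s) \<in> pos_roots"
    using assms root_sign minus_root by (auto simp: pos_roots_iff)
  then have "act (w \<otimes> s) (\<alpha> s) \<in> pos_roots"
    using assms by (simp add: reflect_self)
  from inv_set_mult_ascent[OF _ assms(2) this]
  show "inv_set w = insert (- act w (\<alpha> s)) (inv_set (w \<otimes> s))" "- act w (\<alpha> s) \<notin> inv_set (w \<otimes> s)"
    using assms by (simp_all add: reflect_self)
  show "len w = len (w \<otimes> s) + 1"
    using assms ascent_iff len_mult_gen_cases by blast
qed

lemma eq_one_if_no_descent:
  assumes "w \<in> carrier W" "\<And>s. s \<in> S \<Longrightarrow> act w (\<alpha> s) \<in> pos_roots"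
  shows "w = \<one>"
proof (rule ccontr)
  assume "w \<noteq> \<one>"
  then obtain s where "s \<in> S" "len w = len (w \<otimes> s) + 1"
    using ex_right_descent[OF assms(1)] by blast
  then show False
    using ascent_iff[OF assms(1) \<open>s \<in> S\<close>] assms(2) by simp
qed

lemma ex_reflection:
  assumes "a \<in> roots"
  shows "\<exists>r\<in>carrier W. (\<forall>x. act r x = reflect a x) \<and> inv r = r"
proof -
  obtain v s where v: "v \<in> carrier W" "s \<in> S" "a = act v (\<alpha> s)"
    using assms by (auto simp: roots_def)
  define r where "r = v \<otimes> s \<otimes> inv v"
  have "act r x = reflect a x" for x
  proof -
    have "form (\<alpha> s) (act (inv v) x) = form a x"
      using form_act[of v "\<alpha> s" "act (inv v) x"] v by simp
    then show ?thesis
      using v by (simp add: r_def reflect_def act_linear_simps)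
  qed
  moreover have "inv r = r"
    using v by (simp add: r_def inv_mult_group m_assoc)
  ultimately show ?thesis
    using v by (intro bexI[of _ r]) (auto simp: r_def)
qed

lemma reflect_root:
  assumes "a \<in> roots" "b \<in> roots"
  shows "reflect a b \<in> roots"
proof -
  obtain r where "r \<in> carrier W" "\<forall>x. act r x = reflect a x"
    using ex_reflection[OF assms(1)] by blast
  then show ?thesis
    using act_root[of r b] assms(2) by simp
qed

end


subsection \<open>Dominance and the radical of the form\<close>

text \<open>If all terms were negative, the second differences 2 (1 - b)(- a (k+1)) would be
  positive. A convex sequence bounded above by 0 has no positive increment, so every term is at most
  \<open>a 0\<close>; then the second differences stay above a positive constant and the increments
  become positive after all. The argument covers |b| < 1 and b <= -1 alike.\<close>

lemma linear_recurrence_not_negative: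
  fixes a :: "nat \<Rightarrow> real"
  assumes rec: "\<And>k. a (Suc (Suc k)) = 2 * b * a (Suc k) - a k" and "b < 1"
  shows "\<exists>k. a k \<ge> 0"
proof (rule ccontr)
  assume "\<not> ?thesis"
  then have neg: "a k < 0" for k
    by (simp add: not_le)
  define d where "d k = a (Suc k) - a k" for k
  have d: "d (Suc k) = d k + 2 * ((1 - b) * (- a (Suc k)))" for k
    using rec[of k] by (simp add: d_def algebra_simps)
  have "d k \<le> d (Suc k)" for k
  proof -
    have "(1 - b) * (- a (Suc k)) \<ge> 0"
      using neg[of "Suc k"] \<open>b < 1\<close> by (intro mult_nonneg_nonneg) auto
    then show ?thesis
      using d[of k] by linarith
  qed
  then have mono: "d k \<le> d (k + j)" for k j
    by (induction j) (auto intro: order_trans)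
  have d_nonpos: "d k \<le> 0" for k
  proof (rule ccontr)
    assume "\<not> d k \<le> 0"
    then have pos: "d k > 0" by simp
    have lin: "a (k + j) \<ge> a k + real j * d k" for j
    proof (induction j)
      case (Suc j)
      then show ?case
        using mono[of k j] by (simp add: d_def algebra_simps)
    qed simp
    obtain j where "real j * d k > - a k"
      using reals_Archimedean3[OF pos] by blast
    then show False
      using lin[of j] neg[of "k + j"] by linarith
  qed
  have "a k \<le> a 0" for k
  proof (induction k)
    case (Suc k)
    then show ?case
      using d_nonpos[of k] by (simp add: d_def)
  qed simp
  then have step: "d (Suc k) \<ge> d k + 2 * ((1 - b) * (- a 0))" for k
    unfolding d[of k] using \<open>b < 1\<close> by (intro add_left_mono mult_left_mono) auto
  have lin: "d k \<ge> d 0 + real k * (2 * ((1 - b) * (- a 0)))" for k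
  proof (induction k)
    case (Suc k)
    have "d 0 + real (Suc k) * (2 * ((1 - b) * (- a 0)))
        = d 0 + real k * (2 * ((1 - b) * (- a 0))) + 2 * ((1 - b) * (- a 0))"
      by (simp add: algebra_simps)
    also have "\<dots> \<le> d (Suc k)"
      using Suc.IH step[of k] by linarith
    finally show ?case .
  qed simp
  have "2 * ((1 - b) * (- a 0)) > 0"
    using \<open>b < 1\<close> neg[of 0] by (simp add: mult_pos_neg)
  then obtain k where "real k * (2 * ((1 - b) * (- a 0))) > - d 0"
    using reals_Archimedean3 by blast
  then show False
    using lin[of k] d_nonpos[of k] by linarith
qed

context coxeter_geometric
begin

text \<open>With value 1 on every simple root, this is a point of the fundamental chamber; its sign
  tells positive roots from negative ones.\<close>

definition height :: "'v \<Rightarrow> real" where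
  "height x = (\<Sum>s\<in>S. coord x s)"

lemma height_simps:
  "height (x + y) = height x + height y" "height (x - y) = height x - height y"
  "height (- x) = - height x" "height (r *\<^sub>R x) = r * height x"
  by (simp_all add: height_def coord_simps sum.distrib sum_subtractf sum_negf sum_distrib_left)

lemma linear_height: "linear height"
  by (intro linearI) (simp_all add: height_simps)

lemma height_nonneg: "nonneg x \<Longrightarrow> 0 \<le> height x"
  by (simp add: height_def nonneg_def sum_nonneg)

lemma height_pos:
  assumes "nonneg x" "x \<noteq> 0"
  shows "0 < height x"
proof -
  obtain s where "s \<in> S" "coord x s \<noteq> 0"
    using assms(2) coord_eqI[of x 0] by (auto simp: coord_zero)
  then show ?thesis
    using assms(1) finite_gens unfolding height_def nonneg_def
    by (intro sum_pos2[of S s]) (auto simp: order_less_le)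
qed

lemma root_in_inv_set_reflection:
  assumes "a \<in> pos_roots" "r \<in> carrier W" "\<And>x. act r x = reflect a x" "inv r = r"
  shows "a \<in> inv_set r"
  using assms form_root[of a] by (intro inv_setI) (auto simp: reflect_self pos_roots_iff)

lemma dom_le_refl: "a \<in> pos_roots \<Longrightarrow> dom_le a a"
  by (simp add: dom_le_def)

lemma dom_le_trans: "dom_le a b \<Longrightarrow> dom_le b c \<Longrightarrow> dom_le a c"
  by (simp add: dom_le_def)

text \<open>Writing \<open>a\<close> as \<open>act v (\<alpha> s)\<close> gives two adjacent
  chambers separated by the wall of \<open>a\<close> alone, so \<open>a\<close> can be inverted
  without any change at \<open>b\<close>.\<close>

lemma dom_le_antisym:
  assumes "dom_le a b" "dom_le b a"
  shows "a = b"
proof (rule ccontr)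
  assume "a \<noteq> b"
  have a: "a \<in> pos_roots"
    using assms by (simp add: dom_le_def)
  then obtain v s where v: "v \<in> carrier W" "s \<in> S" "a = act v (\<alpha> s)"
    by (auto simp: pos_roots_iff roots_def)
  note N = inv_set_mult_ascent[OF v(1,2), folded v(3), OF a]
  have "v \<otimes> s \<in> carrier W"
    using v by simp
  then have "b \<in> inv_set (v \<otimes> s)"
    using N(1) assms(2) unfolding dom_le_def by blast
  then have "b \<in> inv_set v"
    using \<open>a \<noteq> b\<close> by (simp add: N(1))
  then show False
    using assms(1) v(1) N(2) unfolding dom_le_def by blast
qed

text \<open>Everything dominated by \<open>b\<close> is an inversion of the reflection in
  \<open>b\<close>, which leaves only finitely many candidates; descending among them ends at a
  small root.\<close>

lemma ex_small_root_below:
  assumes "b \<in> pos_roots"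
  shows "\<exists>a\<in>small_roots. dom_le a b"
proof -
  have fin: "finite {a. dom_le a b}" if b: "b \<in> pos_roots" for b
  proof -
    obtain r where r: "r \<in> carrier W" "\<And>x. act r x = reflect b x" "inv r = r"
      using ex_reflection b pos_roots_iff by metis
    then have "{a. dom_le a b} \<subseteq> inv_set r"
      using root_in_inv_set_reflection[OF b r] by (auto simp: dom_le_def)
    then show ?thesis
      using finite_inv_set r(1) finite_subset by blast
  qed
  show ?thesis
    using assms
  proof (induction "card {a. dom_le a b}" arbitrary: b rule: less_induct)
    case less
    show ?case
    proof (cases "b \<in> small_roots")
      case True
      then show ?thesis
        using dom_le_refl less.prems by blast
    next
      case False
      then obtain a where a: "a \<in> pos_roots" "dom_le a b" "a \<noteq> b"
        using less.prems by (auto simp: small_roots_def)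
      have "{c. dom_le c a} \<subseteq> {c. dom_le c b}"
        using a(2) dom_le_trans by blast
      moreover have "b \<notin> {c. dom_le c a}" "b \<in> {c. dom_le c b}"
        using a dom_le_antisym dom_le_refl less.prems by auto
      ultimately have "{c. dom_le c a} \<subset> {c. dom_le c b}"
        by blast
      then have "card {c. dom_le c a} < card {c. dom_le c b}"
        using fin[OF less.prems] psubset_card_mono by blast
      then show ?thesis
        using less.hyps[of a] a dom_le_trans by blast
    qed
  qed
qed

text \<open>
  If \<open>b\<close> dominates \<open>a\<close>, then no element of \<open>\<langle>s\<^sub>a, s\<^sub>b\<rangle>\<close> separates \<open>a\<close> from \<open>b\<close>. Moving along the
  dihedral group, the heights of \<open>b, a, \<dots>\<close> obey a linear recurrence whose solutions oscillate
  when \<open>B(a, b) < 1\<close>.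
\<close>

lemma dom_le_form:
  assumes "dom_le a b" "a \<noteq> b"
  shows "form a b \<ge> 1"
proof (rule ccontr)
  define B where "B = form a b"
  assume "\<not> form a b \<ge> 1"
  then have "B < 1"
    by (simp add: B_def)
  have pos: "a \<in> pos_roots" "b \<in> pos_roots"
    using assms by (auto simp: dom_le_def)
  have dom: "a \<in> inv_set w" if "w \<in> carrier W" "b \<in> inv_set w" for w
    using assms that by (simp add: dom_le_def)
  obtain ra where ra: "ra \<in> carrier W" "\<And>x. act ra x = reflect a x" "inv ra = ra"
    using ex_reflection pos(1) pos_roots_iff by metis
  obtain rb where rb: "rb \<in> carrier W" "\<And>x. act rb x = reflect b x" "inv rb = rb"
    using ex_reflection pos(2) pos_roots_iff by metis
  have unit: "form a a = 1" "form b b = 1" "form b a = B"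
    using pos form_root by (auto simp: pos_roots_iff B_def form_commute)
  have neg: "height (act (inv w) x) < 0" if "w \<in> carrier W" "x \<in> inv_set w" for w x
  proof -
    have "act (inv w) x \<in> roots"
      using that by (auto simp: root_act_inv_iff inv_set_iff pos_roots_iff)
    then have "height (- act (inv w) x) > 0"
      using inv_set_nonpos[OF that] minus_root root_nonzero by (intro height_pos) auto
    then show ?thesis
      by (simp add: height_simps)
  qed
  have rb_b: "b \<in> inv_set rb"
    using root_in_inv_set_reflection[OF pos(2) rb] .
  \<comment> \<open>Iterating on pairs yields \<open>h\<close>, the solution of the recurrence whose
    first two terms are the heights of \<open>b\<close> and \<open>a\<close> after pulling back by
    \<open>rb\<close>.\<close>
  define f :: "nat \<Rightarrow> real \<times> real" where
    "f = rec_nat (height (act (inv rb) b), height (act (inv rb) a)) (\<lambda>_ p. (snd p, 2 * B * snd p - fst p))"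
  define h where "h k = fst (f k)" for k
  have hS: "h (Suc k) = snd (f k)" for k
    by (simp add: h_def f_def)
  have rec: "h (Suc (Suc k)) = 2 * B * h (Suc k) - h k" for k
    by (simp add: h_def f_def)
  have h01: "h 0 = height (act (inv rb) b)" "h (Suc 0) = height (act (inv rb) a)"
    by (simp_all add: h_def f_def)
  have "\<exists>w\<in>carrier W. b \<in> inv_set w \<and> height (act (inv w) b) = h (2 * n) \<and>
    height (act (inv w) a) = h (Suc (2 * n))" for n
  proof (induction n)
    case 0
    then show ?case
      using rb(1) rb_b h01 by auto
  next
    case (Suc n)
    then obtain w where w: "w \<in> carrier W" "b \<in> inv_set w" "height (act (inv w) b) = h (2 * n)"
      "height (act (inv w) a) = h (Suc (2 * n))"
      by blast
    \<comment> \<open>Multiplying by \<open>ra\<close> makes \<open>a\<close> a non-inversion, hence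
      also \<open>b\<close> by dominance. Multiplying by \<open>rb\<close> makes \<open>b\<close> an
      inversion again, hence also \<open>a\<close>. Each such round advances \<open>h\<close> by two
      indices.\<close>
    define w1 where "w1 = ra \<otimes> w"
    define w2 where "w2 = rb \<otimes> (ra \<otimes> w)"
    have cl: "w1 \<in> carrier W" "w2 \<in> carrier W"
      using w ra rb by (auto simp: w1_def w2_def)
    have act1: "act (inv w1) x = act (inv w) (reflect a x)" for x
      using w(1) ra by (simp add: w1_def inv_mult_group)
    have act2: "act (inv w2) x = act (inv w) (reflect a (reflect b x))" for x
      using w(1) ra rb by (simp add: w2_def inv_mult_group)
    have "nonneg (act (inv w1) a)"
      using inv_set_nonpos[OF w(1) dom[OF w(1,2)]] w(1) by (simp add: act1 reflect_self unit)
    then have "a \<notin> inv_set w1"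
      using cl by (simp add: inv_set_iff)
    then have "b \<notin> inv_set w1"
      using dom cl by blast
    then have "nonneg (act (inv w) (reflect a b))"
      using cl pos act1 by (simp add: inv_set_iff)
    then have "b \<in> inv_set w2"
      using cl pos w(1) linear_neg[OF linear_reflect]
      by (intro inv_setI) (simp_all add: act2 reflect_self unit)
    moreover have b2: "height (act (inv w2) b) = h (Suc (Suc (2 * n)))"
      using w unit by (simp add: act2 reflect_def form_simps act_linear_simps height_simps rec
          flip: B_def)
    moreover have "height (act (inv w2) a) = h (Suc (Suc (Suc (2 * n))))"
      using w unit b2[unfolded act2] by (simp add: rec[of "Suc (2 * n)"] act2 reflect_self)
        (simp add: reflect_def form_simps act_linear_simps height_simps rec algebra_simps
          flip: B_def)
    ultimately show ?case
      using cl(2) by (intro bexI[of _ w2]) auto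
  qed
  then have "h (2 * n) < 0 \<and> h (Suc (2 * n)) < 0" for n
    using neg dom by metis
  then have "h k < 0" for k
    by (metis evenE oddE Suc_eq_plus1)
  then show False
    using linear_recurrence_not_negative[of h B] rec \<open>B < 1\<close> by (metis not_less)
qed

end

section \<open>Affine type: irreducible components and the radical of the form\<close>

locale affine_coxeter = coxeter_geometric W S \<alpha>
  for W :: "('w, 'b) monoid_scheme" (structure) and S :: "'w set" and \<alpha> :: "'w \<Rightarrow> 'v::real_vector" +
  assumes affine: affine_system
begin

definition supported :: "'w set \<Rightarrow> 'v \<Rightarrow> bool" where
  "supported J x \<longleftrightarrow> (\<forall>s\<in>S - J. coord x s = 0)"

definition restrict_to :: "'w set \<Rightarrow> 'v \<Rightarrow> 'v" where
  "restrict_to J x = (\<Sum>s\<in>S. (if s \<in> J then coord x s else 0) *\<^sub>R \<alpha> s)"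

definition radical :: "'v \<Rightarrow> bool" where
  "radical z \<longleftrightarrow> (\<forall>y. form z y = 0)"

lemma coord_restrict_to: "s \<in> S \<Longrightarrow> coord (restrict_to J x) s = (if s \<in> J then coord x s else 0)"
  by (simp add: restrict_to_def coord_combination)

lemma linear_restrict_to: "linear (restrict_to J)"
  by (intro linearI coord_eqI) (auto simp: coord_restrict_to coord_simps)

lemma restrict_to_supported: "supported J x \<Longrightarrow> restrict_to J x = x"
  by (intro coord_eqI) (auto simp: coord_restrict_to supported_def)

lemma restrict_to_disjoint: "supported K x \<Longrightarrow> J \<inter> K = {} \<Longrightarrow> restrict_to J x = 0"
  by (intro coord_eqI) (auto simp: coord_restrict_to supported_def coord_zero)

lemma supported_restrict_to: "supported J (restrict_to J x)"
  by (simp add: supported_def coord_restrict_to)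

lemma nonneg_restrict_to: "nonneg x \<Longrightarrow> nonneg (restrict_to J x)"
  and nonneg_restrict_to_diff: "nonneg x \<Longrightarrow> nonneg (x - restrict_to J x)"
  by (simp_all add: nonneg_def coord_restrict_to coord_simps)

lemma sym_cox_graph: "sym cox_graph"
  by (auto simp: sym_def cox_graph_def cox_entry_commute)

lemma component_subset:
  assumes "J \<in> irreducible_components"
  shows "J \<subseteq> S"
proof
  fix t assume "t \<in> J"
  then obtain s where s: "s \<in> S" "(s, t) \<in> cox_graph\<^sup>*"
    using assms by (auto simp: irreducible_components_def)
  from s(2) show "t \<in> S"
    by (induction rule: rtrancl_induct) (auto simp: cox_graph_def s)
qed

lemma component_eq:
  assumes "J \<in> irreducible_components" "s \<in> J"
  shows "J = cox_graph\<^sup>* `` {s}"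
proof -
  obtain r where r: "J = cox_graph\<^sup>* `` {r}" "(r, s) \<in> cox_graph\<^sup>*"
    using assms by (auto simp: irreducible_components_def)
  then have "(s, r) \<in> cox_graph\<^sup>*"
    using sym_rtrancl[OF sym_cox_graph] by (meson symD)
  then show ?thesis
    using r by (auto intro: rtrancl_trans)
qed

lemma component_disjoint:
  "J \<in> irreducible_components \<Longrightarrow> K \<in> irreducible_components \<Longrightarrow> J \<noteq> K \<Longrightarrow> J \<inter> K = {}"
  by (metis component_eq disjoint_iff)

lemma ex_component: "s \<in> S \<Longrightarrow> \<exists>J\<in>irreducible_components. s \<in> J"
  by (intro bexI[of _ "cox_graph\<^sup>* `` {s}"]) (auto simp: irreducible_components_def)

lemma finite_components: "finite irreducible_components"
proof -
  have "irreducible_components = (\<lambda>s. cox_graph\<^sup>* `` {s}) ` S"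
    by (auto simp: irreducible_components_def)
  then show ?thesis
    using finite_gens by simp
qed

lemma gram_component:
  assumes "J \<in> irreducible_components" "s \<in> J" "t \<in> S" "t \<notin> J"
  shows "gram s t = 0"
proof -
  have "s \<in> S" "s \<noteq> t"
    using assms component_subset by auto
  moreover have "(s, t) \<notin> cox_graph"
    using assms component_eq[OF assms(1,2)] by auto
  ultimately have "cox_entry W s t = 2"
    using assms by (simp add: cox_graph_def)
  then show ?thesis
    by (simp add: gram_def)
qed

lemma form_component:
  assumes "J \<in> irreducible_components" "supported J x" "\<And>s. s \<in> J \<Longrightarrow> coord y s = 0"
  shows "form x y = 0"
  unfolding form_gram
proof (intro sum.neutral ballI)
  fix s t assume "s \<in> S" "t \<in> S"
  then show "coord x s * coord y t * gram s t = 0"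
    using assms gram_component[OF assms(1)] by (cases "s \<in> J"; cases "t \<in> J") (auto simp: supported_def)
qed

lemma form_restrict_split:
  assumes "J \<in> irreducible_components"
  shows "form x x = form (restrict_to J x) (restrict_to J x) + form (x - restrict_to J x) (x - restrict_to J x)"
proof -
  have "form (restrict_to J x) (x - restrict_to J x) = 0"
    using assms component_subset[OF assms]
    by (intro form_component) (auto simp: supported_restrict_to coord_simps coord_restrict_to)
  then show ?thesis
    by (simp add: form_simps form_commute[of x "restrict_to J x"])
qed

lemma supported_span: "supported J x \<Longrightarrow> x \<in> span (\<alpha> ` J)"
proof -
  assume "supported J x"
  have "(\<Sum>s\<in>S. coord x s *\<^sub>R \<alpha> s) \<in> span (\<alpha> ` J)"
  proof (intro span_sum)
    fix s assume "s \<in> S"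
    then show "coord x s *\<^sub>R \<alpha> s \<in> span (\<alpha> ` J)"
      using \<open>supported J x\<close> by (cases "s \<in> J") (auto simp: supported_def span_zero intro: span_scale span_base)
  qed
  then show ?thesis
    using expand by metis
qed

text \<open>Components are mutually orthogonal, so semidefiniteness passes to V by splitting off one
  component at a time.\<close>

lemma form_nonneg: "form x x \<ge> 0"
proof -
  have "form x x \<ge> 0" if "finite C" "C \<subseteq> irreducible_components" "supported (\<Union>C) x" for C
    using that
  proof (induction C arbitrary: x rule: finite_induct)
    case empty
    then have "x = 0"
      by (intro coord_eqI) (auto simp: supported_def coord_zero)
    then show ?case
      by (simp add: form_zero_left)
  next
    case (insert J C)
    have J: "J \<in> irreducible_components"
      using insert by simp
    have "form (restrict_to J x) (restrict_to J x) \<ge> 0"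
    proof -
      have "\<forall>x\<in>span (\<alpha> ` J). form x x \<ge> 0"
        using affine J by (simp add: affine_system_def affine_type_def)
      then show ?thesis
        using supported_span[OF supported_restrict_to[of J x]] by blast
    qed
    moreover have "form (x - restrict_to J x) (x - restrict_to J x) \<ge> 0"
      using insert.prems by (intro insert.IH) (auto simp: supported_def coord_simps coord_restrict_to)
    ultimately show ?case
      using form_restrict_split[OF J, of x] by linarith
  qed
  from this[OF finite_components] show ?thesis
    using ex_component by (auto simp: supported_def)
qed

text \<open>An isotropic vector \<open>z\<close> pairing nontrivially with \<open>y\<close> would
  give y + r z the norm B(y, y) + 2 r B(z, y), and a suitable r makes this -1.\<close>

lemma radicalI:
  assumes "form z z \<le> 0"
  shows "radical z"
  unfolding radical_def
proof (rule ccontr)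
  assume "\<not> (\<forall>y. form z y = 0)"
  then obtain y where y: "form z y \<noteq> 0" by blast
  have "form z z = 0"
    using assms form_nonneg[of z] by simp
  define r where "r = - (form y y + 1) / (2 * form z y)"
  have "form (y + r *\<^sub>R z) (y + r *\<^sub>R z) = form y y + 2 * r * form z y"
    using \<open>form z z = 0\<close> by (simp add: form_simps form_commute[of y z])
  also have "\<dots> = -1"
    using y by (simp add: r_def field_simps)
  finally show False
    using form_nonneg[of "y + r *\<^sub>R z"] by simp
qed

lemma radical_diff: "radical x \<Longrightarrow> radical y \<Longrightarrow> radical (x - y)"
  and radical_add: "radical x \<Longrightarrow> radical y \<Longrightarrow> radical (x + y)"
  and radical_scale: "radical x \<Longrightarrow> radical (r *\<^sub>R x)"
  and radical_minus: "radical x \<Longrightarrow> radical (- x)"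
  by (auto simp: radical_def form_simps)

lemma radical_form [simp]: "radical z \<Longrightarrow> form z y = 0" "radical z \<Longrightarrow> form y z = 0"
  by (auto simp: radical_def) (metis form_commute)

lemma reflect_radical [simp]: "radical z \<Longrightarrow> reflect a z = z"
  by (simp add: reflect_def)

lemma act_radical [simp]:
  assumes "w \<in> carrier W" "radical z"
  shows "act w z = z"
  using assms(1) by (induction rule: act_induct) (use assms(2) in auto)

text \<open>A Perron-Frobenius argument. At a zero coordinate the equation B(z,
  \<open>\<alpha> t\<close>) = 0 is a vanishing sum of nonpositive terms, so the coordinates at all
  graph neighbours vanish too; connectedness spreads this over the component.\<close>

lemma radical_full_support:
  assumes J: "J \<in> irreducible_components" "supported J z" "nonneg z" "radical z" "z \<noteq> 0" and "s \<in> J"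
  shows "coord z s > 0"
proof (rule ccontr)
  have nn: "coord z t \<ge> 0" if "t \<in> S" for t
    using that J by (simp add: nonneg_def)
  assume "\<not> coord z s > 0"
  then have s0: "coord z s = 0"
    using nn[of s] component_subset[OF J(1)] \<open>s \<in> J\<close> by auto
  have "coord z t = 0" if "(s, t) \<in> cox_graph\<^sup>*" for t
    using that
  proof (induction rule: rtrancl_induct)
    case (step t u)
    then have tu: "t \<in> S" "u \<in> S" "t \<noteq> u" "cox_entry W t u \<noteq> 2"
      by (auto simp: cox_graph_def)
    have "(\<Sum>v\<in>S. coord z v * gram t v) = 0"
      using form_expand[of "\<alpha> t" z] tu J(4) by (simp add: form_simple)
    moreover have "coord z v * gram t v \<le> 0" if "v \<in> S" for v
      using that nn[of v] gram_nonpos[of t v] tu step.IH by (cases "v = t") (auto intro: mult_nonneg_nonpos)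
    ultimately have "coord z u * gram t u = 0"
      using sum_nonneg_eq_0_iff[of S "\<lambda>v. - (coord z v * gram t v)"] finite_gens tu
      by (auto simp: sum_negf)
    then show ?case
      using gram_neg[OF tu] by simp
  qed (use s0 in auto)
  then have "z = 0"
    using J(2) component_eq[OF J(1) \<open>s \<in> J\<close>]
    by (intro coord_eqI) (auto simp: supported_def coord_zero)
  then show False
    using J by simp
qed

text \<open>Subtract from \<open>y\<close> the largest multiple of \<open>z\<close> that leaves it
  nonnegative. Some coordinate on \<open>J\<close> becomes zero, so by full support nothing
  remains.\<close>

lemma radical_proportional:
  assumes J: "J \<in> irreducible_components"
    and z: "supported J z" "nonneg z" "radical z" "z \<noteq> 0"
    and y: "supported J y" "nonneg y" "radical y"
  shows "\<exists>c\<ge>0. y = c *\<^sub>R z"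
proof -
  have JS: "J \<subseteq> S" "finite J"
    using component_subset[OF J] finite_gens finite_subset by auto
  have "J \<noteq> {}"
    using J by (auto simp: irreducible_components_def)
  define c where "c = Min ((\<lambda>s. coord y s / coord z s) ` J)"
  have zp: "coord z s > 0" if "s \<in> J" for s
    using radical_full_support[OF J z that] .
  have "c \<in> (\<lambda>s. coord y s / coord z s) ` J"
    unfolding c_def using JS \<open>J \<noteq> {}\<close> by (intro Min_in) auto
  then obtain r where r: "r \<in> J" "c = coord y r / coord z r"
    by blast
  have c0: "c \<ge> 0"
    using r JS y(2) zp[of r] by (auto simp: nonneg_def intro!: divide_nonneg_pos)
  have "c * coord z s \<le> coord y s" if "s \<in> J" for s
  proof -
    have "c \<le> coord y s / coord z s"
      unfolding c_def using JS that by (intro Min_le) auto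
    then show ?thesis
      using zp[OF that] by (simp add: field_simps)
  qed
  then have "c * coord z s \<le> coord y s" if "s \<in> S" for s
    using z(1) y(1) that by (cases "s \<in> J") (auto simp: supported_def)
  then have nn: "nonneg (y - c *\<^sub>R z)"
    by (simp add: nonneg_def coord_simps)
  have "y - c *\<^sub>R z = 0"
  proof (rule ccontr)
    assume "y - c *\<^sub>R z \<noteq> 0"
    then have "coord (y - c *\<^sub>R z) r > 0"
      using z y nn r(1) by (intro radical_full_support[OF J])
        (auto simp: supported_def coord_simps intro!: radical_diff radical_scale)
    then show False
      using r zp[OF r(1)] by (simp add: coord_simps)
  qed
  then show ?thesis
    using c0 by (intro exI[of _ c]) simp
qed

text \<open>Taking absolute values of the coordinates does not increase the norm, since the
  off-diagonal entries are nonpositive, so the result \<open>y\<close> is radical as well. At any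
  coordinate one of y + z and y - z vanishes, and full support makes one of these vectors
  zero.\<close>

lemma radical_sign:
  assumes J: "J \<in> irreducible_components" and z: "supported J z" "radical z"
  shows "nonneg z \<or> nonneg (- z)"
proof -
  define y where "y = (\<Sum>s\<in>S. \<bar>coord z s\<bar> *\<^sub>R \<alpha> s)"
  have y: "coord y s = \<bar>coord z s\<bar>" if "s \<in> S" for s
    using that by (simp add: y_def coord_combination)
  have "form y y \<le> form z z"
    unfolding form_gram
  proof (intro sum_mono)
    fix s t assume st: "s \<in> S" "t \<in> S"
    show "coord y s * coord y t * gram s t \<le> coord z s * coord z t * gram s t"
    proof (cases "s = t")
      case False
      then have "gram s t \<le> 0"
        using gram_nonpos st by blast
      moreover have "coord z s * coord z t \<le> coord y s * coord y t"
        using st by (simp add: y abs_mult[symmetric])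
      ultimately show ?thesis
        by (intro mult_right_mono_neg)
    qed (use st y in auto)
  qed
  also have "\<dots> = 0"
    using z by simp
  finally have "radical y"
    by (rule radicalI)
  have supp: "supported J (y + z)" "supported J (y - z)"
    using z by (auto simp: supported_def coord_simps y)
  have nn: "nonneg (y + z)" "nonneg (y - z)"
    by (auto simp: nonneg_def coord_simps y)
  obtain s where s: "s \<in> J" "s \<in> S"
    using J by (auto simp: irreducible_components_def)
  have "y + z = 0 \<or> y - z = 0"
  proof (rule ccontr)
    assume "\<not> ?thesis"
    then have "coord (y + z) s > 0" "coord (y - z) s > 0"
      using radical_full_support[OF J supp(1) nn(1)] radical_full_support[OF J supp(2) nn(2)] s
        \<open>radical y\<close> z(2) radical_add radical_diff by auto
    then show False
      using s by (auto simp: coord_simps y)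
  qed
  then have "- z = y \<or> z = y"
    by (auto simp: eq_neg_iff_add_eq_0 neg_eq_iff_add_eq_0 add.commute)
  moreover have "nonneg y"
    by (simp add: nonneg_def y)
  ultimately show ?thesis
    by metis
qed

section \<open>Dominance as translation by radical vectors\<close>

lemma root_supported:
  assumes "a \<in> roots"
  shows "\<exists>J\<in>irreducible_components. supported J a"
proof -
  obtain w s where ws: "w \<in> carrier W" "s \<in> S" "a = act w (\<alpha> s)"
    using assms by (auto simp: roots_def)
  obtain J where J: "J \<in> irreducible_components" "s \<in> J"
    using ex_component ws by blast
  have "supported J (act w (\<alpha> s))"
    using ws(1)
  proof (induction rule: act_induct)
    case one
    then show ?case
      using J ws by (auto simp: supported_def coord_simple)
  next
    case (gen t w)
    have "form (\<alpha> t) (act w (\<alpha> s)) = 0" if "t \<notin> J"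
      unfolding form_commute[of "\<alpha> t"]
      using that gen.hyps(1) component_subset[OF J(1)]
      by (intro form_component[OF J(1) gen.IH]) (auto simp: coord_simple)
    then show ?case
      using gen by (auto simp: supported_def reflect_def coord_simps coord_simple)
  qed
  then show ?thesis
    using ws J by blast
qed

text \<open>W fixes the radical vector \<open>b - a\<close>, so the pullbacks of \<open>a\<close>
  and \<open>b\<close> still differ by the same nonnegative vector.\<close>

lemma dom_leI:
  assumes "a \<in> pos_roots" "b \<in> pos_roots" "nonneg (b - a)" "radical (b - a)"
  shows "dom_le a b"
  unfolding dom_le_def
proof (intro conjI ballI impI)
  fix w assume w: "w \<in> carrier W" "b \<in> inv_set w"
  have "act (inv w) (b - a) = b - a"
    using w assms(4) by simp
  then have "- act (inv w) a = - act (inv w) b + (b - a)"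
    using w(1) by (simp add: act_linear_simps algebra_simps)
  then have "nonneg (- act (inv w) a)"
    using nonneg_add[OF inv_set_nonpos[OF w] assms(3)] by (simp only:)
  then show "a \<in> inv_set w"
    using w assms by (intro inv_setI) auto
qed (use assms in auto)

text \<open>The norm of \<open>b - a\<close> is 2 - 2 B(a, b) <= 0. Of the two possible signs of
  this radical vector, the wrong one would make the dominance mutual.\<close>

lemma dom_le_diff:
  assumes "dom_le a b" "a \<noteq> b"
  shows "radical (b - a)" "nonneg (b - a)"
    "J \<in> irreducible_components \<Longrightarrow> supported J b \<Longrightarrow> supported J a"
proof -
  have pos: "a \<in> pos_roots" "b \<in> pos_roots"
    using assms by (auto simp: dom_le_def)
  have B: "form a b \<ge> 1"
    using dom_le_form assms .
  show rad: "radical (b - a)"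
    using pos B form_root by (intro radicalI) (auto simp: form_simps pos_roots_iff form_commute[of b a])
  show supp: "supported J a" if J: "J \<in> irreducible_components" "supported J b" for J
  proof -
    obtain K where K: "K \<in> irreducible_components" "supported K a"
      using root_supported pos pos_roots_iff by blast
    have "J = K"
    proof (rule ccontr)
      assume "J \<noteq> K"
      then have "K \<inter> J = {}"
        using component_disjoint K(1) J(1) by blast
      then have "form a b = 0"
        using K J component_subset[OF K(1)] by (intro form_component[OF K]) (auto simp: supported_def)
      then show False
        using B by simp
    qed
    then show ?thesis
      using K by simp
  qed
  obtain J where J: "J \<in> irreducible_components" "supported J b"
    using root_supported pos pos_roots_iff by blast
  have "supported J (b - a)"
    using supp[OF J] J by (auto simp: supported_def coord_simps)
  then have "nonneg (b - a) \<or> nonneg (- (b - a))"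
    using radical_sign J rad by blast
  moreover have "\<not> nonneg (- (b - a))"
  proof
    assume "nonneg (- (b - a))"
    then have "dom_le b a"
      using pos rad radical_minus[OF rad] by (intro dom_leI) auto
    then show False
      using dom_le_antisym assms by blast
  qed
  ultimately show "nonneg (b - a)"
    by blast
qed

end


subsection \<open>Bipodality and locally minimal elements\<close>

context affine_coxeter
begin

lemma supported_pair:
  assumes "s \<in> S" "t \<in> S" "s \<noteq> t" "supported {s, t} x"
  shows "x = coord x s *\<^sub>R \<alpha> s + coord x t *\<^sub>R \<alpha> t"
  using assms by (intro coord_eqI) (auto simp: supported_def coord_simps coord_simple)

lemma form_pair:
  assumes "s \<in> S" "t \<in> S" "s \<noteq> t" "supported {s, t} x"
  shows "form y x = coord x s * form y (\<alpha> s) + coord x t * form y (\<alpha> t)"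
  by (subst supported_pair[OF assms]) (simp add: form_simps)

lemma act_pair:
  assumes "s \<in> S" "t \<in> S" "s \<noteq> t" "supported {s, t} x" "u \<in> carrier W"
  shows "act u x = coord x s *\<^sub>R act u (\<alpha> s) + coord x t *\<^sub>R act u (\<alpha> t)"
  by (subst supported_pair[OF assms(1-4)]) (simp add: act_linear_simps assms)

lemma height_simple: "s \<in> S \<Longrightarrow> height (\<alpha> s) = 1"
  using finite_gens by (simp add: height_def coord_simple)

lemma act_reflect:
  assumes "u \<in> carrier W"
  shows "act u (reflect a x) = reflect (act u a) (act u x)"
  using assms by (simp add: reflect_def act_linear_simps form_act)

text \<open>
  If \<open>u \<alpha>\<^sub>s\<close> properly dominates \<open>u \<alpha>\<^sub>s - z\<close>, then every other root of the rank two system, except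
  \<open>u \<alpha>\<^sub>t\<close>, properly dominates a translate of itself by a multiple of \<open>- z\<close>; the bound on \<open>c\<close> keeps
  the translate positive.
\<close>

lemma dihedral_translate:
  assumes st: "s \<in> S" "t \<in> S" "s \<noteq> t" and u: "u \<in> carrier W"
    and fin: "finite {v \<in> pos_roots. supported {s, t} v}"
    and z: "radical z" "act u (\<alpha> s) - z \<in> roots"
    and v: "v \<in> pos_roots" "supported {s, t} v" "v \<noteq> \<alpha> t"
  shows "\<exists>c>0. c \<le> coord v s \<and> act u v - c *\<^sub>R z \<in> roots"
  using v
proof (induction "card {x \<in> {v \<in> pos_roots. supported {s, t} v}. height x < height v}" arbitrary: v
    rule: less_induct)
  case less
  let ?P = "{v \<in> pos_roots. supported {s, t} v}"
  show ?case
  proof (cases "v = \<alpha> s")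
    case True
    then show ?thesis
      using z st by (intro exI[of _ 1]) (simp add: coord_simple)
  next
    case False
    have nn: "coord v s \<ge> 0" "coord v t \<ge> 0"
      using less.prems st by (auto simp: pos_roots_iff nonneg_def)
    \<comment> \<open>Having norm 1, \<open>v\<close> pairs positively with one of the two simple
      roots; reflecting in that root lowers the height and drives the induction.\<close>
    have "1 = coord v s * form v (\<alpha> s) + coord v t * form v (\<alpha> t)"
      using form_pair[OF st less.prems(2), of v] form_root less.prems(1) by (simp add: pos_roots_iff)
    then have "\<not> (form v (\<alpha> s) \<le> 0 \<and> form v (\<alpha> t) \<le> 0)"
      using nn by (smt (verit) mult_nonneg_nonpos)
    then obtain r where r: "r \<in> {s, t}" "form v (\<alpha> r) > 0"
      by force
    have rS: "r \<in> S"
      using r st by auto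
    define v' where "v' = sref r v"
    have vv': "v = sref r v'"
      using rS by (simp add: v'_def reflect_reflect)
    have "v \<noteq> \<alpha> r"
      using r(1) False less.prems(3) by auto
    then have v'_pos: "v' \<in> pos_roots"
      using sref_pos_root rS less.prems(1) by (simp add: v'_def)
    have v'_supp: "supported {s, t} v'"
      unfolding supported_def
    proof
      fix p assume p: "p \<in> S - {s, t}"
      then have "coord v' p = coord v p"
        using r(1) rS by (auto simp: v'_def coord_sref_other)
      then show "coord v' p = 0"
        using p less.prems(2) by (simp add: supported_def)
    qed
    have "height v' = height v - 2 * form v (\<alpha> r)"
      using rS by (simp add: v'_def reflect_def height_simps height_simple form_commute)
    then have "height v' < height v"
      using r by simp
    then have "{x \<in> ?P. height x < height v'} \<subset> {x \<in> ?P. height x < height v}"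
      using v'_pos v'_supp by (auto intro: order.strict_trans)
    then have card: "card {x \<in> ?P. height x < height v'} < card {x \<in> ?P. height x < height v}"
      by (rule psubset_card_mono[rotated]) (rule finite_subset[OF _ fin], auto)
    have act_v: "act u v = reflect (act u (\<alpha> r)) (act u v')"
      using u act_reflect vv' by metis
    have refl_root: "reflect (act u (\<alpha> r)) x \<in> roots" if "x \<in> roots" for x
      using that rS u by (intro reflect_root) (auto intro: act_root simple_root)
    have refl_diff: "reflect (act u (\<alpha> r)) (x - c *\<^sub>R z) = reflect (act u (\<alpha> r)) x - c *\<^sub>R z" for x c
      using z(1) by (simp add: reflect_def form_simps)
    show ?thesis
    proof (cases "v' = \<alpha> t")
      case False
      obtain c where c: "c > 0" "c \<le> coord v' s" "act u v' - c *\<^sub>R z \<in> roots"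
        using less.hyps[OF card v'_pos v'_supp False] by blast
      \<comment> \<open>Going back up, the reflection in \<open>\<alpha> s\<close> raises this
        coordinate and the one in \<open>\<alpha> t\<close> keeps it, so the bound on
        \<open>c\<close> persists.\<close>
      have "coord v' s \<le> coord v s"
      proof (cases "r = s")
        case True
        then show ?thesis
          using r st by (simp add: v'_def reflect_def coord_simps coord_simple form_commute)
      next
        case False
        then show ?thesis
          using st r by (simp add: v'_def coord_sref_other)
      qed
      moreover have "act u v - c *\<^sub>R z \<in> roots"
        using refl_root[OF c(3)] by (simp add: refl_diff act_v)
      ultimately show ?thesis
        using c by (intro exI[of _ c]) auto
    next
      case True
      have "r = s"
      proof (rule ccontr)
        assume "r \<noteq> s"
        then have "v = - \<alpha> t"
          using r st vv' True by (simp add: reflect_self)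
        then show False
          using less.prems(1) st simple_root root_not_both nonneg_simple by (force simp: pos_roots_iff)
      qed
      \<comment> \<open>Here no translate of \<open>v'\<close> is at hand. Instead
        \<open>act u (\<alpha> t)\<close> is reflected in the translated root
        \<open>act u (\<alpha> s) - z\<close>, which produces the shift by
        \<open>- 2 * b\<close>.\<close>
      define b where "b = form (\<alpha> s) (\<alpha> t)"
      have v: "v = \<alpha> t - (2 * b) *\<^sub>R \<alpha> s"
        using vv' True \<open>r = s\<close> by (simp add: reflect_def b_def)
      have "form v (\<alpha> s) = - b"
        using st by (simp add: v form_simps form_commute[of "\<alpha> t"] b_def)
      then have "b < 0"
        using r \<open>r = s\<close> by simp
      moreover have "coord v s = - 2 * b"
        using st by (simp add: v coord_simps coord_simple)
      moreover have "act u v - (- 2 * b) *\<^sub>R z = reflect (act u (\<alpha> s) - z) (act u (\<alpha> t))"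
        using u z(1) by (simp add: v reflect_def act_linear_simps form_simps form_act b_def algebra_simps)
      moreover have "reflect (act u (\<alpha> s) - z) (act u (\<alpha> t)) \<in> roots"
        using z u st by (intro reflect_root act_root simple_root)
      ultimately show ?thesis
        by (intro exI[of _ "- 2 * b"]) auto
    qed
  qed
qed

text \<open>If \<open>act u (\<alpha> s)\<close> properly dominated some \<open>b\<close>, their
  difference \<open>z\<close> would yield a translate of \<open>act u v\<close> by
  \<open>- c *\<^sub>R z\<close>. As c is at most the coordinate of \<open>v\<close> at
  \<open>s\<close>, the translate is a nonnegative combination of \<open>b\<close> and the two
  simple roots, hence a positive root properly dominated by \<open>act u v\<close>.\<close>

lemma small_root_bipodal:
  assumes st: "s \<in> S" "t \<in> S" "s \<noteq> t" and u: "u \<in> carrier W"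
    and pos: "act u (\<alpha> s) \<in> pos_roots" "act u (\<alpha> t) \<in> pos_roots"
    and fin: "finite {v \<in> pos_roots. supported {s, t} v}"
    and v: "v \<in> pos_roots" "supported {s, t} v" "v \<noteq> \<alpha> t" and small: "act u v \<in> small_roots"
  shows "act u (\<alpha> s) \<in> small_roots"
proof (rule ccontr)
  assume "act u (\<alpha> s) \<notin> small_roots"
  then obtain b where b: "b \<in> pos_roots" "dom_le b (act u (\<alpha> s))" "b \<noteq> act u (\<alpha> s)"
    using pos by (auto simp: small_roots_def)
  define z where "z = act u (\<alpha> s) - b"
  have z: "radical z" "nonneg z" "z \<noteq> 0"
    using dom_le_diff[OF b(2,3)] b(3) by (auto simp: z_def)
  have bz: "act u (\<alpha> s) - z = b"
    by (simp add: z_def)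
  then obtain c where c: "c > 0" "c \<le> coord v s" "act u v - c *\<^sub>R z \<in> roots"
    using dihedral_translate[OF st u fin z(1) _ v] b(1) by (auto simp: pos_roots_iff)
  have "act u v - c *\<^sub>R z = c *\<^sub>R b + (coord v s - c) *\<^sub>R act u (\<alpha> s) + coord v t *\<^sub>R act u (\<alpha> t)"
    by (subst act_pair[OF st v(2) u]) (simp add: z_def algebra_simps)
  also have "nonneg \<dots>"
    using c b pos v(1) st(2) by (intro nonneg_add nonneg_scale) (auto simp: pos_roots_iff nonneg_def)
  finally have "act u v - c *\<^sub>R z \<in> pos_roots"
    using c by (simp add: pos_roots_iff)
  moreover have "dom_le (act u v - c *\<^sub>R z) (act u v)"
    using calculation small c z by (intro dom_leI) (auto simp: small_roots_def intro: nonneg_scale radical_scale)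
  ultimately have "act u v - c *\<^sub>R z = act u v"
    using small by (auto simp: small_roots_def)
  then show False
    using c z by simp
qed

text \<open>Any right descent of m^-1 u serves: the inclusion makes it a descent of
  \<open>u\<close>, and the root lost in this step is not an inversion of \<open>m\<close>.\<close>

lemma inv_set_subset_descent:
  assumes "m \<in> carrier W" "u \<in> carrier W" "inv_set m \<subseteq> inv_set u" "m \<noteq> u"
  shows "\<exists>s\<in>S. act u (\<alpha> s) \<notin> pos_roots \<and> inv_set m \<subseteq> inv_set (u \<otimes> s)"
proof -
  define d where "d = inv m \<otimes> u"
  have d: "d \<in> carrier W" "u = m \<otimes> d"
    using assms by (auto simp: d_def m_assoc[symmetric])
  then have "d \<noteq> \<one>"
    using assms by auto
  then obtain s where s: "s \<in> S" "act d (\<alpha> s) \<notin> pos_roots"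
    using eq_one_if_no_descent[OF d(1)] by blast
  have b: "- act d (\<alpha> s) \<in> pos_roots"
    using descent_root(1)[OF d(1) s] .
  have us: "act u (\<alpha> s) = act m (act d (\<alpha> s))"
    using d assms(1) by simp
  have notin: "act u (\<alpha> s) \<notin> pos_roots"
  proof
    assume p: "act u (\<alpha> s) \<in> pos_roots"
    have "act u (\<alpha> s) \<in> inv_set m"
      using p b assms(1) by (intro inv_setI) (auto simp: us pos_roots_iff)
    then have "act u (\<alpha> s) \<in> inv_set u"
      using assms by blast
    then show False
      using s(1) assms(2) nonneg_simple by (simp add: inv_set_iff)
  qed
  note D = descent_root[OF assms(2) s(1) notin]
  have "- act u (\<alpha> s) \<notin> inv_set m"
    using b assms(1) by (simp add: inv_set_iff us pos_roots_iff)
  then have "inv_set m \<subseteq> inv_set (u \<otimes> s)"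
    using assms(3) D(2) by auto
  then show ?thesis
    using s(1) notin by blast
qed

lemma word_act_coord_other:
  "x \<in> lists {s, t} \<Longrightarrow> s \<in> S \<Longrightarrow> t \<in> S \<Longrightarrow> r \<in> S - {s, t} \<Longrightarrow> coord (word_act x y) r = coord y r"
  by (induction x) (auto simp: coord_sref_other)

text \<open>\<open>u0\<close> is the minimal element of the coset \<open>u W\<^sub>s\<^sub>,\<^sub>t\<close>.\<close>

lemma two_descents:
  assumes u: "u \<in> carrier W" and st: "s \<in> S" "t \<in> S" "s \<noteq> t"
    and desc: "act u (\<alpha> s) \<notin> pos_roots" "act u (\<alpha> t) \<notin> pos_roots"
  obtains u0 where "u0 \<in> carrier W" "act u0 (\<alpha> s) \<in> pos_roots" "act u0 (\<alpha> t) \<in> pos_roots"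
    "inv_set u0 \<subseteq> inv_set (u \<otimes> s)" "inv_set u0 \<subseteq> inv_set (u \<otimes> t)"
    "\<And>x. x \<in> inv_set u \<Longrightarrow> x \<notin> inv_set u0 \<Longrightarrow> \<exists>v\<in>pos_roots. supported {s, t} v \<and> x = act u0 v"
    "act u0 (\<alpha> s) \<in> {- act u (\<alpha> s), - act u (\<alpha> t)}" "act u0 (\<alpha> t) \<in> {- act u (\<alpha> s), - act u (\<alpha> t)}"
    "finite {v \<in> pos_roots. supported {s, t} v}"
proof -
  \<comment> \<open>Candidates are the coset elements below \<open>u\<close> in weak order; a
    shortest one has no descent at \<open>s\<close> or \<open>t\<close>, as that would lead to a
    shorter candidate.\<close>
  define D where "D v \<longleftrightarrow> v \<in> carrier W \<and> inv_set v \<subseteq> inv_set u \<and> (\<exists>x\<in>lists {s, t}. u = v \<otimes> word_value W x)" for v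
  have "D u"
    using u by (auto simp: D_def intro!: bexI[of _ "[]"])
  then obtain u0 where u0: "D u0" "\<And>v. D v \<Longrightarrow> len u0 \<le> len v"
    using arg_min_nat_lemma[of D u len] by blast
  then obtain x where x: "u0 \<in> carrier W" "inv_set u0 \<subseteq> inv_set u" "x \<in> lists {s, t}" "u = u0 \<otimes> word_value W x"
    by (auto simp: D_def)
  have xS: "x \<in> lists S"
    using x(3) st by auto
  define d where "d = word_value W x"
  have d: "d \<in> carrier W" "u = u0 \<otimes> d"
    using xS x by (auto simp: d_def)
  have asc: "act u0 (\<alpha> r) \<in> pos_roots" if "r \<in> {s, t}" for r
  proof (rule ccontr)
    assume no: "act u0 (\<alpha> r) \<notin> pos_roots"
    have rS: "r \<in> S"
      using that st by auto
    note R = descent_root[OF x(1) rS no]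
    have "u = (u0 \<otimes> r) \<otimes> word_value W (r # x)"
      using x rS xS by (simp add: m_assoc)
    then have "D (u0 \<otimes> r)"
      using x R(2) that rS unfolding D_def by (intro conjI bexI[of _ "r # x"]) auto
    then show False
      using u0(2) R(4) by fastforce
  qed
  have cd: "coord (act d y) r = coord y r" "coord (act (inv d) y) r = coord y r" if "r \<in> S - {s, t}" for r y
  proof -
    have "rev x \<in> lists {s, t}" "rev x \<in> lists S"
      using x(3) xS by auto
    then show "coord (act d y) r = coord y r" "coord (act (inv d) y) r = coord y r"
      using act_word_value[OF xS] act_word_value[of "rev x"] word_value_rev[OF xS]
        word_act_coord_other[OF _ st(1,2) that, of _ y] x(3) by (auto simp: d_def)
  qed
  have act_u: "act u y = act u0 (act d y)" for y
    using d x(1) by simp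
  have act_inv_u: "act (inv u) y = act (inv d) (act (inv u0) y)" for y
    using d x(1) by (simp add: inv_mult_group)
  have simple_supp: "supported {s, t} (\<alpha> r)" if "r \<in> {s, t}" for r
    using that st by (auto simp: supported_def coord_simple split: if_splits)
  have neg: "- act d (\<alpha> r) \<in> pos_roots" "supported {s, t} (- act d (\<alpha> r))" if r: "r \<in> {s, t}" for r
  proof -
    have rS: "r \<in> S" and rd: "act u (\<alpha> r) \<notin> pos_roots"
      using r st desc by auto
    have supp: "supported {s, t} (act d (\<alpha> r))"
      using simple_supp[OF r] cd by (auto simp: supported_def)
    then show "supported {s, t} (- act d (\<alpha> r))"
      by (simp add: supported_def coord_simps)
    have root: "act d (\<alpha> r) \<in> roots"
      using rS d by (intro act_root simple_root)
    have "\<not> nonneg (act d (\<alpha> r))"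
    proof
      assume "nonneg (act d (\<alpha> r))"
      then have "nonneg (act u (\<alpha> r))"
        using asc st unfolding act_u act_pair[OF st supp x(1)]
        by (intro nonneg_add nonneg_scale) (auto simp: nonneg_def pos_roots_iff)
      then show False
        using rd rS u by (auto simp: pos_roots_iff act_root simple_root)
    qed
    then show "- act d (\<alpha> r) \<in> pos_roots"
      using root root_sign minus_root by (auto simp: pos_roots_iff)
  qed
  have notin: "- act u (\<alpha> r) \<notin> inv_set u0" if "r \<in> {s, t}" for r
    using neg(1)[OF that] x(1) by (simp add: inv_set_iff act_u pos_roots_iff)
  have "inv_set u0 \<subseteq> inv_set (u \<otimes> r)" if "r \<in> S" "r \<in> {s, t}" "act u (\<alpha> r) \<notin> pos_roots" for r
    using notin[OF that(2)] x(2) descent_root(2)[OF u that(1,3)] by auto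
  then have sub: "inv_set u0 \<subseteq> inv_set (u \<otimes> s)" "inv_set u0 \<subseteq> inv_set (u \<otimes> t)"
    using st desc by auto
  \<comment> \<open>The dihedral factor \<open>d\<close> does not affect coordinates outside
    \<open>{s, t}\<close>. There the pulled back root and its negative are both nonnegative, so it
    lies in the plane.\<close>
  have part: "\<exists>v\<in>pos_roots. supported {s, t} v \<and> y = act u0 v" if y: "y \<in> inv_set u" "y \<notin> inv_set u0" for y
  proof (intro bexI conjI)
    let ?v = "act (inv u0) y"
    have "y \<in> pos_roots"
      using y u by (simp add: inv_set_iff)
    show v: "?v \<in> pos_roots"
      using y u x(1) by (auto simp: inv_set_iff pos_roots_iff root_act_inv_iff)
    show "y = act u0 ?v"
      using x(1) by simp
    have "nonneg (- act (inv d) ?v)"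
      using inv_set_nonpos[OF u y(1)] by (simp add: act_inv_u)
    then show "supported {s, t} ?v"
      using v cd(2)[of _ ?v] by (force simp: supported_def nonneg_def pos_roots_iff coord_simps)
  qed
  \<comment> \<open>\<open>u\<close> makes every positive root of the plane negative, so these roots
    are as few as the inversions of \<open>u\<close>.\<close>
  have fin: "finite {v \<in> pos_roots. supported {s, t} v}"
  proof (rule finite_subset)
    show "{v \<in> pos_roots. supported {s, t} v} \<subseteq> (\<lambda>y. - act (inv u) y) ` inv_set u"
    proof
      fix v assume "v \<in> {v \<in> pos_roots. supported {s, t} v}"
      then have v: "v \<in> pos_roots" "supported {s, t} v"
        by auto
      have "- act u v = coord v s *\<^sub>R (- act u (\<alpha> s)) + coord v t *\<^sub>R (- act u (\<alpha> t))"
        by (simp add: act_pair[OF st v(2) u])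
      also have "nonneg \<dots>"
        using descent_root(1)[OF u st(1) desc(1)] descent_root(1)[OF u st(2) desc(2)] v(1) st
        by (intro nonneg_add nonneg_scale) (auto simp: pos_roots_iff nonneg_def)
      finally have "- act u v \<in> pos_roots"
        using v u by (auto simp: pos_roots_iff act_root minus_root)
      then have "- act u v \<in> inv_set u"
        using v u by (intro inv_setI) (auto simp: pos_roots_iff)
      then show "v \<in> (\<lambda>y. - act (inv u) y) ` inv_set u"
        using u by (intro image_eqI[of _ _ "- act u v"]) auto
    qed
  qed (use finite_inv_set u in simp)
  \<comment> \<open>\<open>d\<close> is the longest element of the dihedral group, and - d permutes
    the two extreme rays of the positive cone of the plane. Concretely, \<open>\<alpha> r\<close> is
    a nonnegative combination of two positive roots, so one that occurs in it must be
    \<open>\<alpha> r\<close> itself.\<close>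
  have simple_in: "act u0 (\<alpha> r) \<in> {- act u (\<alpha> s), - act u (\<alpha> t)}" if r: "r \<in> {s, t}" for r
  proof -
    have rS: "r \<in> S"
      using r st by auto
    define k where "k = act (inv d) (\<alpha> r)"
    have k: "supported {s, t} k"
      using simple_supp[OF r] cd by (auto simp: supported_def k_def)
    have "\<alpha> r = act d k"
      using d by (simp add: k_def)
    then have ar: "\<alpha> r = (- coord k s) *\<^sub>R (- act d (\<alpha> s)) + (- coord k t) *\<^sub>R (- act d (\<alpha> t))"
      using act_pair[OF st k d(1)] by simp
    have root: "k \<in> roots"
      using rS d by (simp add: k_def act_root simple_root)
    have "\<not> nonneg k"
    proof
      assume kn: "nonneg k"
      have "- \<alpha> r = coord k s *\<^sub>R (- act d (\<alpha> s)) + coord k t *\<^sub>R (- act d (\<alpha> t))"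
        by (subst ar) simp
      also have "nonneg \<dots>"
        using neg kn st by (intro nonneg_add nonneg_scale) (auto simp: pos_roots_iff nonneg_def)
      finally show False
        using rS simple_root root_not_both nonneg_simple by blast
    qed
    then have "nonneg (- k)"
      using root root_sign by blast
    then have kk: "- coord k s \<ge> 0" "- coord k t \<ge> 0"
      using st by (auto simp: nonneg_def coord_simps)
    have zero: "coord (- act d (\<alpha> q)) p = 0" if "q \<in> {s, t}" "- coord k q > 0" "p \<in> S" "p \<noteq> r" for p q
    proof -
      have "0 = (- coord k s) * coord (- act d (\<alpha> s)) p + (- coord k t) * coord (- act d (\<alpha> t)) p"
        using arg_cong[OF ar, of "\<lambda>x. coord x p"] that rS by (simp add: coord_simps coord_simple)
      moreover have "(- coord k s) * coord (- act d (\<alpha> s)) p \<ge> 0" "(- coord k t) * coord (- act d (\<alpha> t)) p \<ge> 0"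
        using kk neg(1)[of s] neg(1)[of t] that(3)
        by (auto simp: pos_roots_iff nonneg_def intro!: mult_nonneg_nonneg[of "- coord k _", simplified])
      ultimately have "(- coord k q) * coord (- act d (\<alpha> q)) p = 0"
        using that(1) by (smt (verit) insert_iff singletonD)
      then show ?thesis
        using that(2) by (metis less_irrefl mult_eq_0_iff)
    qed
    have eq: "\<alpha> r = - act d (\<alpha> q)" if "q \<in> {s, t}" "- coord k q > 0" for q
      using root_multiple_simple[OF neg(1)[OF that(1)] rS] zero[OF that] by metis
    have "k \<noteq> 0"
      using root root_nonzero by blast
    then have "coord k s \<noteq> 0 \<or> coord k t \<noteq> 0"
      using supported_pair[OF st k] by auto
    then have "\<exists>q\<in>{s, t}. - coord k q > 0"
      using kk by force
    then obtain q where q: "q \<in> {s, t}" "\<alpha> r = - act d (\<alpha> q)"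
      using eq by blast
    have "act u0 (\<alpha> r) = - act u (\<alpha> q)"
      using x(1) by (subst q(2)) (simp add: act_u)
    then show ?thesis
      using q(1) by auto
  qed
  show ?thesis
    using that[OF x(1) asc asc sub part simple_in simple_in fin] by blast
qed

text \<open>A small inversion of \<open>w\<close> missing from N(u0) would be a non-simple root of
  the rank two system at \<open>u0\<close>, so by bipodality both simple roots there are small.
  Being small but not among the small inversions of \<open>w\<close>, they are not inverted by
  \<open>w\<close>; then neither is any nonnegative combination of them.\<close>

lemma diamond:
  assumes w: "w \<in> carrier W" and u: "u \<in> carrier W" and st: "s \<in> S" "t \<in> S" "s \<noteq> t"
    and desc: "act u (\<alpha> s) \<notin> pos_roots" "act u (\<alpha> t) \<notin> pos_roots"
    and X: "small_roots \<inter> inv_set w \<subseteq> inv_set (u \<otimes> s)" "small_roots \<inter> inv_set w \<subseteq> inv_set (u \<otimes> t)"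
  obtains u0 where "u0 \<in> carrier W" "inv_set u0 \<subseteq> inv_set (u \<otimes> s)" "inv_set u0 \<subseteq> inv_set (u \<otimes> t)"
    "small_roots \<inter> inv_set w \<subseteq> inv_set u0"
proof -
  obtain u0 where u0: "u0 \<in> carrier W" "act u0 (\<alpha> s) \<in> pos_roots" "act u0 (\<alpha> t) \<in> pos_roots"
    "inv_set u0 \<subseteq> inv_set (u \<otimes> s)" "inv_set u0 \<subseteq> inv_set (u \<otimes> t)"
    and part: "\<And>x. x \<in> inv_set u \<Longrightarrow> x \<notin> inv_set u0 \<Longrightarrow> \<exists>v\<in>pos_roots. supported {s, t} v \<and> x = act u0 v"
    and simple: "act u0 (\<alpha> s) \<in> {- act u (\<alpha> s), - act u (\<alpha> t)}"
    "act u0 (\<alpha> t) \<in> {- act u (\<alpha> s), - act u (\<alpha> t)}"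
    and fin: "finite {v \<in> pos_roots. supported {s, t} v}"
    by (rule two_descents[OF u st desc]) (rule that, assumption+)
  \<comment> \<open>Each of the two descent roots is lost in its own step, so the inclusions
    \<open>X\<close> keep it out of the small inversions of \<open>w\<close>.\<close>
  have "- act u (\<alpha> s) \<notin> small_roots \<inter> inv_set w" "- act u (\<alpha> t) \<notin> small_roots \<inter> inv_set w"
    using X descent_root(3)[OF u st(1) desc(1)] descent_root(3)[OF u st(2) desc(2)] by auto
  then have no: "act u0 (\<alpha> s) \<notin> small_roots \<inter> inv_set w" "act u0 (\<alpha> t) \<notin> small_roots \<inter> inv_set w"
    using simple by auto
  have "y \<in> inv_set u0" if y: "y \<in> small_roots" "y \<in> inv_set w" for y
  proof (rule ccontr)
    assume "y \<notin> inv_set u0"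
    moreover have "y \<in> inv_set u"
      using X(1) y descent_root(2)[OF u st(1) desc(1)] by blast
    ultimately obtain v where v: "v \<in> pos_roots" "supported {s, t} v" "y = act u0 v"
      using part by blast
    have "v \<noteq> \<alpha> s" "v \<noteq> \<alpha> t"
      using no y v(3) by auto
    moreover have ts: "{t, s} = {s, t}"
      by auto
    ultimately have small: "act u0 (\<alpha> s) \<in> small_roots" "act u0 (\<alpha> t) \<in> small_roots"
      using small_root_bipodal[OF st u0(1-3) fin v(1,2)] y(1) v(3)
        small_root_bipodal[OF st(2,1) st(3)[symmetric] u0(1,3,2), unfolded ts, OF fin v(1,2)]
      by simp_all
    then have "act u0 (\<alpha> s) \<notin> inv_set w" "act u0 (\<alpha> t) \<notin> inv_set w"
      using no by auto
    then have "nonneg (act (inv w) (act u0 (\<alpha> s)))" "nonneg (act (inv w) (act u0 (\<alpha> t)))"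
      using u0 w by (auto simp: inv_set_iff)
    moreover have "act (inv w) y = coord v s *\<^sub>R act (inv w) (act u0 (\<alpha> s))
        + coord v t *\<^sub>R act (inv w) (act u0 (\<alpha> t))"
      using w unfolding v(3) act_pair[OF st v(2) u0(1)] by (simp add: act_linear_simps)
    moreover have "coord v s \<ge> 0" "coord v t \<ge> 0"
      using v(1) st by (auto simp: pos_roots_iff nonneg_def)
    ultimately have "nonneg (act (inv w) y)"
      by (simp add: nonneg_add nonneg_scale)
    then show False
      using y(2) w by (simp add: inv_set_iff)
  qed
  then show ?thesis
    using that u0 by blast
qed

section \<open>Locally minimal elements and their uniqueness below a common bound\<close>

definition locally_minimal :: "'w \<Rightarrow> 'w \<Rightarrow> bool" where
  "locally_minimal w m \<longleftrightarrow> m \<in> carrier W \<and> small_roots \<inter> inv_set w \<subseteq> inv_set m \<and>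
     (\<forall>s\<in>S. act m (\<alpha> s) \<notin> pos_roots \<longrightarrow> \<not> small_roots \<inter> inv_set w \<subseteq> inv_set (m \<otimes> s))"

lemma ex_locally_minimal:
  assumes "u \<in> carrier W" "small_roots \<inter> inv_set w \<subseteq> inv_set u"
  shows "\<exists>m. locally_minimal w m \<and> inv_set m \<subseteq> inv_set u"
proof -
  let ?P = "\<lambda>m. m \<in> carrier W \<and> small_roots \<inter> inv_set w \<subseteq> inv_set m \<and> inv_set m \<subseteq> inv_set u"
  have "?P u"
    using assms by simp
  then obtain m where m: "?P m" "\<And>v. ?P v \<Longrightarrow> len m \<le> len v"
    using arg_min_nat_lemma[of ?P u len] by blast
  have "locally_minimal w m"
    unfolding locally_minimal_def
  proof (intro conjI ballI impI notI)
    fix s assume s: "s \<in> S" "act m (\<alpha> s) \<notin> pos_roots" "small_roots \<inter> inv_set w \<subseteq> inv_set (m \<otimes> s)"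
    have mc: "m \<in> carrier W" "inv_set m \<subseteq> inv_set u"
      using m(1) by auto
    have "?P (m \<otimes> s)"
      using s mc descent_root(2)[OF mc(1) s(1,2)] by auto
    then show False
      using m(2)[of "m \<otimes> s"] descent_root(4)[OF mc(1) s(1,2)] by simp
  qed (use m in auto)
  then show ?thesis
    using m by blast
qed

text \<open>Newman's lemma, by induction on the length of the bound. First steps towards
  \<open>m1\<close> and \<open>m2\<close> along \<open>s\<close> and \<open>t\<close> are completed
  to a diamond; a locally minimal element below its bottom agrees with \<open>m1\<close> below
  \<open>u \<otimes> s\<close> and with \<open>m2\<close> below
  \<open>u \<otimes> t\<close>.\<close>

lemma locally_minimal_unique:
  assumes "w \<in> carrier W" "u \<in> carrier W"
    and "locally_minimal w m1" "inv_set m1 \<subseteq> inv_set u"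
    and "locally_minimal w m2" "inv_set m2 \<subseteq> inv_set u"
  shows "m1 = m2"
  using assms(2-)
proof (induction "len u" arbitrary: u m1 m2 rule: less_induct)
  case less
  let ?X = "small_roots \<inter> inv_set w"
  have m: "m1 \<in> carrier W" "?X \<subseteq> inv_set m1" "m2 \<in> carrier W" "?X \<subseteq> inv_set m2"
    using less.prems by (auto simp: locally_minimal_def)
  have *: "m = u" if lm: "locally_minimal w u" and m: "m \<in> carrier W" "?X \<subseteq> inv_set m" "inv_set m \<subseteq> inv_set u" for m
  proof (rule ccontr)
    assume "m \<noteq> u"
    then obtain s where "s \<in> S" "act u (\<alpha> s) \<notin> pos_roots" "inv_set m \<subseteq> inv_set (u \<otimes> s)"
      using inv_set_subset_descent[OF m(1) less.prems(1) m(3)] by blast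
    then show False
      using lm m(2) unfolding locally_minimal_def by blast
  qed
  show ?case
  proof (cases "m1 = u \<or> m2 = u")
    case True
    then show ?thesis
      using * m less.prems by metis
  next
    case False
    obtain s where s: "s \<in> S" "act u (\<alpha> s) \<notin> pos_roots" "inv_set m1 \<subseteq> inv_set (u \<otimes> s)"
      using inv_set_subset_descent[of m1 u] m less.prems False by blast
    obtain t where t: "t \<in> S" "act u (\<alpha> t) \<notin> pos_roots" "inv_set m2 \<subseteq> inv_set (u \<otimes> t)"
      using inv_set_subset_descent[of m2 u] m less.prems False by blast
    have us: "len (u \<otimes> s) < len u" "u \<otimes> s \<in> carrier W" "len (u \<otimes> t) < len u" "u \<otimes> t \<in> carrier W"
      using descent_root(4)[OF less.prems(1) s(1,2)] descent_root(4)[OF less.prems(1) t(1,2)]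
        s(1) t(1) less.prems(1) by simp_all
    show ?thesis
    proof (cases "s = t")
      case True
      then show ?thesis
        using less.hyps[OF us(1,2) less.prems(2) s(3) less.prems(4)] t(3) by simp
    next
      case False
      have "?X \<subseteq> inv_set (u \<otimes> s)" "?X \<subseteq> inv_set (u \<otimes> t)"
        using m(2,4) s(3) t(3) by auto
      then obtain u0 where u0: "u0 \<in> carrier W" "inv_set u0 \<subseteq> inv_set (u \<otimes> s)"
        "inv_set u0 \<subseteq> inv_set (u \<otimes> t)" "?X \<subseteq> inv_set u0"
        by (rule diamond[OF assms(1) less.prems(1) s(1) t(1) False s(2) t(2)]) (rule that, assumption+)
      obtain m0 where m0: "locally_minimal w m0" "inv_set m0 \<subseteq> inv_set u0"
        using ex_locally_minimal[OF u0(1,4)] by blast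
      have "m1 = m0"
        using less.hyps[OF us(1,2) less.prems(2) s(3) m0(1)] m0(2) u0(2) by blast
      moreover have "m2 = m0"
        using less.hyps[OF us(3,4) less.prems(4) t(3) m0(1)] m0(2) u0(3) by blast
      ultimately show ?thesis
        by simp
    qed
  qed
qed

lemma locally_minimal_self:
  assumes "w \<in> carrier W" "\<And>s. s \<in> S \<Longrightarrow> act w (\<alpha> s) \<notin> pos_roots \<Longrightarrow> - act w (\<alpha> s) \<in> small_roots"
  shows "locally_minimal w w"
  unfolding locally_minimal_def
proof (intro conjI ballI impI)
  fix s assume s: "s \<in> S" "act w (\<alpha> s) \<notin> pos_roots"
  have "- act w (\<alpha> s) \<in> small_roots \<inter> inv_set w"
    using assms(2)[OF s] descent_root(2)[OF assms(1) s] by blast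
  then show "\<not> small_roots \<inter> inv_set w \<subseteq> inv_set (w \<otimes> s)"
    using descent_root(3)[OF assms(1) s] by blast
qed (use assms in auto)

text \<open>Only a downward step can hurt. A locally minimal element below
  \<open>u \<otimes> s\<close> also lies below \<open>u\<close>, where uniqueness identifies it with
  \<open>w\<close>.\<close>

lemma inv_set_mono_step:
  assumes w: "w \<in> carrier W" "locally_minimal w w" and u: "u \<in> carrier W" "inv_set w \<subseteq> inv_set u"
    and s: "s \<in> S" "small_roots \<inter> inv_set w \<subseteq> inv_set (u \<otimes> s)"
  shows "inv_set w \<subseteq> inv_set (u \<otimes> s)"
proof (cases "act u (\<alpha> s) \<in> pos_roots")
  case True
  then show ?thesis
    using inv_set_mult_ascent(1)[OF u(1) s(1)] u by blast
next
  case False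
  have us: "u \<otimes> s \<in> carrier W"
    using u s by simp
  obtain m where m: "locally_minimal w m" "inv_set m \<subseteq> inv_set (u \<otimes> s)"
    using ex_locally_minimal[OF us s(2)] by blast
  then have "inv_set m \<subseteq> inv_set u"
    using descent_root(2)[OF u(1) s(1) False] by blast
  then show ?thesis
    using locally_minimal_unique[OF w(1) u(1) m(1) _ w(2) u(2)] m by blast
qed

end


subsection \<open>Low elements from small descents\<close>

lemma convex_cone_hull_image_subset:
  assumes "linear T"
  shows "convex_cone hull (T ` X) \<subseteq> T ` (convex_cone hull X)"
  using assms convex_cone_convex_cone_hull
  by (intro hull_minimal image_mono hull_subset convex_cone_linear_image) blast+

text \<open>
  Farkas' lemma in a real vector space without topology. In the induction step, a functional \<open>f\<close>
  with \<open>f a < 0\<close> is corrected by projecting along \<open>a\<close> onto the kernel of \<open>f\<close>.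
\<close>

lemma farkas_finite:
  fixes b :: "'a::real_vector"
  assumes "finite X" "b \<notin> convex_cone hull X"
  shows "\<exists>f. linear f \<and> (\<forall>x\<in>X. f x \<ge> (0::real)) \<and> f b < 0"
  using assms
proof (induction "card X" arbitrary: X b rule: less_induct)
  case less
  show ?case
  proof (cases "X = {}")
    case True
    then have "b \<noteq> 0"
      using convex_cone_hull_contains_0 less.prems by metis
    then have "independent {b}"
      by simp
    then obtain g :: "'a \<Rightarrow> real" where "linear g" "g b = -1"
      using linear_independent_extend[of "{b}" "\<lambda>_. -1"] by auto
    then show ?thesis
      using True by (intro exI[of _ g]) auto
  next
    case False
    then obtain a where "a \<in> X"
      by blast
    define Y where "Y = X - {a}"
    have X: "X = insert a Y" "card Y < card X" "finite Y"
      using \<open>a \<in> X\<close> less.prems(1) card_Diff1_less[of X a] unfolding Y_def by auto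
    have hullY: "convex_cone hull Y \<subseteq> convex_cone hull X"
      unfolding X by (intro hull_mono) auto
    then obtain f where f: "linear f" "\<And>x. x \<in> Y \<Longrightarrow> f x \<ge> (0::real)" "f b < 0"
      using less.hyps[OF X(2,3), of b] less.prems(2) by blast
    show ?thesis
    proof (cases "f a \<ge> 0")
      case True
      then show ?thesis
        using f X by auto
    next
      case False
      then have fa: "f a < 0"
        by simp
      \<comment> \<open>The projection along \<open>a\<close> onto the kernel of \<open>f\<close>,
        scaled by the positive number \<open>- f a\<close> to avoid a division.\<close>
      define T where "T x = (- f a) *\<^sub>R x + f x *\<^sub>R a" for x
      have T: "linear T"
        using f(1) by (intro linearI) (simp_all add: T_def linear_add linear_scale algebra_simps)
      have fY: "f y \<ge> 0" if y: "y \<in> convex_cone hull Y" for y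
      proof -
        obtain F c where "y = (\<Sum>x\<in>F. c x *\<^sub>R x)" "F \<subseteq> Y" "\<forall>x\<in>F. 0 \<le> c x"
          using y unfolding convex_cone_hull_nonneg_combinations by blast
        then show ?thesis
          using f(1,2) by (auto simp: linear_sum linear_scale intro!: sum_nonneg)
      qed
      have "T b \<notin> convex_cone hull (T ` Y)"
      proof
        assume "T b \<in> convex_cone hull (T ` Y)"
        then obtain y where y: "y \<in> convex_cone hull Y" "T b = T y"
          using convex_cone_hull_image_subset[OF T] by blast
        define m where "m = - f a"
        have m: "m > 0"
          using fa by (simp add: m_def)
        have "m *\<^sub>R b = m *\<^sub>R y + (f y - f b) *\<^sub>R a"
          using y(2) by (simp add: T_def m_def algebra_simps)
        then have "(1 / m) *\<^sub>R (m *\<^sub>R b) = (1 / m) *\<^sub>R (m *\<^sub>R y + (f y - f b) *\<^sub>R a)"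
          by (rule arg_cong)
        then have "b = y + ((f y - f b) / m) *\<^sub>R a"
          using m by (simp add: scaleR_add_right)
        moreover have "(f y - f b) / m \<ge> 0"
          using m f(3) fY[OF y(1)] by (intro divide_nonneg_pos) auto
        moreover have "a \<in> convex_cone hull X"
          unfolding X by (intro hull_inc) simp
        ultimately have "b \<in> convex_cone hull X"
          using y hullY by (metis convex_cone_hull_add convex_cone_hull_mul subsetD)
        then show False
          using less.prems by simp
      qed
      moreover have "card (T ` Y) < card X" "finite (T ` Y)"
        using X card_image_le[of Y T] by auto
      ultimately obtain g where g: "linear g" "\<forall>x\<in>T ` Y. g x \<ge> (0::real)" "g (T b) < 0"
        using less.hyps by blast
      have "linear (\<lambda>x. g (T x))"
        using linear_compose[OF T g(1)] by (simp add: comp_def)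
      moreover have "g (T a) = 0"
        using linear_0[OF g(1)] by (simp add: T_def)
      ultimately show ?thesis
        using g X by (intro exI[of _ "\<lambda>x. g (T x)"]) auto
    qed
  qed
qed


section \<open>Discreteness of the representation and roots of bounded height\<close>

context coxeter_geometric
begin

lemma abs_gram_le: "\<bar>gram s t\<bar> \<le> 1"
  by (simp add: gram_def)

text \<open>
  The geometric representation is discrete: if \<open>r\<^sup>-\<^sup>1 r'\<close> is close to the identity, then it makes all
  simple roots positive and hence is trivial.
\<close>

lemma finite_bounded_elements:
  assumes "K \<ge> 0"
  shows "finite {r \<in> carrier W. \<forall>s\<in>S. \<forall>t\<in>S. \<bar>coord (act r (\<alpha> t)) s\<bar> \<le> K \<and> \<bar>coord (act (inv r) (\<alpha> t)) s\<bar> \<le> K}"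
    (is "finite ?A")
proof -
  define n where "n = real (card S)"
  \<comment> \<open>The mesh is chosen so that a perturbation of size at most
    \<open>n * K * e\<close> cannot cancel the coordinate 1 of a simple root; the summand 1 keeps
    \<open>e\<close> meaningful when \<open>n * K = 0\<close>.\<close>
  define e where "e = 1 / (n * K + 1)"
  have nK: "n * K \<ge> 0"
    using assms by (simp add: n_def)
  then have e: "e > 0" "n * K * e < 1"
    by (simp_all add: e_def divide_simps)
  \<comment> \<open>Matrices are rounded to a grid of mesh \<open>e\<close>: bounded matrices meet
    finitely many cells, and each cell holds at most one group element.\<close>
  define F where "F r = restrict (\<lambda>(s, t). \<lfloor>coord (act r (\<alpha> t)) s / e\<rfloor>) (S \<times> S)" for r
  have "inj_on F ?A"
  proof (rule inj_onI)
    fix r r' assume r: "r \<in> ?A" and r': "r' \<in> ?A" and F: "F r = F r'"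
    have rc: "r \<in> carrier W" "r' \<in> carrier W"
      using r r' by auto
    have close: "\<bar>coord (act r' (\<alpha> t)) s - coord (act r (\<alpha> t)) s\<bar> \<le> e" if "s \<in> S" "t \<in> S" for s t
    proof -
      have "F r (s, t) = F r' (s, t)"
        using F by simp
      then have "\<lfloor>coord (act r (\<alpha> t)) s / e\<rfloor> = \<lfloor>coord (act r' (\<alpha> t)) s / e\<rfloor>"
        using that by (simp add: F_def)
      then have "\<bar>coord (act r' (\<alpha> t)) s / e - coord (act r (\<alpha> t)) s / e\<bar> < 1"
        by linarith
      then have "\<bar>(coord (act r' (\<alpha> t)) s - coord (act r (\<alpha> t)) s) / e\<bar> < 1"
        by (simp add: diff_divide_distrib)
      then show ?thesis
        using e(1) by (simp add: abs_divide field_simps)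
    qed
    define v where "v = inv r \<otimes> r'"
    have v: "v \<in> carrier W"
      using rc by (simp add: v_def)
    have "act v (\<alpha> t) \<in> pos_roots" if t: "t \<in> S" for t
    proof -
      define d where "d = act r' (\<alpha> t) - act r (\<alpha> t)"
      have "act v (\<alpha> t) = \<alpha> t + act (inv r) d"
        using rc by (simp add: v_def d_def act_linear_simps)
      then have c: "coord (act v (\<alpha> t)) t = 1 + coord (act (inv r) d) t"
        using t by (simp add: coord_simps coord_simple)
      have "act (inv r) d = (\<Sum>q\<in>S. coord d q *\<^sub>R act (inv r) (\<alpha> q))"
        using rc by (intro linear_expand) simp
      then have "\<bar>coord (act (inv r) d) t\<bar> = \<bar>\<Sum>q\<in>S. coord d q * coord (act (inv r) (\<alpha> q)) t\<bar>"
        by (simp add: coord_sum coord_simps)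
      also have "\<dots> \<le> (\<Sum>q\<in>S. \<bar>coord d q * coord (act (inv r) (\<alpha> q)) t\<bar>)"
        by (rule sum_abs)
      also have "\<dots> \<le> (\<Sum>q\<in>S. e * K)"
      proof (intro sum_mono)
        fix q assume q: "q \<in> S"
        have "\<bar>coord d q\<bar> \<le> e"
          using close[OF q t] by (simp add: d_def coord_simps)
        moreover have "\<bar>coord (act (inv r) (\<alpha> q)) t\<bar> \<le> K"
          using r q t by auto
        ultimately show "\<bar>coord d q * coord (act (inv r) (\<alpha> q)) t\<bar> \<le> e * K"
          using e(1) by (simp add: abs_mult mult_mono)
      qed
      also have "\<dots> = n * K * e"
        by (simp add: n_def)
      finally have "coord (act v (\<alpha> t)) t > 0"
        using c e(2) by linarith
      then have "\<not> nonneg (- act v (\<alpha> t))"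
        using t by (force simp: nonneg_def coord_simps)
      then show ?thesis
        using root_sign[OF act_root[OF v simple_root[OF t]]] act_root[OF v simple_root[OF t]]
        by (simp add: pos_roots_iff)
    qed
    then have "v = \<one>"
      using eq_one_if_no_descent v by blast
    then show "r = r'"
      using rc by (metis v_def inv_equality inv_inv inv_closed)
  qed
  moreover have "F ` ?A \<subseteq> PiE (S \<times> S) (\<lambda>_. {\<lfloor>- K / e\<rfloor>..\<lfloor>K / e\<rfloor>})"
  proof
    fix f assume "f \<in> F ` ?A"
    then obtain r where r: "r \<in> ?A" "f = F r"
      by blast
    have "\<lfloor>coord (act r (\<alpha> t)) s / e\<rfloor> \<in> {\<lfloor>- K / e\<rfloor>..\<lfloor>K / e\<rfloor>}" if "s \<in> S" "t \<in> S" for s t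
    proof -
      have "- K \<le> coord (act r (\<alpha> t)) s" "coord (act r (\<alpha> t)) s \<le> K"
        using r(1) that by (force simp: abs_le_iff)+
      then show ?thesis
        unfolding atLeastAtMost_iff using less_imp_le[OF e(1)] by (intro conjI floor_mono divide_right_mono)
    qed
    then show "f \<in> PiE (S \<times> S) (\<lambda>_. {\<lfloor>- K / e\<rfloor>..\<lfloor>K / e\<rfloor>})"
      unfolding r(2) F_def by auto
  qed
  moreover have "finite (PiE (S \<times> S) (\<lambda>_. {\<lfloor>- K / e\<rfloor>..\<lfloor>K / e\<rfloor>}))"
    using finite_gens by (intro finite_PiE) auto
  ultimately show ?thesis
    using finite_imageD finite_subset by blast
qed

lemma coord_le_height:
  assumes "nonneg a" "s \<in> S"
  shows "coord a s \<le> height a"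
  using assms finite_gens unfolding height_def nonneg_def by (intro member_le_sum) auto

text \<open>A positive root is determined by its reflection. For height at most M both B(a,
  \<open>\<alpha> t\<close>) and the coordinates of \<open>a\<close> are bounded by M, so the matrix
  entries are bounded by 1 + 2 M^2.\<close>

lemma finite_bounded_roots: "finite {a \<in> pos_roots. height a \<le> M}"
proof (cases "M \<ge> 0")
  case False
  then have "{a \<in> pos_roots. height a \<le> M} = {}"
    using height_nonneg by (force simp: pos_roots_iff)
  then show ?thesis
    by (simp only: finite.emptyI)
next
  case True
  let ?A = "{a \<in> pos_roots. height a \<le> M}"
  define K where "K = 1 + 2 * M * M"
  have "K \<ge> 0"
    using True by (simp add: K_def)
  let ?B = "{r \<in> carrier W. \<forall>s\<in>S. \<forall>t\<in>S. \<bar>coord (act r (\<alpha> t)) s\<bar> \<le> K \<and> \<bar>coord (act (inv r) (\<alpha> t)) s\<bar> \<le> K}"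
  have "\<forall>a\<in>?A. \<exists>r. r \<in> carrier W \<and> (\<forall>x. act r x = reflect a x) \<and> inv r = r"
  proof
    fix a assume "a \<in> ?A"
    then have "a \<in> roots"
      by (simp add: pos_roots_iff)
    then show "\<exists>r. r \<in> carrier W \<and> (\<forall>x. act r x = reflect a x) \<and> inv r = r"
      using ex_reflection[of a] by blast
  qed
  from bchoice[OF this] obtain \<rho> where
    "\<forall>a\<in>?A. \<rho> a \<in> carrier W \<and> (\<forall>x. act (\<rho> a) x = reflect a x) \<and> inv (\<rho> a) = \<rho> a"
    ..
  then have \<rho>: "\<And>a. a \<in> ?A \<Longrightarrow> \<rho> a \<in> carrier W"
    "\<And>a x. a \<in> ?A \<Longrightarrow> act (\<rho> a) x = reflect a x" "\<And>a. a \<in> ?A \<Longrightarrow> inv (\<rho> a) = \<rho> a"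
    by auto
  have "inj_on \<rho> ?A"
  proof (rule inj_onI)
    fix a b assume ab: "a \<in> ?A" "b \<in> ?A" "\<rho> a = \<rho> b"
    have unit: "form a a = 1" "form b b = 1"
      using ab form_root by (auto simp: pos_roots_iff)
    have "reflect b a = - a"
      using \<rho>(2)[OF ab(1), of a] \<rho>(2)[OF ab(2), of a] ab(3) reflect_self[OF unit(1)] by simp
    then have "2 *\<^sub>R a = 2 *\<^sub>R (form b a *\<^sub>R b)"
      by (simp add: reflect_def scaleR_2 algebra_simps)
    then have a: "a = form b a *\<^sub>R b"
      by (rule scaleR_left_imp_eq[rotated]) simp
    define c where "c = form b a"
    have "1 = c\<^sup>2"
      using unit arg_cong[OF a, of "form a"] by (simp add: form_simps form_commute[of a b] c_def power2_eq_square)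
    then have "c = 1 \<or> c = -1"
      by (simp add: power2_eq_1_iff[symmetric])
    moreover have "c \<noteq> -1"
    proof
      assume "c = -1"
      then have "a = - b"
        using a by (simp add: c_def)
      then show False
        using ab root_not_both[of b] by (auto simp: pos_roots_iff)
    qed
    ultimately show "a = b"
      using a by (simp add: c_def)
  qed
  moreover have "\<rho> ` ?A \<subseteq> ?B"
  proof
    fix r assume "r \<in> \<rho> ` ?A"
    then obtain a where a: "a \<in> ?A" "r = \<rho> a"
      by blast
    have ca: "0 \<le> coord a s" "coord a s \<le> M" if "s \<in> S" for s
      using a that coord_le_height[of a s] by (auto simp: pos_roots_iff nonneg_def)
    have "\<bar>coord (act r (\<alpha> t)) s\<bar> \<le> K" if st: "s \<in> S" "t \<in> S" for s t
    proof -
      have "form (\<alpha> t) a = (\<Sum>q\<in>S. coord a q * gram t q)"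
        using st by (subst form_expand) (simp add: form_simple)
      then have "\<bar>form (\<alpha> t) a\<bar> \<le> (\<Sum>q\<in>S. \<bar>coord a q * gram t q\<bar>)"
        by (simp add: sum_abs)
      also have "\<dots> \<le> (\<Sum>q\<in>S. coord a q)"
        using ca abs_gram_le by (intro sum_mono) (simp add: abs_mult mult_left_le)
      also have "\<dots> \<le> M"
        using a by (simp add: height_def)
      finally have f: "\<bar>form a (\<alpha> t)\<bar> \<le> M"
        by (simp add: form_commute)
      have "\<bar>coord (act r (\<alpha> t)) s\<bar> = \<bar>coord (\<alpha> t) s - 2 * form a (\<alpha> t) * coord a s\<bar>"
        using a \<rho>(2) by (simp add: reflect_def coord_simps)
      also have "\<dots> \<le> \<bar>coord (\<alpha> t) s\<bar> + 2 * (\<bar>form a (\<alpha> t)\<bar> * \<bar>coord a s\<bar>)"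
        using abs_triangle_ineq4[of "coord (\<alpha> t) s" "2 * form a (\<alpha> t) * coord a s"] by (simp add: abs_mult)
      also have "\<dots> \<le> 1 + 2 * (M * M)"
        using f ca[OF st(1)] st by (intro add_mono mult_left_mono mult_mono) (auto simp: coord_simple)
      finally show ?thesis
        by (simp add: K_def)
    qed
    then show "r \<in> ?B"
      using a \<rho> by auto
  qed
  ultimately show ?thesis
    using finite_bounded_elements[OF \<open>K \<ge> 0\<close>] finite_imageD finite_subset by blast
qed

text \<open>Among the roots, N(w) is cut out by two conditions closed under nonnegative
  combinations: b and - w^-1 b are both nonnegative.\<close>

lemma convex_cone_hull_inv_set:
  assumes w: "w \<in> carrier W" and b: "b \<in> convex_cone hull (inv_set w)" "b \<in> roots"
  shows "b \<in> inv_set w"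
proof -
  obtain F c where F: "b = (\<Sum>a\<in>F. c a *\<^sub>R a)" "F \<subseteq> inv_set w" "\<forall>a\<in>F. 0 \<le> c a"
    using b(1) unfolding convex_cone_hull_nonneg_combinations by blast
  have "nonneg b"
    using F inv_set_pos[OF w] unfolding F(1)
    by (intro nonneg_sum nonneg_scale) (auto simp: pos_roots_iff)
  moreover have "- act (inv w) b = (\<Sum>a\<in>F. c a *\<^sub>R (- act (inv w) a))"
    using w unfolding F(1) by (simp add: linear_sum linear_scale sum_negf)
  then have "nonneg (- act (inv w) b)"
    using F inv_set_nonpos[OF w] by (simp only:) (intro nonneg_sum nonneg_scale; blast)
  ultimately show ?thesis
    using b(2) w by (intro inv_setI) (auto simp: pos_roots_iff)
qed

end

section \<open>Separating functionals and walks towards them\<close>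

context affine_coxeter
begin

text \<open>
  By compactness, the form is bounded below on the nonnegative vectors of height \<open>1\<close> with \<open>F \<le> 0\<close>.
  Since roots have norm \<open>1\<close>, this bounds the heights of the roots with \<open>F \<le> 0\<close>.
\<close>

lemma finite_roots_below:
  assumes F: "linear F" and Z: "\<And>z. nonneg z \<Longrightarrow> radical z \<Longrightarrow> z \<noteq> 0 \<Longrightarrow> F z > (0::real)"
  shows "finite {a \<in> pos_roots. F a < 0}"
proof -
  \<comment> \<open>Coordinate vectors are functions on the whole type, pinned to 0 outside
    \<open>S\<close>, so that \<open>K\<close> is a closed part of a product of compact
    sets.\<close>
  define K :: "('w \<Rightarrow> real) set" where
    "K = PiE UNIV (\<lambda>s. if s \<in> S then {0..1} else {0}) \<inter>
      ({c. (\<Sum>s\<in>S. c s) = 1} \<inter> {c. (\<Sum>s\<in>S. c s * F (\<alpha> s)) \<le> 0})"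
  define Q where "Q c = (\<Sum>s\<in>S. \<Sum>t\<in>S. c s * c t * gram s t)" for c :: "'w \<Rightarrow> real"
  have "compactin (product_topology (\<lambda>_. euclidean) UNIV) (PiE UNIV (\<lambda>s. if s \<in> S then {0..1::real} else {0}))"
    unfolding compactin_PiE by auto
  then have "compact (PiE UNIV (\<lambda>s. if s \<in> S then {0..1::real} else {0}))"
    by (simp add: euclidean_product_topology)
  moreover have "closed {c::'w \<Rightarrow> real. (\<Sum>s\<in>S. c s) = 1}"
    by (intro closed_Collect_eq continuous_intros continuous_on_product_coordinates)
  moreover have "closed {c::'w \<Rightarrow> real. (\<Sum>s\<in>S. c s * F (\<alpha> s)) \<le> 0}"
    by (intro closed_Collect_le continuous_intros continuous_on_product_coordinates)
  ultimately have "compact K"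
    unfolding K_def by (intro compact_Int_closed closed_Int)
  have "continuous_on UNIV Q"
    unfolding Q_def by (intro continuous_intros continuous_on_product_coordinates)
  then have "continuous_on K Q"
    using continuous_on_subset by blast
  have coeff: "(\<lambda>s. if s \<in> S then coord a s / height a else 0) \<in> K"
    "Q (\<lambda>s. if s \<in> S then coord a s / height a else 0) = 1 / (height a)\<^sup>2"
    if a: "a \<in> pos_roots" "F a < 0" for a
  proof -
    have h: "height a > 0"
      using a height_pos root_nonzero by (auto simp: pos_roots_iff)
    have c: "0 \<le> coord a s" "coord a s \<le> height a" if "s \<in> S" for s
      using that a coord_le_height[of a s] by (auto simp: pos_roots_iff nonneg_def)
    have "(\<Sum>s\<in>S. coord a s / height a) = 1"
      using h by (simp add: height_def sum_divide_distrib[symmetric])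
    moreover have "(\<Sum>s\<in>S. coord a s / height a * F (\<alpha> s)) = F a / height a"
      using linear_expand[OF F, of a] by (simp add: sum_divide_distrib)
    then have "(\<Sum>s\<in>S. coord a s / height a * F (\<alpha> s)) \<le> 0"
      using a h by (simp add: divide_nonpos_pos)
    ultimately show "(\<lambda>s. if s \<in> S then coord a s / height a else 0) \<in> K"
      using c h by (auto simp: K_def PiE_iff)
    have "Q (\<lambda>s. if s \<in> S then coord a s / height a else 0) = form a a / (height a)\<^sup>2"
      unfolding Q_def form_gram sum_divide_distrib by (intro sum.cong) (auto simp: power2_eq_square)
    then show "Q (\<lambda>s. if s \<in> S then coord a s / height a else 0) = 1 / (height a)\<^sup>2"
      using a form_root by (simp add: pos_roots_iff)
  qed
  show ?thesis
  proof (cases "K = {}")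
    case True
    then have "{a \<in> pos_roots. F a < 0} = {}"
      using coeff(1) by blast
    then show ?thesis
      by (simp only: finite.emptyI)
  next
    case False
    then obtain c where c: "c \<in> K" "\<And>d. d \<in> K \<Longrightarrow> Q c \<le> Q d"
      using continuous_attains_inf[OF \<open>compact K\<close> _ \<open>continuous_on K Q\<close>] by blast
    define x where "x = (\<Sum>s\<in>S. c s *\<^sub>R \<alpha> s)"
    have x: "coord x s = c s" if "s \<in> S" for s
      using that by (simp add: x_def coord_combination)
    have Qx: "Q c = form x x"
      unfolding Q_def form_gram by (intro sum.cong) (auto simp: x)
    have c': "\<And>s. c s \<in> (if s \<in> S then {0..1} else {0})" "(\<Sum>s\<in>S. c s) = 1"
      "(\<Sum>s\<in>S. c s * F (\<alpha> s)) \<le> 0"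
      using c(1) by (auto simp: K_def PiE_iff)
    have nx: "nonneg x"
      unfolding nonneg_def
    proof
      fix s assume "s \<in> S"
      then show "0 \<le> coord x s"
        using c'(1)[of s] by (simp add: x)
    qed
    have "height x = 1"
      using c'(2) by (simp add: height_def x)
    then have x0: "x \<noteq> 0"
      by (auto simp: height_def coord_zero)
    have "F x \<le> 0"
      using linear_expand[OF F, of x] c'(3) by (simp add: x)
    \<comment> \<open>The minimum is attained at a nonnegative vector with F <= 0, where by
      \<open>Z\<close> it cannot be radical; so the minimum of the form is positive.\<close>
    then have "\<not> radical x"
      using Z[OF nx _ x0] by linarith
    then have q: "Q c > 0"
      using radicalI[of x] Qx by linarith
    have "{a \<in> pos_roots. F a < 0} \<subseteq> {a \<in> pos_roots. height a \<le> 1 / Q c + 1}"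
    proof
      fix a assume "a \<in> {a \<in> pos_roots. F a < 0}"
      then have a: "a \<in> pos_roots" "F a < 0"
        by auto
      have h: "height a > 0"
        using a height_pos root_nonzero by (auto simp: pos_roots_iff)
      have "Q c \<le> 1 / (height a)\<^sup>2"
        using c(2)[OF coeff(1)[OF a]] coeff(2)[OF a] by simp
      then have "(height a)\<^sup>2 \<le> 1 / Q c"
        using q h by (simp add: field_simps)
      moreover have "height a \<le> (height a)\<^sup>2 + 1"
        using h sum_squares_bound[of "height a" 1] by (simp add: power2_eq_square)
      ultimately have "height a \<le> 1 / Q c + 1"
        by linarith
      then show "a \<in> {a \<in> pos_roots. height a \<le> 1 / Q c + 1}"
        using a by simp
    qed
    then show ?thesis
      using finite_bounded_roots finite_subset by blast
  qed
qed

text \<open>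
  Walk from \<open>w\<close> towards the chamber containing \<open>F\<close>, crossing only walls that separate it from \<open>F\<close>:
  no hyperplane of a small inversion of \<open>w\<close> is crossed.
\<close>

lemma walk_to_functional:
  assumes w: "w \<in> carrier W" "locally_minimal w w"
    and F: "linear F" "\<And>x. x \<in> small_roots \<inter> inv_set w \<Longrightarrow> F x < (0::real)"
    and fin: "finite {a \<in> pos_roots. F a < 0}"
    and b: "b \<in> inv_set w"
  shows "F b \<le> 0"
proof -
  \<comment> \<open>The roots whose hyperplanes strictly separate the chamber of \<open>u\<close>
    from \<open>F\<close>; their number measures the remaining walk.\<close>
  define D where "D u = {a \<in> pos_roots. F a < 0 \<and> a \<notin> inv_set u} \<union> {a \<in> inv_set u. F a > 0}" for u
  have finD: "finite (D u)" if "u \<in> carrier W" for u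
    using fin finite_inv_set[OF that] by (auto simp: D_def intro: finite_subset[OF _ fin])
  have "\<exists>v\<in>carrier W. inv_set w \<subseteq> inv_set v \<and> (\<forall>s\<in>S. F (act v (\<alpha> s)) \<ge> 0)"
    if "u \<in> carrier W" "inv_set w \<subseteq> inv_set u" for u
    using that
  proof (induction "card (D u)" arbitrary: u rule: less_induct)
    case less
    note u = less.prems
    show ?case
    proof (cases "\<forall>s\<in>S. F (act u (\<alpha> s)) \<ge> 0")
      case True
      then show ?thesis
        using u by blast
    next
      case False
      then obtain s where s: "s \<in> S" "F (act u (\<alpha> s)) < 0"
        by force
      have us: "u \<otimes> s \<in> carrier W"
        using u s by simp
      have "D (u \<otimes> s) \<subset> D u \<and> small_roots \<inter> inv_set w \<subseteq> inv_set (u \<otimes> s)"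
      proof (cases "act u (\<alpha> s) \<in> pos_roots")
        case True
        note A = inv_set_mult_ascent[OF u(1) s(1) True]
        have "D (u \<otimes> s) = D u - {act u (\<alpha> s)}" "act u (\<alpha> s) \<in> D u"
          using A s(2) True by (auto simp: D_def)
        then show ?thesis
          using A u(2) by auto
      next
        case False
        note A = descent_root[OF u(1) s(1) False]
        have Fp: "F (- act u (\<alpha> s)) > 0"
          using s(2) F(1) by (simp add: linear_neg)
        then have "D (u \<otimes> s) = D u - {- act u (\<alpha> s)}" "- act u (\<alpha> s) \<in> D u"
          using A(1-3) by (auto simp: D_def)
        moreover have "- act u (\<alpha> s) \<notin> small_roots \<inter> inv_set w"
          using Fp F(2) by force
        then have "small_roots \<inter> inv_set w \<subseteq> inv_set (u \<otimes> s)"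
          using A(2) u(2) by auto
        ultimately show ?thesis
          by auto
      qed
      then have "card (D (u \<otimes> s)) < card (D u)" "small_roots \<inter> inv_set w \<subseteq> inv_set (u \<otimes> s)"
        using psubset_card_mono[OF finD[OF u(1)]] by auto
      then show ?thesis
        using less.hyps[of "u \<otimes> s"] us inv_set_mono_step[OF w u s(1)] by blast
    qed
  qed
  from this[OF w(1)] obtain v where v: "v \<in> carrier W" "inv_set w \<subseteq> inv_set v" "\<And>s. s \<in> S \<Longrightarrow> F (act v (\<alpha> s)) \<ge> 0"
    by blast
  \<comment> \<open>At the end \<open>F\<close> is nonnegative on the images of the simple roots
    under \<open>v\<close>, while \<open>v\<close> still inverts \<open>b\<close>; so
    \<open>F\<close> is nonnegative at \<open>- b\<close>.\<close>
  define y where "y = - act (inv v) b"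
  have y: "nonneg y"
    using inv_set_nonpos[OF v(1), of b] v(2) b by (auto simp: y_def)
  have "linear (\<lambda>x. F (act v x))"
    using linear_compose[OF linear_act[OF v(1)] F(1)] by (simp add: comp_def)
  then have "F (act v y) = (\<Sum>s\<in>S. coord y s * F (act v (\<alpha> s)))"
    using linear_expand[of "\<lambda>x. F (act v x)" y] by simp
  also have "\<dots> \<ge> 0"
    using y v(3) by (auto simp: nonneg_def intro!: sum_nonneg)
  finally show ?thesis
    using v(1) F(1) by (simp add: y_def linear_neg)
qed

lemma inv_set_small_cone:
  assumes w: "w \<in> carrier W" "locally_minimal w w" and b: "b \<in> inv_set w"
  shows "b \<in> convex_cone hull (small_roots \<inter> inv_set w)"
proof (rule ccontr)
  let ?X = "small_roots \<inter> inv_set w"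
  assume notin: "b \<notin> convex_cone hull ?X"
  have "finite ?X"
    using finite_inv_set[OF w(1)] by simp
  then obtain f where f: "linear f" "\<And>x. x \<in> ?X \<Longrightarrow> f x \<ge> (0::real)" "f b < 0"
    using farkas_finite[OF _ notin] by blast
  have bp: "b \<in> pos_roots"
    using b w by (simp add: inv_set_iff)
  \<comment> \<open>The small root \<open>a\<close> is inverted with \<open>b\<close>, so f a >= 0 >
    f b. This gives \<open>- f\<close> the right sign on the radical direction
    \<open>b - a\<close>.\<close>
  obtain a where a: "a \<in> small_roots" "dom_le a b"
    using ex_small_root_below[OF bp] by blast
  have "b \<notin> ?X"
    using notin hull_inc by metis
  then have "a \<noteq> b" "a \<in> ?X"
    using a b w(1) by (auto simp: dom_le_def)
  obtain J where J: "J \<in> irreducible_components" "supported J b"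
    using root_supported bp pos_roots_iff by blast
  define z0 where "z0 = b - a"
  have z0: "radical z0" "nonneg z0" "z0 \<noteq> 0"
    using dom_le_diff[OF a(2) \<open>a \<noteq> b\<close>] \<open>a \<noteq> b\<close> by (auto simp: z0_def)
  have z0_supp: "supported J z0"
    using dom_le_diff(3)[OF a(2) \<open>a \<noteq> b\<close> J] J(2) by (simp add: z0_def supported_def coord_simps)
  have fz0: "f z0 < 0"
    using f(2)[OF \<open>a \<in> ?X\<close>] f(1,3) by (simp add: z0_def linear_diff)
  \<comment> \<open>A point of the chamber of \<open>w\<close>: negative on N(w), and equal to the
    height on the radical because W fixes radical vectors.\<close>
  define g where "g x = height (act (inv w) x)" for x
  have lin_g: "linear g"
    using linear_compose[OF linear_act linear_height, of "inv w"] w(1) unfolding comp_def g_def[abs_def] by simp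
  have g_neg: "g x < 0" if "x \<in> inv_set w" for x
  proof -
    have "act (inv w) x \<noteq> 0"
      using that w(1) root_nonzero[of "act (inv w) x"]
      by (auto simp: inv_set_iff pos_roots_iff root_act_inv_iff)
    then have "height (- act (inv w) x) > 0"
      using inv_set_nonpos[OF w(1) that] by (intro height_pos) auto
    then show ?thesis
      by (simp add: g_def height_simps)
  qed
  have g_rad: "g z = height z" if "radical z" for z
    using that w(1) by (simp add: g_def)
  \<comment> \<open>Since \<open>f\<close> may vanish on small inversions, a multiple of
    \<open>g\<close> is added to make signs strict. This size uses up exactly half of the value
    \<open>- f b\<close> at \<open>b\<close>.\<close>
  define e where "e = f b / (2 * g b)"
  have e: "e > 0" "e * g b = f b / 2"
    using f(3) g_neg[OF b] by (simp_all add: e_def divide_neg_neg)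
  \<comment> \<open>The Farkas functional is kept, with sign reversed, only on the component
    \<open>J\<close> of \<open>b\<close>; \<open>g\<close> replaces it on the others.\<close>
  define F where "F x = - f (restrict_to J x) + g (x - restrict_to J x) + e * g x" for x
  have lin_F: "linear F"
  proof (rule linearI)
    note L = linear_restrict_to[of J]
    show "F (x + y) = F x + F y" for x y
      using f(1) lin_g L by (simp add: F_def linear_add linear_diff algebra_simps)
    show "F (r *\<^sub>R x) = r *\<^sub>R F x" for r x
      using f(1) lin_g L by (simp add: F_def linear_scale linear_diff algebra_simps)
  qed
  have "F x < 0" if x: "x \<in> ?X" for x
  proof -
    have xr: "x \<in> roots"
      using x by (auto simp: small_roots_def pos_roots_iff)
    obtain K where K: "K \<in> irreducible_components" "supported K x"
      using root_supported[OF xr] by blast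
    have gx: "g x < 0" "e * g x < 0"
      using g_neg x e(1) by (auto simp: mult_pos_neg)
    show ?thesis
    proof (cases "K = J")
      case True
      then show ?thesis
        using K gx f(2)[OF x] linear_0[OF lin_g] by (simp add: F_def restrict_to_supported)
    next
      case False
      then have "restrict_to J x = 0"
        using component_disjoint[OF J(1) K(1)] K(2) by (intro restrict_to_disjoint) auto
      then show ?thesis
        using gx linear_0[OF f(1)] by (simp add: F_def)
    qed
  qed
  moreover have "finite {a \<in> pos_roots. F a < 0}"
  proof (rule finite_roots_below[OF lin_F])
    fix z assume z: "nonneg z" "radical z" "z \<noteq> 0"
    let ?y = "restrict_to J z"
    have "form ?y ?y + form (z - ?y) (z - ?y) = 0"
      using form_restrict_split[OF J(1), of z] z(2) by simp
    then have rad: "radical ?y" "radical (z - ?y)"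
      using form_nonneg[of ?y] form_nonneg[of "z - ?y"] by (auto intro!: radicalI)
    \<comment> \<open>One known radical vector controls \<open>f\<close> on the whole nonnegative
      radical of \<open>J\<close>, since that is a single ray.\<close>
    obtain c where c: "c \<ge> 0" "?y = c *\<^sub>R z0"
      using radical_proportional[OF J(1) z0_supp z0(2,1,3) supported_restrict_to nonneg_restrict_to[OF z(1)] rad(1)]
      by blast
    have "f ?y \<le> 0"
      using c fz0 f(1) by (simp add: linear_scale mult_nonneg_nonpos)
    moreover have "g (z - ?y) \<ge> 0"
      using g_rad[OF rad(2)] height_nonneg[OF nonneg_restrict_to_diff[OF z(1)]] by simp
    moreover have "e * g z > 0"
      using e(1) g_rad[OF z(2)] height_pos[OF z(1,3)] by simp
    ultimately show "F z > 0"
      by (simp add: F_def)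
  qed
  ultimately have "F b \<le> 0"
    using walk_to_functional[OF w lin_F _ _ b] by blast
  moreover have "F b = - f b / 2"
    using J(2) linear_0[OF lin_g] e(2) by (simp add: F_def restrict_to_supported)
  ultimately show False
    using f(3) by simp
qed

lemma low_if_small_descents:
  assumes "w \<in> carrier W" "\<And>s. s \<in> S \<Longrightarrow> act w (\<alpha> s) \<notin> pos_roots \<Longrightarrow> - act w (\<alpha> s) \<in> small_roots"
  shows "w \<in> low_elements"
proof -
  let ?X = "small_roots \<inter> inv_set w"
  have "inv_set w \<subseteq> convex_cone hull ?X \<inter> roots"
    using inv_set_small_cone[OF assms(1) locally_minimal_self[OF assms]] inv_set_pos[OF assms(1)]
    by (auto simp: pos_roots_iff)
  moreover have "b \<in> inv_set w" if b: "b \<in> convex_cone hull ?X" "b \<in> roots" for b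
    using convex_cone_hull_inv_set[OF assms(1) _ b(2)] hull_mono[of ?X "inv_set w"] b(1) by blast
  ultimately show ?thesis
    using assms(1) by (auto simp: low_elements_def)
qed

end


subsection \<open>Shi regions\<close>

context affine_coxeter
begin

lemma closed_dual_space: "closed dual_space"
proof -
  have "dual_space = {f. \<forall>x y. f (x + y) = f x + f y} \<inter> {f. \<forall>r x. f (r *\<^sub>R x) = r * f x}"
    by (auto simp: dual_space_def linear_add linear_scale intro!: linearI)
  moreover have "closed \<dots>"
    by (intro closed_Int closed_Collect_all closed_Collect_eq continuous_intros
        continuous_on_product_coordinates)
  ultimately show ?thesis
    by simp
qed

lemma dual_act_dual_space:
  assumes "w \<in> carrier W" "f \<in> dual_space"
  shows "dual_act w f \<in> dual_space"
  using linear_compose[OF linear_act, of "inv w" f] assms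
  by (simp add: dual_space_def dual_act_def comp_def)

lemma tits_cone_dual_space: "tits_cone \<subseteq> dual_space"
proof -
  have "closure fund_chamber \<subseteq> dual_space"
    by (rule closure_minimal[OF _ closed_dual_space]) (auto simp: fund_chamber_def)
  then show ?thesis
    using dual_act_dual_space by (auto simp: tits_cone_def)
qed

lemma height_fund_chamber: "height \<in> fund_chamber"
  by (simp add: fund_chamber_def dual_space_def linear_height height_simple)

text \<open>Evaluation at \<open>a\<close> is continuous and has no zero on a Shi region, so its
  sign is constant there. The translates of \<open>height\<close> are points of the two chambers
  where the sign shows whether \<open>a\<close> is inverted.\<close>

lemma shi_equiv_small_inversion:
  assumes u: "u \<in> carrier W" and w: "w \<in> carrier W" and uw: "shi_equiv u w"
    and a: "a \<in> small_roots" "a \<in> inv_set w"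
  shows "a \<in> inv_set u"
proof (rule ccontr)
  assume notin: "a \<notin> inv_set u"
  obtain R where R: "R \<in> shi_regions" "dual_act u ` fund_chamber \<subseteq> R" "dual_act w ` fund_chamber \<subseteq> R"
    using uw by (auto simp: shi_equiv_def)
  have ap: "a \<in> pos_roots"
    using a by (simp add: small_roots_def)
  have RT: "R \<subseteq> tits_cone - (\<Union>a\<in>small_roots. hyperplane a)" "connected R"
    using in_components_subset[OF R(1)[unfolded shi_regions_def]]
      in_components_connected[OF R(1)[unfolded shi_regions_def]] by auto
  have nz: "f a \<noteq> 0" if "f \<in> R" for f
  proof
    assume "f a = 0"
    moreover have "f \<in> dual_space" "f \<notin> hyperplane a"
      using that RT(1) a(1) tits_cone_dual_space by auto
    ultimately show False
      by (simp add: hyperplane_def)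
  qed
  have "continuous_on R (\<lambda>f. f a)"
    by (rule continuous_on_subset[OF continuous_on_product_coordinates]) simp
  then have conn: "connected ((\<lambda>f. f a) ` R)"
    using RT(2) connected_continuous_image by blast
  have "act (inv w) a \<noteq> 0"
    using ap w root_nonzero[of "act (inv w) a"] by (simp add: pos_roots_iff root_act_inv_iff)
  then have "height (- act (inv w) a) > 0"
    using inv_set_nonpos[OF w a(2)] by (intro height_pos) auto
  then have neg: "dual_act w height a < 0"
    by (simp add: dual_act_def height_simps)
  have "nonneg (act (inv u) a)"
    using notin ap u by (simp add: inv_set_iff)
  then have pos: "dual_act u height a \<ge> 0"
    by (simp add: dual_act_def height_nonneg)
  have "dual_act w height \<in> R" "dual_act u height \<in> R"
    using R height_fund_chamber by auto
  then have "0 \<in> (\<lambda>f. f a) ` R"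
    using connectedD_interval[OF conn, of "dual_act w height a" "dual_act u height a" 0] neg pos by auto
  then show False
    using nz by auto
qed

text \<open>The open fundamental chamber together with its relatively open facet on the wall of
  \<open>\<alpha> s\<close>. Two adjacent translates share this facet, so their union is
  connected.\<close>

definition chamber_with_facet :: "'w \<Rightarrow> ('v \<Rightarrow> real) set" where
  "chamber_with_facet s = {f \<in> dual_space. (\<forall>t\<in>S. t \<noteq> s \<longrightarrow> f (\<alpha> t) > 0) \<and> f (\<alpha> s) \<ge> 0}"

text \<open>Adding a small positive multiple of \<open>height\<close> moves a point of the facet
  into the open chamber.\<close>

lemma chamber_with_facet_closure: "chamber_with_facet s \<subseteq> closure fund_chamber"
proof
  fix f assume f: "f \<in> chamber_with_facet s"
  define h where "h t x = f x + t * height x" for t x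
  have "linear f"
    using f by (simp add: chamber_with_facet_def dual_space_def)
  then have lin: "linear (h t)" for t
    using linear_height unfolding h_def[abs_def]
    by (intro linearI) (simp_all add: linear_add linear_scale algebra_simps)
  have pos: "h t (\<alpha> r) > 0" if "t > 0" "r \<in> S" for t r
    using f that by (cases "r = s") (auto simp: h_def chamber_with_facet_def height_simple add_nonneg_pos)
  have "h ` {0<..} \<subseteq> closure fund_chamber"
    using lin pos closure_subset by (fastforce simp: fund_chamber_def dual_space_def)
  moreover have "continuous_on (closure {0<..}) h"
    unfolding h_def[abs_def] by (intro continuous_intros)
  ultimately have "h ` closure {0<..} \<subseteq> closure fund_chamber"
    by (intro image_closure_subset) auto
  moreover have "h 0 = f"
    by (simp add: h_def fun_eq_iff)
  ultimately show "f \<in> closure fund_chamber"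
    by force
qed

lemma connected_chamber_with_facet: "connected (dual_act w ` chamber_with_facet s)"
proof (subst connected_iff_connected_component, intro ballI)
  fix F G assume F: "F \<in> dual_act w ` chamber_with_facet s" and G: "G \<in> dual_act w ` chamber_with_facet s"
  obtain f where f: "f \<in> chamber_with_facet s" "F = dual_act w f"
    using F by (rule imageE)
  obtain g where g: "g \<in> chamber_with_facet s" "G = dual_act w g"
    using G by (rule imageE)
  define h where "h t x = (1 - t) * f x + t * g x" for t x
  have h: "h t \<in> chamber_with_facet s" if "t \<in> {0..1}" for t
  proof -
    have "linear f" "linear g"
      using f g by (auto simp: chamber_with_facet_def dual_space_def)
    then have "linear (h t)"
      unfolding h_def[abs_def] by (intro linearI) (simp_all add: linear_add linear_scale algebra_simps)
    moreover have "h t (\<alpha> r) > 0" if "r \<in> S" "r \<noteq> s" for r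
    proof -
      have "f (\<alpha> r) > 0" "g (\<alpha> r) > 0"
        using f g that by (auto simp: chamber_with_facet_def)
      then show ?thesis
        using \<open>t \<in> {0..1}\<close> unfolding h_def
        by (cases "t = 0") (auto intro!: add_nonneg_pos)
    qed
    moreover have "h t (\<alpha> s) \<ge> 0"
      using f g that by (auto simp: h_def chamber_with_facet_def)
    ultimately show ?thesis
      by (simp add: chamber_with_facet_def dual_space_def)
  qed
  have "continuous_on {0..1} (\<lambda>t. dual_act w (h t))"
    unfolding dual_act_def h_def by (intro continuous_intros)
  then have "connected ((\<lambda>t. dual_act w (h t)) ` {0..1})"
    by (intro connected_continuous_image) auto
  moreover have "(\<lambda>t. dual_act w (h t)) ` {0..1} \<subseteq> dual_act w ` chamber_with_facet s"
    using h by auto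
  moreover have "h 0 = f" "h 1 = g"
    by (simp_all add: h_def fun_eq_iff)
  then have "F \<in> (\<lambda>t. dual_act w (h t)) ` {0..1}" "G \<in> (\<lambda>t. dual_act w (h t)) ` {0..1}"
    using f g by (auto intro: image_eqI[of _ _ 0] image_eqI[of _ _ 1])
  ultimately show "connected_component (dual_act w ` chamber_with_facet s) F G"
    unfolding connected_component_def by blast
qed

text \<open>The value at \<open>b\<close> is a sum of nonnegative terms, so every coordinate with a
  positive factor vanishes. Hence the set meets no root hyperplane except that of
  \<open>\<alpha> s\<close>.\<close>

lemma chamber_with_facet_root_zero:
  assumes f: "f \<in> chamber_with_facet s" "s \<in> S" and b: "b \<in> pos_roots" "f b = 0"
  shows "b = \<alpha> s"
proof (rule root_multiple_simple[OF b(1) f(2)])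
  have lin: "linear f"
    using f by (simp add: chamber_with_facet_def dual_space_def)
  have fpos: "f (\<alpha> t) \<ge> 0" "t \<noteq> s \<Longrightarrow> f (\<alpha> t) > 0" if "t \<in> S" for t
    using f that by (auto simp: chamber_with_facet_def intro: less_imp_le)
  fix t assume t: "t \<in> S" "t \<noteq> s"
  have "(\<Sum>r\<in>S. coord b r * f (\<alpha> r)) = 0"
    using linear_expand[OF lin, of b] b(2) by simp
  moreover have "coord b r * f (\<alpha> r) \<ge> 0" if "r \<in> S" for r
    using fpos(1)[OF that] b(1) that by (simp add: pos_roots_iff nonneg_def)
  ultimately have "coord b t * f (\<alpha> t) = 0"
    using sum_nonneg_eq_0_iff[OF finite_gens, of "\<lambda>r. coord b r * f (\<alpha> r)"] t by simp
  then show "coord b t = 0"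
    using fpos(2)[OF t] by simp
qed

lemma chamber_with_facet_avoids:
  assumes v: "v \<in> carrier W" and s: "s \<in> S"
    and "act v (\<alpha> s) \<notin> small_roots" "- act v (\<alpha> s) \<notin> small_roots"
  shows "dual_act v ` chamber_with_facet s \<subseteq> tits_cone - (\<Union>a\<in>small_roots. hyperplane a)"
proof
  fix F assume "F \<in> dual_act v ` chamber_with_facet s"
  then obtain f where f: "f \<in> chamber_with_facet s" "F = dual_act v f"
    by blast
  have "F \<in> tits_cone"
    using f v chamber_with_facet_closure unfolding tits_cone_def by blast
  moreover have "F a \<noteq> 0" if a: "a \<in> small_roots" for a
  proof
    assume "F a = 0"
    then have fa: "f (act (inv v) a) = 0"
      by (simp add: f dual_act_def)
    have root: "act (inv v) a \<in> roots"
      using a v by (simp add: root_act_inv_iff small_roots_def pos_roots_iff)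
    have "f (- act (inv v) a) = 0"
      using fa f(1) by (simp add: chamber_with_facet_def dual_space_def linear_neg)
    moreover have "act (inv v) a \<in> pos_roots \<or> - act (inv v) a \<in> pos_roots"
      using root root_sign minus_root by (auto simp: pos_roots_iff)
    ultimately have "act (inv v) a = \<alpha> s \<or> - act (inv v) a = \<alpha> s"
      using chamber_with_facet_root_zero[OF f(1) s] fa by blast
    then have "a = act v (\<alpha> s) \<or> a = - act v (\<alpha> s)"
      using v by (metis act_act_inv act_minus minus_minus)
    then show False
      using a assms by auto
  qed
  ultimately show "F \<in> tits_cone - (\<Union>a\<in>small_roots. hyperplane a)"
    by (auto simp: hyperplane_def)
qed

lemma shi_equiv_across_large_wall:
  assumes w: "w \<in> carrier W" and s: "s \<in> S"
    and large: "act w (\<alpha> s) \<notin> small_roots" "- act w (\<alpha> s) \<notin> small_roots"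
  shows "shi_equiv (w \<otimes> s) w"
proof -
  let ?E = "chamber_with_facet s"
  let ?T = "tits_cone - (\<Union>a\<in>small_roots. hyperplane a)"
  define Y where "Y = dual_act (w \<otimes> s) ` ?E \<union> dual_act w ` ?E"
  \<comment> \<open>An explicit point of the facet: 0 on \<open>\<alpha> s\<close> and 1 on the
    other simple roots. It is fixed by \<open>s\<close>, so its translates by \<open>w\<close> and
    \<open>w \<otimes> s\<close> coincide and link the two chambers.\<close>
  define f where "f x = height x - coord x s" for x
  have lin: "linear f"
    unfolding f_def by (intro linearI) (auto simp: height_simps coord_simps algebra_simps)
  have f: "f \<in> ?E" "f (\<alpha> s) = 0"
    using lin s by (auto simp: chamber_with_facet_def dual_space_def f_def height_simple coord_simple)
  have "f (sref s x) = f x" for x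
    using f(2) lin by (simp add: reflect_def linear_diff linear_scale)
  then have "dual_act (w \<otimes> s) f = dual_act w f"
    using w s by (simp add: dual_act_def inv_mult_group fun_eq_iff)
  then have "dual_act w f \<in> dual_act (w \<otimes> s) ` ?E \<inter> dual_act w ` ?E"
    using f(1) by (metis IntI imageI)
  then have "connected Y"
    unfolding Y_def by (intro connected_Un connected_chamber_with_facet) blast
  moreover have "Y \<subseteq> ?T"
    unfolding Y_def using chamber_with_facet_avoids[OF w s large]
      chamber_with_facet_avoids[of "w \<otimes> s" s] w s large by (simp add: reflect_self)
  moreover have "Y \<noteq> {}"
    using f(1) by (auto simp: Y_def)
  ultimately obtain R where "R \<in> components ?T" "Y \<subseteq> R"
    using exists_component_superset[of Y ?T] by blast
  moreover have "fund_chamber \<subseteq> ?E"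
    using s by (auto simp: fund_chamber_def chamber_with_facet_def less_imp_le)
  then have "dual_act (w \<otimes> s) ` fund_chamber \<subseteq> Y" "dual_act w ` fund_chamber \<subseteq> Y"
    unfolding Y_def by (auto intro: image_mono)
  ultimately show ?thesis
    unfolding shi_equiv_def shi_regions_def by (meson order_trans)
qed

lemma shi_minimal_eq_low: "shi_minimal_elements = low_elements"
proof (intro equalityI subsetI)
  fix w assume "w \<in> shi_minimal_elements"
  then have w: "w \<in> carrier W" "\<And>u. u \<in> carrier W \<Longrightarrow> shi_equiv u w \<Longrightarrow> len w \<le> len u"
    by (auto simp: shi_minimal_elements_def)
  show "w \<in> low_elements"
  proof (rule low_if_small_descents[OF w(1)], rule ccontr)
    fix s assume s: "s \<in> S" "act w (\<alpha> s) \<notin> pos_roots" "- act w (\<alpha> s) \<notin> small_roots"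
    then have "act w (\<alpha> s) \<notin> small_roots"
      by (auto simp: small_roots_def)
    then have "shi_equiv (w \<otimes> s) w"
      using shi_equiv_across_large_wall w(1) s by blast
    then have "len w \<le> len (w \<otimes> s)"
      using w s by simp
    then show False
      using descent_root(4)[OF w(1) s(1,2)] by simp
  qed
next
  fix w assume "w \<in> low_elements"
  then have w: "w \<in> carrier W" "inv_set w = convex_cone hull (small_roots \<inter> inv_set w) \<inter> roots"
    by (auto simp: low_elements_def)
  show "w \<in> shi_minimal_elements"
    unfolding shi_minimal_elements_def
  proof (intro CollectI conjI ballI impI)
    fix u assume u: "u \<in> carrier W" "shi_equiv u w"
    have "small_roots \<inter> inv_set w \<subseteq> inv_set u"
      using shi_equiv_small_inversion[OF u(1) w(1) u(2)] by blast
    then have "convex_cone hull (small_roots \<inter> inv_set w) \<subseteq> convex_cone hull (inv_set u)"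
      by (rule hull_mono)
    then have "inv_set w \<subseteq> inv_set u"
      using w(2) convex_cone_hull_inv_set[OF u(1)] by blast
    then show "len w \<le> len u"
      using len_mono_inv_set w(1) u(1) by blast
  qed (use w in simp)
qed

end

theorem theorem1p2:
  fixes W :: "('w, 'b) monoid_scheme" and S :: "'w set" and \<alpha> :: "'w \<Rightarrow> 'v::real_vector"
  assumes "coxeter_geometric W S \<alpha>"
    and "coxeter_geometric.affine_system W S \<alpha>"
  shows "coxeter_geometric.shi_minimal_elements W S \<alpha> = coxeter_geometric.low_elements W S \<alpha>"
proof -
  interpret affine_coxeter W S \<alpha>
    using assms by (intro affine_coxeter.intro affine_coxeter_axioms.intro)
  show ?thesis
    by (rule shi_minimal_eq_low)
qed

end
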